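(* Let $n=1$, let $m_0:(0,\infty)\to(0,1]$ be in $L^1(0,\infty)$, and let $c_0>0$, $R_E>0$, $C_V,E_\infty\in\mathbb{R}$ and $E>E_\infty$. Then there is $C>0$ such that for all $\delta_0>0$ there is $h_0\in(0,1]$ such that for all $s>1/2$ there is $C_s>0$ such that for all $V\in L^\infty(\mathbb{R};\mathbb{R})$ satisfying $$\limsup_{y\to0}\sup_{x}\frac{|V(x)-V(x+y)|}{m_0(|x|)}\le c_0,$$ $\delta_0\le\delta_{0,V}$, $\sup_{\mathbb{R}}V\le C_V$, $V_\infty\le E_\infty$ and $R_{E,V}\le R_E$, one has, for both choices of sign, $$g_s^\pm(h,\varepsilon)\le C_s\exp\left(Ch^{-1}\right),\qquad\varepsilon>0,\ h\in(0,h_0],$$ where $$g_s^\pm(h,\varepsilon):=\|\langle x\rangle^{-s}(P(h)-E\pm i\varepsilon)^{-1}\langle x\rangle^{-s}\|_{L^2(\mathbb{R})\to L^2(\mathbb{R})}.$$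
   Context: $\langle x\rangle:=(1+|x|^2)^{1/2}$. $P(h):=-h^2\partial_x^2+V$, $h>0$, self-adjoint on $L^2(\mathbb{R})$ with domain $H^2(\mathbb{R})$. $V$ is a bounded measurable real function whose pointwise values are used in the conditions. Define $$V_\infty:=\limsup_{|x|\to\infty}V(x),\qquad \delta_{0,V}:=\inf\Big\{y>0\ \Big|\ \sup_x\frac{|V(x)-V(x+y)|}{m_0(|x|)}>2c_0\Big\}$$ (with $\inf\emptyset=+\infty$), and, for $E>V_\infty$, $$R_{E,V}:=\sup\Big\{|x|\ \Big|\ V(x)>\frac{E+3V_\infty}{4}\Big\}$$ (with $\sup\emptyset=0$). *)

theory Defs
  imports "HOL-Analysis.Analysis"
begin

section \<open>The spaces \<open>L\<^sup>2(\<real>)\<close> and \<open>H\<^sup>2(\<real>)\<close>\<close>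

text \<open>Elements are represented by functions; equality in \<open>L\<^sup>2\<close> is equality almost everywhere.\<close>

definition L2 :: "(real \<Rightarrow> complex) set" where
  "L2 = {f. f \<in> borel_measurable lebesgue \<and> integrable lebesgue (\<lambda>x. (cmod (f x))\<^sup>2)}"

definition L2_norm :: "(real \<Rightarrow> complex) \<Rightarrow> real" where
  "L2_norm f = sqrt (\<integral>x. (cmod (f x))\<^sup>2 \<partial>lebesgue)"

definition test_function :: "(real \<Rightarrow> real) \<Rightarrow> bool" where
  "test_function \<phi> \<longleftrightarrow>
     (\<forall>n x. (deriv ^^ n) \<phi> differentiable (at x)) \<and> (\<exists>R. \<forall>x. R < \<bar>x\<bar> \<longrightarrow> \<phi> x = 0)"

definition has_weak_derivative :: "nat \<Rightarrow> (real \<Rightarrow> complex) \<Rightarrow> (real \<Rightarrow> complex) \<Rightarrow> bool" where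
  "has_weak_derivative k u v \<longleftrightarrow>
     (\<forall>\<phi>. test_function \<phi> \<longrightarrow>
        (\<integral>x. (deriv ^^ k) \<phi> x *\<^sub>R u x \<partial>lebesgue) = (-1) ^ k * (\<integral>x. \<phi> x *\<^sub>R v x \<partial>lebesgue))"

definition H2 :: "(real \<Rightarrow> complex) set" where
  "H2 = {u \<in> L2. \<forall>k\<in>{1, 2}. \<exists>v\<in>L2. has_weak_derivative k u v}"

text \<open>A representative of the weak derivative, which is unique only up to a null set.\<close>

definition weak_derivative :: "nat \<Rightarrow> (real \<Rightarrow> complex) \<Rightarrow> real \<Rightarrow> complex" where
  "weak_derivative k u = (SOME v. v \<in> L2 \<and> has_weak_derivative k u v)"


section \<open>The operator \<open>P(h) = -h\<^sup>2 \<partial>\<^sub>x\<^sup>2 + V\<close> with domain \<open>H\<^sup>2(\<real>)\<close> and its resolvent\<close>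

definition schroedinger :: "(real \<Rightarrow> real) \<Rightarrow> real \<Rightarrow> (real \<Rightarrow> complex) \<Rightarrow> real \<Rightarrow> complex" where
  "schroedinger V h u x = - (of_real (h\<^sup>2) * weak_derivative 2 u x) + of_real (V x) * u x"

definition resolvent_eq ::
    "(real \<Rightarrow> real) \<Rightarrow> real \<Rightarrow> complex \<Rightarrow> (real \<Rightarrow> complex) \<Rightarrow> (real \<Rightarrow> complex) \<Rightarrow> bool" where
  "resolvent_eq V h z f u \<longleftrightarrow>
     u \<in> H2 \<and> (AE x in lebesgue. schroedinger V h u x - z * u x = f x)"

text \<open>\<open>P(h) - z\<close> is a bijection from \<open>H\<^sup>2\<close> onto \<open>L\<^sup>2\<close> (modulo null sets).\<close>

definition shift_bijective :: "(real \<Rightarrow> real) \<Rightarrow> real \<Rightarrow> complex \<Rightarrow> bool" where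
  "shift_bijective V h z \<longleftrightarrow>
     (\<forall>f\<in>L2. \<exists>u. resolvent_eq V h z f u) \<and>
     (\<forall>f\<in>L2. \<forall>u v. resolvent_eq V h z f u \<longrightarrow> resolvent_eq V h z f v \<longrightarrow>
        (AE x in lebesgue. u x = v x))"

definition resolvent ::
    "(real \<Rightarrow> real) \<Rightarrow> real \<Rightarrow> complex \<Rightarrow> (real \<Rightarrow> complex) \<Rightarrow> real \<Rightarrow> complex" where
  "resolvent V h z f = (SOME u. resolvent_eq V h z f u)"

definition japanese_bracket :: "real \<Rightarrow> real" where
  "japanese_bracket x = sqrt (1 + \<bar>x\<bar>\<^sup>2)"

definition weight :: "real \<Rightarrow> (real \<Rightarrow> complex) \<Rightarrow> real \<Rightarrow> complex" where
  "weight s f x = of_real (japanese_bracket x powr (- s)) * f x"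

definition L2_operator_norm :: "((real \<Rightarrow> complex) \<Rightarrow> (real \<Rightarrow> complex)) \<Rightarrow> ereal" where
  "L2_operator_norm T = (SUP f\<in>{f \<in> L2. L2_norm f \<le> 1}. ereal (L2_norm (T f)))"

text \<open>
  The sign is \<open>\<sigma> \<in> {1, -1}\<close>: with \<open>z = E - \<sigma> i \<epsilon>\<close> one has \<open>P(h) - z = P(h) - E + \<sigma> i \<epsilon>\<close>.
  The value is \<open>\<infinity>\<close> if \<open>P(h) - z\<close> has no inverse (which never happens for bounded measurable
  real \<open>V\<close>, \<open>h > 0\<close> and \<open>\<epsilon> > 0\<close>, by self-adjointness), so that a finite bound on it asserts in
  particular that the inverse exists.
\<close>

definition weighted_resolvent_norm ::
    "real \<Rightarrow> (real \<Rightarrow> real) \<Rightarrow> real \<Rightarrow> real \<Rightarrow> real \<Rightarrow> real \<Rightarrow> ereal" where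
  "weighted_resolvent_norm \<sigma> V E s h \<epsilon> =
     (let z = Complex E (- \<sigma> * \<epsilon>) in
      if shift_bijective V h z
      then L2_operator_norm (\<lambda>f. weight s (resolvent V h z (weight s f)))
      else \<infinity>)"


section \<open>Quantities attached to the potential\<close>

definition V_infinity :: "(real \<Rightarrow> real) \<Rightarrow> ereal" where
  "V_infinity V = Limsup at_infinity (\<lambda>x. ereal (V x))"

text \<open>
  The supremum omits \<open>x = 0\<close>, because \<open>m0\<close> is a function on \<open>(0, \<infinity>)\<close> and \<open>m0 0\<close> has no meaning.
\<close>

definition relative_oscillation :: "(real \<Rightarrow> real) \<Rightarrow> (real \<Rightarrow> real) \<Rightarrow> real \<Rightarrow> ereal" where
  "relative_oscillation m0 V y = (SUP x\<in>- {0}. ereal (\<bar>V x - V (x + y)\<bar> / m0 \<bar>x\<bar>))"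

definition delta0 :: "(real \<Rightarrow> real) \<Rightarrow> real \<Rightarrow> (real \<Rightarrow> real) \<Rightarrow> ereal" where
  "delta0 m0 c0 V = (INF y\<in>{y. 0 < y \<and> relative_oscillation m0 V y > ereal (2 * c0)}. ereal y)"

text \<open>Inserting \<open>0\<close> implements the convention that the empty supremum is \<open>0\<close>.\<close>

definition R_energy :: "real \<Rightarrow> (real \<Rightarrow> real) \<Rightarrow> ereal" where
  "R_energy E V =
     Sup (insert 0 {ereal \<bar>x\<bar> | x. ereal (V x) > (ereal E + 3 * V_infinity V) / 4})"

end

theory Submission
  imports Defs
begin

text \<open>
  Replace the potential by \<open>E - W\<close>, where \<open>W\<close> is the average of \<open>max \<kappa> (E - V)\<close>, \<open>\<kappa> = 3 (E - E_inf) / 4\<close>,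
  over intervals of length \<open>\<delta>0 / 2\<close>. By the oscillation condition \<open>W'\<close> is integrable, with a bound
  depending on \<open>\<delta>0\<close>, and \<open>V - E + W\<close> is the sum of a multiple of \<open>m0\<close> and of a bounded function
  supported where \<open>\<bar>x\<bar> \<le> R_E\<close>, with bounds independent of \<open>\<delta>0\<close>. A solution of
  \<open>h p' = (V - z) u - f\<close>, \<open>p = h u'\<close>, therefore satisfies a Gronwall inequality for the energy
  \<open>\<bar>p\<bar>\<^sup>2 + W \<bar>u\<bar>\<^sup>2\<close>, integrated from infinity, in which only \<open>V - E + W\<close> carries a factor \<open>1 / h\<close>.
  The contribution of \<open>\<epsilon>\<close> is controlled by \<open>\<epsilon> \<integral>\<bar>u\<bar>\<^sup>2 \<le> \<integral>\<bar>f u\<bar>\<close> if \<open>\<epsilon> \<le> 1\<close>, while self-adjointness suffices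
  if \<open>\<epsilon> > 1\<close>.

  The resolvent is constructed as the limit of Dirichlet problems on growing intervals, in which
  only the two initial values at \<open>0\<close> have to converge.
\<close>

subsection \<open>Primitives of locally integrable functions\<close>

text \<open>The order of the quantifiers shapes the proof: the constant in the exponent is fixed
  before \<open>\<delta>0\<close>, and \<open>C_s\<close> before \<open>V\<close>, which is bounded
  above by \<open>C_V\<close> but not uniformly below. Averaging meets the first demand:
  differentiating the average costs \<open>1 / \<delta>0\<close> but no \<open>1 / h\<close>, so
  this cost ends up in \<open>C_s\<close>, while the averaging error, paid with
  \<open>1 / h\<close>, is at most \<open>2 * c0 * m0\<close> for every averaging length below
  \<open>\<delta>0\<close>. For the second demand, \<open>W\<close> may be huge, but its total
  oscillation is bounded uniformly in \<open>V\<close>; hence an upper bound for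
  \<open>E - V\<close> is comparable with \<open>W\<close> at every point, and only the ratio of the
  two enters the constants. The truncation level \<open>\<kappa>\<close> is \<open>E\<close> minus
  the level \<open>(E + 3 * E_inf) / 4\<close> coming from \<open>R_energy\<close>, so truncating
  changes nothing where \<open>\<bar>x\<bar> > R_E\<close>. The estimate closes on itself: the
  energy bound contains integrals of the solution, which are in turn at most a multiple of its
  square root. As \<open>V\<close> is merely bounded and measurable, all calculus is done with
  integrated identities.\<close>

text \<open>Local absolute continuity of \<open>F\<close> with derivative \<open>f\<close> almost everywhere, in integrated form.\<close>

definition primitive :: "(real \<Rightarrow> 'a::euclidean_space) \<Rightarrow> (real \<Rightarrow> 'a) \<Rightarrow> bool" where
  "primitive F f \<longleftrightarrow>
     (\<forall>a b. a \<le> b \<longrightarrow> f absolutely_integrable_on {a..b} \<and> (f has_integral (F b - F a)) {a..b})"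

lemma primitiveD:
  assumes "primitive F f"
  shows "f absolutely_integrable_on {a..b}" "f integrable_on {a..b}"
    and "a \<le> b \<Longrightarrow> (f has_integral (F b - F a)) {a..b}"
    and "a \<le> b \<Longrightarrow> integral {a..b} f = F b - F a"
proof -
  show *: "f absolutely_integrable_on {a..b}" for a b
    using assms by (cases "a \<le> b") (auto simp: primitive_def set_integrable_def)
  show "f integrable_on {a..b}"
    using * absolutely_integrable_on_def by blast
  show "a \<le> b \<Longrightarrow> (f has_integral (F b - F a)) {a..b}"
    using assms by (auto simp: primitive_def)
  then show "a \<le> b \<Longrightarrow> integral {a..b} f = F b - F a"
    by blast
qed

lemma primitive_exists:
  fixes f :: "real \<Rightarrow> 'a::euclidean_space"
  assumes f: "\<And>a b. f absolutely_integrable_on {a..b}"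
  obtains F where "F 0 = c" "primitive F f"
proof -
  \<comment> \<open>One of the two intervals is degenerate or empty and contributes 0, so the
    difference is the oriented integral from 0.\<close>
  define F where "F x = c + (integral {0..x} f - integral {x..0} f)" for x :: real
  have i: "f integrable_on {a..b}" for a b
    using f absolutely_integrable_on_def by blast
  have eq: "F b - F a = integral {a..b} f" if "a \<le> b" for a b
  proof -
    consider "0 \<le> a" | "a \<le> 0" "0 \<le> b" | "b \<le> 0" by linarith
    then show ?thesis
    proof cases
      case 1
      then have "integral {a..0} f = 0" "integral {b..0} f = 0"
        using that by (cases "a = 0"; cases "b = 0"; simp)+
      then show ?thesis
        using Henstock_Kurzweil_Integration.integral_combine[of 0 a b f] 1 that i by (simp add: F_def algebra_simps)
    next
      case 2
      then have "integral {0..a} f = 0" "integral {b..0} f = 0"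
        by (cases "a = 0"; cases "b = 0"; simp)+
      then show ?thesis
        using Henstock_Kurzweil_Integration.integral_combine[of a 0 b f] 2 i by (simp add: F_def algebra_simps)
    next
      case 3
      then have "integral {0..a} f = 0" "integral {0..b} f = 0"
        using that by (cases "a = 0"; cases "b = 0"; simp)+
      then show ?thesis
        using Henstock_Kurzweil_Integration.integral_combine[of a b 0 f] 3 that i by (simp add: F_def algebra_simps)
    qed
  qed
  have "F 0 = c" by (simp add: F_def)
  moreover have "primitive F f"
    unfolding primitive_def using eq f i by (auto intro: integrable_integral)
  ultimately show ?thesis using that by blast
qed

lemma primitive_continuous:
  assumes "primitive F f"
  shows "continuous_on S F"
proof -
  have "isCont F x" for x
  proof -
    have "continuous_on {x-1..x+1} (\<lambda>y. F (x-1) + integral {x-1..y} f)"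
      by (intro continuous_intros indefinite_integral_continuous_1 primitiveD(2)[OF assms])
    moreover have "F (x-1) + integral {x-1..y} f = F y" if "y \<in> {x-1..x+1}" for y
      using primitiveD(4)[OF assms, of "x-1" y] that by auto
    ultimately have "continuous_on {x-1..x+1} F"
      by (metis (no_types, lifting) continuous_on_cong)
    then show ?thesis
      by (rule continuous_on_interior) (auto simp: interior_atLeastAtMost_real)
  qed
  then show ?thesis by (simp add: continuous_at_imp_continuous_on)
qed

lemma primitive_linear:
  assumes "primitive F f" "bounded_linear h"
  shows "primitive (\<lambda>x. h (F x)) (\<lambda>x. h (f x))"
  unfolding primitive_def
proof (intro allI impI conjI)
  fix a b :: real assume ab: "a \<le> b"
  show "(\<lambda>x. h (f x)) absolutely_integrable_on {a..b}"
    using absolutely_integrable_linear[OF primitiveD(1)[OF assms(1)] assms(2)] by (simp add: o_def)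
  show "((\<lambda>x. h (f x)) has_integral h (F b) - h (F a)) {a..b}"
    using has_integral_linear[OF primitiveD(3)[OF assms(1) ab] assms(2)] assms(2)
    by (simp add: o_def linear_diff bounded_linear.linear)
qed

lemma primitive_add:
  assumes "primitive F f" "primitive G g"
  shows "primitive (\<lambda>x. F x + G x) (\<lambda>x. f x + g x)"
  unfolding primitive_def
proof (intro allI impI conjI)
  fix a b :: real assume ab: "a \<le> b"
  show "(\<lambda>x. f x + g x) absolutely_integrable_on {a..b}"
    by (intro set_integral_add primitiveD(1)[OF assms(1)] primitiveD(1)[OF assms(2)])
  show "((\<lambda>x. f x + g x) has_integral F b + G b - (F a + G a)) {a..b}"
    using has_integral_add[OF primitiveD(3)[OF assms(1) ab] primitiveD(3)[OF assms(2) ab]]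
    by (simp add: algebra_simps)
qed

lemma primitive_const: "primitive (\<lambda>x. c) (\<lambda>x. 0)"
  by (simp add: primitive_def)

lemma primitive_minus: "primitive F f \<Longrightarrow> primitive (\<lambda>x. - F x) (\<lambda>x. - f x)"
  by (rule primitive_linear[OF _ bounded_linear_minus[OF bounded_linear_ident]])

lemma primitive_diff:
  assumes "primitive F f" "primitive G g"
  shows "primitive (\<lambda>x. F x - G x) (\<lambda>x. f x - g x)"
  using primitive_add[OF assms(1) primitive_minus[OF assms(2)]] by simp

lemma primitive_cmult:
  fixes f :: "real \<Rightarrow> real"
  shows "primitive F f \<Longrightarrow> primitive (\<lambda>x. c * F x) (\<lambda>x. c * f x)"
  by (rule primitive_linear) (auto intro: bounded_linear_intros)

text \<open>Integrals ignore null sets. Later proofs use this to truncate a derivative, so that an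
  almost everywhere bound on it becomes pointwise.\<close>

lemma primitive_cong_AE:
  assumes "primitive F f" "AE x in lebesgue. f x = g x"
  shows "primitive F g"
proof -
  obtain N where N: "N \<in> null_sets lebesgue" "{x. f x \<noteq> g x} \<subseteq> N"
    using assms(2) by (auto simp: eventually_ae_filter)
  have N1: "negligible N" using N(1) by (simp add: negligible_iff_null_sets)
  have N2: "g x = f x" if "x \<in> S - N" for x S
    using that N(2) by (metis (mono_tags, lifting) DiffD2 mem_Collect_eq subsetD)
  show ?thesis
    unfolding primitive_def
  proof (intro allI impI conjI)
    fix a b :: real assume ab: "a \<le> b"
    show "g absolutely_integrable_on {a..b}"
      by (rule absolutely_integrable_spike[OF primitiveD(1)[OF assms(1)] N1 N2])
    show "(g has_integral F b - F a) {a..b}"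
      by (rule has_integral_spike[OF N1 N2 primitiveD(3)[OF assms(1) ab]])
  qed
qed

lemma primitive_increment_norm_le:
  assumes F: "primitive F f" and G: "primitive G g" and "a \<le> b"
    and le: "\<And>x. a \<le> x \<Longrightarrow> x \<le> b \<Longrightarrow> norm (f x) \<le> g x"
  shows "norm (F b - F a) \<le> G b - (G a :: real)"
proof -
  have "norm (integral {a..b} f) \<le> integral {a..b} g"
    by (rule Henstock_Kurzweil_Integration.integral_norm_bound_integral)
       (use le primitiveD(2)[OF F] primitiveD(2)[OF G] in auto)
  then show ?thesis
    using primitiveD(4)[OF F \<open>a \<le> b\<close>] primitiveD(4)[OF G \<open>a \<le> b\<close>] by simp
qed

lemma primitive_of_derivative:
  fixes F :: "real \<Rightarrow> real"
  assumes "\<And>x. (F has_real_derivative f x) (at x)" "continuous_on UNIV f"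
  shows "primitive F f"
  unfolding primitive_def
proof (intro allI impI conjI)
  fix a b :: real assume ab: "a \<le> b"
  show "f absolutely_integrable_on {a..b}"
    by (rule absolutely_integrable_continuous_real) (use assms(2) continuous_on_subset in blast)
  show "(f has_integral F b - F a) {a..b}"
    by (rule fundamental_theorem_of_calculus[OF ab])
       (use assms(1) in \<open>auto simp: has_real_derivative_iff_has_vector_derivative[symmetric]
           intro: DERIV_subset\<close>)
qed

text \<open>An increment that is locally small of every order relative to a fixed monotone
  function vanishes. This replaces differentiation almost everywhere in the product and chain rules.\<close>

lemma eq_if_increments_small:
  fixes D :: "real \<Rightarrow> 'a::real_normed_vector" and M :: "real \<Rightarrow> real"
  assumes "a \<le> b"
    and small: "\<And>\<eta>. \<eta> > 0 \<Longrightarrow> \<exists>\<delta>>0. \<forall>x y. a \<le> x \<longrightarrow> x \<le> y \<longrightarrow> y \<le> b \<longrightarrow> y - x < \<delta> \<longrightarrow>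
      norm (D y - D x) \<le> \<eta> * (M y - M x)"
  shows "D b = D a"
proof -
  have bound: "norm (D b - D a) \<le> \<eta> * (M b - M a)" if pos: "\<eta> > 0" for \<eta>
  proof -
    obtain \<delta> where \<delta>: "\<delta> > 0"
      "\<And>x y. a \<le> x \<Longrightarrow> x \<le> y \<Longrightarrow> y \<le> b \<Longrightarrow> y - x < \<delta> \<Longrightarrow> norm (D y - D x) \<le> \<eta> * (M y - M x)"
      using small[OF pos] by blast
    obtain n0 :: nat where n0: "(b - a) / \<delta> < real n0"
      using reals_Archimedean2 by blast
    define n where "n = Suc n0"
    have n: "(b - a) / \<delta> < real n" "n > 0"
      using n0 by (auto simp: n_def)
    define x where "x i = a + (b - a) * real i / real n" for i
    have step: "x (Suc i) - x i = (b - a) / real n" for i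
      by (simp add: x_def diff_divide_distrib[symmetric] algebra_simps)
    have small': "(b - a) / real n < \<delta>"
      using n \<delta>(1) by (simp add: field_simps)
    have xb: "a \<le> x i" "x i \<le> b" if "i \<le> n" for i
    proof -
      show "a \<le> x i" using assms(1) by (simp add: x_def)
      have "(b - a) * real i \<le> (b - a) * real n"
        using assms(1) that by (intro mult_left_mono) auto
      then show "x i \<le> b" using n by (simp add: x_def field_simps)
    qed
    have "norm (D b - D a) = norm (D (x n) - D (x 0))"
      using n by (simp add: x_def)
    also have "\<dots> = norm (\<Sum>i<n. D (x (Suc i)) - D (x i))"
      using sum_lessThan_telescope[of "\<lambda>i. D (x i)" n] by simp
    also have "\<dots> \<le> (\<Sum>i<n. \<eta> * (M (x (Suc i)) - M (x i)))"
    proof (rule sum_norm_le)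
      fix i assume i: "i \<in> {..<n}"
      have "x i \<le> x (Suc i)"
        using step[of i] divide_nonneg_nonneg[of "b - a" "real n"] assms(1) by linarith
      then show "norm (D (x (Suc i)) - D (x i)) \<le> \<eta> * (M (x (Suc i)) - M (x i))"
        using xb[of i] xb[of "Suc i"] i step[of i] small' by (intro \<delta>(2)) auto
    qed
    also have "\<dots> = \<eta> * (M (x n) - M (x 0))"
      using sum_lessThan_telescope[of "\<lambda>i. M (x i)" n] by (simp add: sum_distrib_left[symmetric])
    finally show ?thesis using n by (simp add: x_def)
  qed
  have "M b - M a \<ge> 0"
    using order_trans[OF norm_ge_zero bound[OF zero_less_one]] by simp
  have "norm (D b - D a) \<le> 0"
  proof (rule field_le_epsilon)
    fix e :: real assume "e > 0"
    \<comment> \<open>The summand 1 keeps the quotient meaningful when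
      \<open>M b = M a\<close>.\<close>
    have "norm (D b - D a) \<le> e / (M b - M a + 1) * (M b - M a)"
      using \<open>e > 0\<close> \<open>M b - M a \<ge> 0\<close> by (intro bound) simp
    also have "\<dots> \<le> e"
      using \<open>e > 0\<close> \<open>M b - M a \<ge> 0\<close> by (simp add: field_simps)
    finally show "norm (D b - D a) \<le> 0 + e" by simp
  qed
  then show ?thesis by simp
qed

lemma absolutely_integrable_mult_continuous:
  fixes f g :: "real \<Rightarrow> real"
  assumes "f absolutely_integrable_on {a..b}" "continuous_on {a..b} g"
  shows "(\<lambda>x. g x * f x) absolutely_integrable_on {a..b}"
proof (rule absolutely_integrable_bounded_measurable_product_real[OF _ _ _ assms(1)])
  show "g \<in> borel_measurable (lebesgue_on {a..b})"
    by (rule continuous_imp_measurable_on_sets_lebesgue[OF assms(2)]) auto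
  show "bounded (g ` {a..b})"
    by (rule compact_imp_bounded[OF compact_continuous_image[OF assms(2)]]) auto
qed auto

text \<open>\<open>H\<close> is a primitive of the expected derivative. It remains to see that
  \<open>F * G - H\<close> has increments small relative to \<open>M\<close>, a primitive of the sum
  of the absolute values of \<open>f\<close> and \<open>g\<close>; it is then constant.\<close>

lemma primitive_mult:
  fixes f g F G :: "real \<Rightarrow> real"
  assumes F: "primitive F f" and G: "primitive G g"
  shows "primitive (\<lambda>x. F x * G x) (\<lambda>x. f x * G x + F x * g x)"
proof -
  note cont = primitive_continuous[OF F] primitive_continuous[OF G]
  have "(\<lambda>x. G x * f x + F x * g x) absolutely_integrable_on {a..b}" for a b
    by (intro set_integral_add absolutely_integrable_mult_continuous primitiveD(1)[OF F]
        primitiveD(1)[OF G] cont)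
  then have int: "(\<lambda>x. f x * G x + F x * g x) absolutely_integrable_on {a..b}" for a b
    by (simp add: mult.commute)
  have "(\<lambda>x. \<bar>f x\<bar> + \<bar>g x\<bar>) absolutely_integrable_on {a..b}" for a b
    by (intro set_integral_add set_integrable_abs primitiveD(1)[OF F] primitiveD(1)[OF G])
  then obtain M where M: "primitive M (\<lambda>x. \<bar>f x\<bar> + \<bar>g x\<bar>)"
    using primitive_exists by blast
  obtain H where H: "primitive H (\<lambda>x. f x * G x + F x * g x)"
    using primitive_exists[OF int] by blast
  have "F b * G b - H b = F a * G a - H a" if "a \<le> b" for a b
  proof (rule eq_if_increments_small[OF that, where M = M])
    fix \<eta> :: real assume "\<eta> > 0"
    have "uniformly_continuous_on {a..b} F" "uniformly_continuous_on {a..b} G"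
      by (intro compact_uniformly_continuous cont; simp)+
    then obtain d e where d: "d > 0" "\<And>s t. s \<in> {a..b} \<Longrightarrow> t \<in> {a..b} \<Longrightarrow> dist s t < d \<Longrightarrow> dist (F s) (F t) < \<eta>"
      and e: "e > 0" "\<And>s t. s \<in> {a..b} \<Longrightarrow> t \<in> {a..b} \<Longrightarrow> dist s t < e \<Longrightarrow> dist (G s) (G t) < \<eta>"
      using \<open>\<eta> > 0\<close> unfolding uniformly_continuous_on_def by metis
    have "norm (F y * G y - H y - (F x * G x - H x)) \<le> \<eta> * (M y - M x)"
      if xy: "a \<le> x" "x \<le> y" "y \<le> b" "y - x < min d e" for x y
    proof -
      \<comment> \<open>Freezing \<open>G\<close> at \<open>y\<close> in one term and
        \<open>F\<close> at \<open>x\<close> in the other keeps the increment of the product over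
        \<open>[x, y]\<close> but makes the expression linear in \<open>F\<close> and
        \<open>G\<close>; its derivative is off only by oscillations of \<open>F\<close> and
        \<open>G\<close>.\<close>
      let ?D = "\<lambda>t. (F t * G y + F x * G t) - H t"
      have "primitive ?D (\<lambda>t. (f t * G y + F x * g t) - (f t * G t + F x * g t + (F t - F x) * g t))"
        using primitive_diff[OF primitive_add[OF primitive_cmult[OF F, of "G y"] primitive_cmult[OF G, of "F x"]] H]
        by (simp add: algebra_simps)
      from this primitive_cmult[OF M, of \<eta>] xy(2)
      have "norm (?D y - ?D x) \<le> \<eta> * M y - \<eta> * M x"
      proof (rule primitive_increment_norm_le)
        show "norm ((f t * G y + F x * g t) - (f t * G t + F x * g t + (F t - F x) * g t)) \<le> \<eta> * (\<bar>f t\<bar> + \<bar>g t\<bar>)"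
          if t: "x \<le> t" "t \<le> y" for t
        proof -
          have "\<bar>F t - F x\<bar> \<le> \<eta>" "\<bar>G y - G t\<bar> \<le> \<eta>"
            using d(2)[of t x] e(2)[of y t] t xy by (auto simp: dist_real_def)
          then have "\<bar>f t\<bar> * \<bar>G y - G t\<bar> + \<bar>F t - F x\<bar> * \<bar>g t\<bar> \<le> \<bar>f t\<bar> * \<eta> + \<eta> * \<bar>g t\<bar>"
            by (intro add_mono mult_left_mono mult_right_mono) auto
          moreover have "norm ((f t * G y + F x * g t) - (f t * G t + F x * g t + (F t - F x) * g t))
              = \<bar>f t * (G y - G t) - (F t - F x) * g t\<bar>"
            by (simp add: algebra_simps)
          moreover have "\<dots> \<le> \<bar>f t\<bar> * \<bar>G y - G t\<bar> + \<bar>F t - F x\<bar> * \<bar>g t\<bar>"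
            by (simp add: abs_mult[symmetric])
          ultimately show ?thesis by (simp add: algebra_simps)
        qed
      qed
      moreover have "?D y - ?D x = F y * G y - H y - (F x * G x - H x)"
        by (simp add: algebra_simps)
      ultimately show ?thesis by (simp add: algebra_simps)
    qed
    then show "\<exists>\<delta>>0. \<forall>x y. a \<le> x \<longrightarrow> x \<le> y \<longrightarrow> y \<le> b \<longrightarrow> y - x < \<delta> \<longrightarrow>
      norm (F y * G y - H y - (F x * G x - H x)) \<le> \<eta> * (M y - M x)"
      using d(1) e(1) by (intro exI[of _ "min d e"]) auto
  qed
  then have "F b * G b - F a * G a = H b - H a" if "a \<le> b" for a b
    using that by (simp add: algebra_simps)
  then show ?thesis
    using H by (simp add: primitive_def)
qed

text \<open>Same scheme as for products: on a short interval the exponential is replaced by its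
  secant slope \<open>c\<close>, which the mean value theorem places between
  \<open>exp (F x)\<close> and \<open>exp (F y)\<close>, hence near all values in between.\<close>

lemma primitive_exp:
  fixes f F :: "real \<Rightarrow> real"
  assumes F: "primitive F f"
  shows "primitive (\<lambda>x. exp (F x)) (\<lambda>x. exp (F x) * f x)"
proof -
  have cont: "continuous_on S (\<lambda>x. exp (F x))" for S
    by (intro continuous_intros primitive_continuous[OF F])
  have int: "(\<lambda>x. exp (F x) * f x) absolutely_integrable_on {a..b}" for a b
    by (intro absolutely_integrable_mult_continuous primitiveD(1)[OF F] cont)
  have "(\<lambda>x. \<bar>f x\<bar>) absolutely_integrable_on {a..b}" for a b
    by (intro set_integrable_abs primitiveD(1)[OF F])
  then obtain M where M: "primitive M (\<lambda>x. \<bar>f x\<bar>)"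
    using primitive_exists by blast
  obtain H where H: "primitive H (\<lambda>x. exp (F x) * f x)"
    using primitive_exists[OF int] by blast
  have "exp (F b) - H b = exp (F a) - H a" if "a \<le> b" for a b
  proof (rule eq_if_increments_small[OF that, where M = M])
    fix \<eta> :: real assume "\<eta> > 0"
    have "uniformly_continuous_on {a..b} (\<lambda>x. exp (F x))"
      by (intro compact_uniformly_continuous cont) simp
    then obtain d where d: "d > 0" "\<And>s t. s \<in> {a..b} \<Longrightarrow> t \<in> {a..b} \<Longrightarrow> dist s t < d \<Longrightarrow> dist (exp (F s)) (exp (F t)) < \<eta>"
      using \<open>\<eta> > 0\<close> unfolding uniformly_continuous_on_def by metis
    have "norm (exp (F y) - H y - (exp (F x) - H x)) \<le> \<eta> * (M y - M x)"
      if xy: "a \<le> x" "x \<le> y" "y \<le> b" "y - x < d" for x y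
    proof -
      obtain c where c: "min (exp (F x)) (exp (F y)) \<le> c" "c \<le> max (exp (F x)) (exp (F y))"
        "exp (F y) - exp (F x) = c * (F y - F x)"
      proof -
        consider "F x = F y" | "F x < F y" | "F y < F x" by linarith
        then show ?thesis
        proof cases
          case 1 then show ?thesis using that[of "exp (F x)"] by simp
        next
          case 2
          then obtain z where "z > F x" "z < F y" "exp (F y) - exp (F x) = (F y - F x) * exp z"
            using MVT2[of "F x" "F y" exp exp] by auto
          then show ?thesis using that[of "exp z"] by auto
        next
          case 3
          then obtain z where "z > F y" "z < F x" "exp (F x) - exp (F y) = (F x - F y) * exp z"
            using MVT2[of "F y" "F x" exp exp] by auto
          then show ?thesis using that[of "exp z"] by (auto simp: algebra_simps)
        qed
      qed
      let ?D = "\<lambda>t. c * F t - H t"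
      have D: "primitive ?D (\<lambda>t. c * f t - exp (F t) * f t)"
        by (intro primitive_diff primitive_cmult F H)
      have "norm (?D y - ?D x) \<le> \<eta> * M y - \<eta> * M x"
      proof (rule primitive_increment_norm_le[OF D primitive_cmult[OF M] xy(2)])
        fix t assume t: "x \<le> t" "t \<le> y"
        have "\<bar>exp (F t) - exp (F x)\<bar> < \<eta>" "\<bar>exp (F t) - exp (F y)\<bar> < \<eta>"
          using d(2)[of t x] d(2)[of t y] t xy by (auto simp: dist_real_def)
        then have "\<bar>c - exp (F t)\<bar> \<le> \<eta>" using c(1,2) by linarith
        then have "\<bar>c - exp (F t)\<bar> * \<bar>f t\<bar> \<le> \<eta> * \<bar>f t\<bar>"
          by (intro mult_right_mono) auto
        then show "norm (c * f t - exp (F t) * f t) \<le> \<eta> * \<bar>f t\<bar>"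
          by (simp add: abs_mult[symmetric] algebra_simps)
      qed
      moreover have "?D y - ?D x = exp (F y) - H y - (exp (F x) - H x)"
        using c(3) by (simp add: algebra_simps)
      ultimately show ?thesis by (simp add: algebra_simps)
    qed
    then show "\<exists>\<delta>>0. \<forall>x y. a \<le> x \<longrightarrow> x \<le> y \<longrightarrow> y \<le> b \<longrightarrow> y - x < \<delta> \<longrightarrow>
      norm (exp (F y) - H y - (exp (F x) - H x)) \<le> \<eta> * (M y - M x)"
      using d(1) by blast
  qed
  then have "exp (F b) - exp (F a) = H b - H a" if "a \<le> b" for a b
    using that by (simp add: algebra_simps)
  then show ?thesis
    using H by (simp add: primitive_def)
qed

subsection \<open>Local integrability\<close>

definition locally_integrable :: "(real \<Rightarrow> 'a::euclidean_space) \<Rightarrow> bool" where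
  "locally_integrable w \<longleftrightarrow> (\<forall>a b. w absolutely_integrable_on {a..b})"

lemma primitive_locally_integrable: "primitive F f \<Longrightarrow> locally_integrable f"
  by (simp add: locally_integrable_def primitiveD(1))

lemma continuous_locally_integrable: "continuous_on UNIV f \<Longrightarrow> locally_integrable f"
  unfolding locally_integrable_def
  by (intro allI absolutely_integrable_continuous_real) (blast intro: continuous_on_subset)

lemma locally_integrable_diff:
  "locally_integrable f \<Longrightarrow> locally_integrable g \<Longrightarrow> locally_integrable (\<lambda>x. f x - g x)"
  by (simp add: locally_integrable_def)

lemma locally_integrable_Ioo:
  fixes w :: "real \<Rightarrow> 'a::euclidean_space"
  shows "locally_integrable w \<Longrightarrow> set_integrable lebesgue {a<..<b} w"
  unfolding locally_integrable_def by (meson absolutely_integrable_on_Icc_iff_Ioo)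

lemma L2_locally_integrable:
  assumes "f \<in> L2"
  shows "locally_integrable f"
  unfolding locally_integrable_def
proof (intro allI)
  fix a b :: real
  have f: "f \<in> borel_measurable lebesgue" and i: "integrable lebesgue (\<lambda>x. (cmod (f x))\<^sup>2)"
    using assms by (auto simp: L2_def)
  \<comment> \<open>On a bounded interval \<open>t \<le> 1 + t\<^sup>2\<close> provides an
    integrable majorant.\<close>
  have "integrable lebesgue (\<lambda>x. indicator {a..b} x + (cmod (f x))\<^sup>2)"
    by (intro Bochner_Integration.integrable_add i integrable_real_indicator) (auto simp: emeasure_lborel_Icc_eq)
  then show "f absolutely_integrable_on {a..b}"
    unfolding set_integrable_def
  proof (rule Bochner_Integration.integrable_bound)
    have *: "t \<le> 1 + t\<^sup>2" for t :: real
      using zero_le_power2[of "t - 1/2"] unfolding power2_eq_square by (simp add: algebra_simps)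
    show "AE x in lebesgue. norm (indicat_real {a..b} x *\<^sub>R f x) \<le> norm (indicator {a..b} x + (cmod (f x))\<^sup>2 :: real)"
      using * by (intro AE_I2) (auto split: split_indicator simp: abs_of_nonneg)
    show "(\<lambda>x. indicat_real {a..b} x *\<^sub>R f x) \<in> borel_measurable lebesgue"
      by (intro borel_measurable_scaleR borel_measurable_indicator f) simp
  qed
qed

subsection \<open>A supply of test functions\<close>

text \<open>The standard smooth function that is flat at 0, with the powers \<open>x ^ k\<close>
  built into the denominator: the derivative of \<open>flat k\<close> is a combination of
  \<open>flat (k + 2)\<close> and \<open>flat (k + 1)\<close>, so the family is stable under
  differentiation.\<close>

definition flat :: "nat \<Rightarrow> real \<Rightarrow> real" where
  "flat k x = (if 0 < x then exp (- (1 / x)) / x ^ k else 0)"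

lemma flat_tendsto_0: "(flat k \<longlongrightarrow> 0) (at 0)"
proof -
  have "((\<lambda>x. inverse x ^ k / exp (inverse x)) \<longlongrightarrow> (0::real)) (at_right 0)"
    by (rule filterlim_compose[OF tendsto_power_div_exp_0 filterlim_inverse_at_top_right])
  moreover have "eventually (\<lambda>x. inverse x ^ k / exp (inverse x) = flat k x) (at_right 0)"
    by (auto simp: eventually_at_right_field flat_def field_simps exp_minus intro!: exI[of _ 1])
  ultimately have "(flat k \<longlongrightarrow> 0) (at_right 0)"
    by (rule Lim_transform_eventually)
  moreover have "(flat k \<longlongrightarrow> 0) (at_left 0)"
    by (rule Lim_transform_eventually[OF tendsto_const])
       (auto simp: eventually_at_left_field flat_def intro!: exI[of _ "-1"])
  ultimately show ?thesis
    by (simp add: filterlim_split_at)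
qed

lemma flat_has_derivative:
  "(flat k has_real_derivative (flat (k + 2) x - real k * flat (k + 1) x)) (at x)"
proof -
  consider "x < 0" | "x = 0" | "0 < x" by linarith
  then show ?thesis
  proof cases
    case 1
    have "((\<lambda>x. 0) has_real_derivative 0) (at x)" by simp
    then have "(flat k has_real_derivative 0) (at x)"
    proof (rule has_field_derivative_transform_within_open)
      show "open {..<0::real}" by simp
    qed (use 1 in \<open>auto simp: flat_def\<close>)
    then show ?thesis using 1 by (simp add: flat_def)
  next
    case 2
    \<comment> \<open>At the junction the difference quotient of \<open>flat k\<close> is
      \<open>flat (k + 1)\<close>, whose limit is 0.\<close>
    have "eventually (\<lambda>y. flat (k + 1) y = (flat k y - flat k 0) / (y - 0)) (at 0)"
      by (auto simp: flat_def eventually_at intro!: exI[of _ 1])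
    then have "((\<lambda>y. (flat k y - flat k 0) / (y - 0)) \<longlongrightarrow> 0) (at 0)"
      by (rule Lim_transform_eventually[OF flat_tendsto_0])
    then show ?thesis using 2 by (simp add: has_field_derivative_iff flat_def)
  next
    case 3
    have "((\<lambda>x. exp (- (1 / x)) / x ^ k) has_real_derivative
        exp (- (1 / x)) / x ^ (k + 2) - real k * (exp (- (1 / x)) / x ^ (k + 1))) (at x)"
    proof (cases k)
      case (Suc j)
      have "x * x ^ (j - Suc 0) * real j = x ^ j * real j" by (cases j) auto
      then show ?thesis using 3 Suc
        by (auto intro!: derivative_eq_intros simp: field_simps power2_eq_square power_add)
    qed (use 3 in \<open>auto intro!: derivative_eq_intros simp: field_simps power2_eq_square\<close>)
    then have "(flat k has_real_derivative
        exp (- (1 / x)) / x ^ (k + 2) - real k * (exp (- (1 / x)) / x ^ (k + 1))) (at x)"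
    proof (rule has_field_derivative_transform_within_open)
      show "open {0::real<..}" by simp
    qed (use 3 in \<open>auto simp: flat_def\<close>)
    then show ?thesis using 3 by (simp add: flat_def)
  qed
qed

text \<open>Stable under differentiation, so membership alone yields derivatives of every order,
  without a formula for \<open>deriv ^^ n\<close>.\<close>

inductive_set flat_algebra :: "(real \<Rightarrow> real) set" where
  flat: "(\<lambda>x. flat k (c * x + d)) \<in> flat_algebra"
| const: "(\<lambda>x. c) \<in> flat_algebra"
| add: "f \<in> flat_algebra \<Longrightarrow> g \<in> flat_algebra \<Longrightarrow> (\<lambda>x. f x + g x) \<in> flat_algebra"
| mult: "f \<in> flat_algebra \<Longrightarrow> g \<in> flat_algebra \<Longrightarrow> (\<lambda>x. f x * g x) \<in> flat_algebra"

lemma flat_algebra_derivative: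
  "f \<in> flat_algebra \<Longrightarrow> \<exists>f'\<in>flat_algebra. \<forall>x. (f has_real_derivative f' x) (at x)"
proof (induction rule: flat_algebra.induct)
  case (flat k c d)
  let ?f' = "\<lambda>x. c * (flat (k + 2) (c * x + d) + (- real k) * flat (k + 1) (c * x + d))"
  have "?f' \<in> flat_algebra"
    by (intro flat_algebra.intros)
  moreover have "((\<lambda>x. flat k (c * x + d)) has_real_derivative ?f' x) (at x)" for x
    by (rule DERIV_cong[OF DERIV_chain2[OF flat_has_derivative]])
       (auto intro!: derivative_eq_intros simp: algebra_simps)
  ultimately show ?case by (intro bexI[of _ ?f']) auto
next
  case (const c)
  then show ?case by (intro bexI[of _ "\<lambda>x. 0"]) (auto intro: flat_algebra.intros)
next
  case (add f g)
  then obtain f' g' where *: "f' \<in> flat_algebra" "g' \<in> flat_algebra"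
    "\<And>x. (f has_real_derivative f' x) (at x)" "\<And>x. (g has_real_derivative g' x) (at x)" by blast
  then show ?case
    by (intro bexI[of _ "\<lambda>x. f' x + g' x"]) (auto intro!: flat_algebra.intros derivative_intros)
next
  case (mult f g)
  then obtain f' g' where *: "f' \<in> flat_algebra" "g' \<in> flat_algebra"
    "\<And>x. (f has_real_derivative f' x) (at x)" "\<And>x. (g has_real_derivative g' x) (at x)" by blast
  then have "((\<lambda>x. f x * g x) has_real_derivative f' x * g x + g' x * f x) (at x)" for x
    by (intro DERIV_mult)
  then show ?case
    using * mult.hyps
    by (intro bexI[of _ "\<lambda>x. f' x * g x + g' x * f x"]) (auto intro!: flat_algebra.intros)
qed

lemma flat_algebra_deriv: "f \<in> flat_algebra \<Longrightarrow> (deriv ^^ n) f \<in> flat_algebra"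
proof (induction n arbitrary: f)
  case (Suc n)
  obtain f' where "f' \<in> flat_algebra" "\<forall>x. (f has_real_derivative f' x) (at x)"
    using flat_algebra_derivative[OF Suc.prems] by blast
  then have "deriv f \<in> flat_algebra"
    by (metis DERIV_imp_deriv ext)
  then show ?case
    using Suc.IH by (simp only: funpow_Suc_right o_apply)
qed simp

lemma flat_algebra_test_function:
  assumes "f \<in> flat_algebra" "\<And>x. R < \<bar>x\<bar> \<Longrightarrow> f x = 0"
  shows "test_function f"
  unfolding test_function_def
proof (intro conjI allI exI[of _ R] impI)
  fix n x
  show "(deriv ^^ n) f differentiable at x"
    using flat_algebra_derivative[OF flat_algebra_deriv[OF assms(1), of n]]
    by (meson real_differentiable_def)
qed (use assms in auto)

text \<open>The two flat ends are compressed by the factor \<open>n + 1\<close>, so that the bumps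
  converge to the indicator of the open interval as \<open>n\<close> grows.\<close>

definition bump :: "nat \<Rightarrow> real \<Rightarrow> real \<Rightarrow> real \<Rightarrow> real" where
  "bump n a b x = flat 0 (real (Suc n) * (x - a)) * flat 0 (real (Suc n) * (b - x))"

lemma bump_flat_algebra: "bump n a b \<in> flat_algebra"
proof -
  have "(\<lambda>x. flat 0 (real (Suc n) * x + (- real (Suc n) * a)) *
      flat 0 ((- real (Suc n)) * x + real (Suc n) * b)) \<in> flat_algebra"
    by (intro flat_algebra.intros)
  then show ?thesis
    unfolding bump_def[abs_def] by (simp only: right_diff_distrib mult_minus_left add_uminus_conv_diff minus_add_distrib uminus_add_conv_diff)
qed

lemma bump_outside: "x \<notin> {a<..<b} \<Longrightarrow> bump n a b x = 0"
  by (auto simp: bump_def flat_def zero_less_mult_iff)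

lemma bump_test_function: "test_function (bump n a b)"
  by (rule flat_algebra_test_function[OF bump_flat_algebra, of "\<bar>a\<bar> + \<bar>b\<bar>"])
     (auto intro!: bump_outside)

lemma bump_bounds: "0 \<le> bump n a b x" "bump n a b x \<le> indicator {a<..<b} x"
proof -
  have f: "0 \<le> flat 0 y" "flat 0 y \<le> 1" for y by (auto simp: flat_def)
  then show "0 \<le> bump n a b x" by (simp add: bump_def)
  have "bump n a b x \<le> 1" using f by (simp add: bump_def mult_le_one)
  then show "bump n a b x \<le> indicator {a<..<b} x"
    using bump_outside[of x a b n] by (auto split: split_indicator)
qed

lemma bump_pos: "a < x \<Longrightarrow> x < b \<Longrightarrow> 0 < bump n a b x"
  by (auto simp: bump_def flat_def zero_less_mult_iff)

lemma bump_tendsto: "(\<lambda>n. bump n a b x) \<longlonglongrightarrow> indicator {a<..<b} x"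
proof (cases "x \<in> {a<..<b}")
  case True
  have *: "(\<lambda>n. exp (- (1 / (real (Suc n) * y)))) \<longlonglongrightarrow> 1" if "y > 0" for y :: real
  proof -
    have "(\<lambda>n. exp (- (inverse (real (Suc n)) * inverse y))) \<longlonglongrightarrow> exp (- (0 * inverse y))"
      by (intro tendsto_intros LIMSEQ_inverse_real_of_nat)
    then show ?thesis by (simp add: field_simps)
  qed
  have "(\<lambda>n. exp (- (1 / (real (Suc n) * (x - a)))) * exp (- (1 / (real (Suc n) * (b - x))))) \<longlonglongrightarrow> 1 * 1"
    using True by (intro tendsto_mult *) auto
  moreover have "bump n a b x = exp (- (1 / (real (Suc n) * (x - a)))) * exp (- (1 / (real (Suc n) * (b - x))))" for n
    using True by (auto simp: bump_def flat_def zero_less_mult_iff)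
  ultimately show ?thesis using True by simp
next
  case False
  then show ?thesis using bump_outside[OF False] by simp
qed

subsection \<open>Integration against test functions\<close>

lemma test_function_deriv:
  assumes "test_function \<phi>"
  shows "test_function (deriv \<phi>)" "(\<phi> has_real_derivative deriv \<phi> x) (at x)"
proof -
  obtain R where d: "\<And>n x. (deriv ^^ n) \<phi> differentiable at x" and R: "\<And>x. R < \<bar>x\<bar> \<Longrightarrow> \<phi> x = 0"
    using assms unfolding test_function_def by blast
  show "(\<phi> has_real_derivative deriv \<phi> x) (at x)"
    using d[of 0 x] by (simp add: DERIV_deriv_iff_real_differentiable)
  have "deriv \<phi> x = 0" if "R < \<bar>x\<bar>" for x
  proof -
    have "((\<lambda>x. 0) has_real_derivative 0) (at x)" by simp
    then have "(\<phi> has_real_derivative 0) (at x)"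
    proof (rule has_field_derivative_transform_within_open)
      show "open {x. R < \<bar>x\<bar>}"
        by (intro open_Collect_less continuous_intros)
    qed (use that R in auto)
    then show ?thesis by (rule DERIV_imp_deriv)
  qed
  moreover have "(deriv ^^ n) (deriv \<phi>) differentiable at x" for n x
    using d[of "Suc n" x] by (simp only: funpow_Suc_right o_apply)
  ultimately show "test_function (deriv \<phi>)"
    unfolding test_function_def by blast
qed

lemma test_function_continuous: "test_function \<phi> \<Longrightarrow> continuous_on S \<phi>"
  by (meson DERIV_continuous test_function_deriv(2) continuous_at_imp_continuous_on)

lemma test_function_support:
  assumes "test_function \<phi>"
  obtains R where "R > 0" "\<And>x. R \<le> \<bar>x\<bar> \<Longrightarrow> \<phi> x = 0"
proof -
  obtain R where R: "\<And>x. R < \<bar>x\<bar> \<Longrightarrow> \<phi> x = 0"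
    using assms unfolding test_function_def by blast
  \<comment> \<open>The larger radius makes \<open>\<phi>\<close> vanish at the endpoints too, which
    later removes boundary terms.\<close>
  show ?thesis using that[of "\<bar>R\<bar> + 1"] R by force
qed

lemma test_function_times_integrable:
  fixes w :: "real \<Rightarrow> 'a::euclidean_space"
  assumes "test_function \<phi>" "locally_integrable w"
  shows "integrable lebesgue (\<lambda>x. \<phi> x *\<^sub>R w x)"
proof -
  obtain R where R: "R > 0" "\<And>x. R \<le> \<bar>x\<bar> \<Longrightarrow> \<phi> x = 0"
    using test_function_support[OF assms(1)] by blast
  have "(\<lambda>x. \<phi> x *\<^sub>R w x) absolutely_integrable_on {-R..R}"
  proof (rule absolutely_integrable_bounded_measurable_product[where h = "(*\<^sub>R)"])
    show "bilinear ((*\<^sub>R) :: real \<Rightarrow> 'a \<Rightarrow> 'a::euclidean_space)"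
      by (simp add: bilinear_conv_bounded_bilinear bounded_bilinear_scaleR)
    show "\<phi> \<in> borel_measurable (lebesgue_on {-R..R})"
      by (rule continuous_imp_measurable_on_sets_lebesgue[OF test_function_continuous[OF assms(1)]]) auto
    show "bounded (\<phi> ` {-R..R})"
      by (rule compact_imp_bounded[OF compact_continuous_image[OF test_function_continuous[OF assms(1)]]]) auto
    show "w absolutely_integrable_on {-R..R}"
      using assms(2) by (simp add: locally_integrable_def)
  qed auto
  moreover have "(\<lambda>x. indicator {-R..R} x *\<^sub>R \<phi> x *\<^sub>R w x) = (\<lambda>x. \<phi> x *\<^sub>R w x)"
  proof
    fix x
    show "indicator {-R..R} x *\<^sub>R \<phi> x *\<^sub>R w x = \<phi> x *\<^sub>R w x"
      using R(2)[of x] by (cases "x \<in> {-R..R}") auto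
  qed
  ultimately show ?thesis
    unfolding set_integrable_def by metis
qed

text \<open>Passes from test functions to intervals by dominated convergence; the majorant is the
  norm of \<open>w\<close> on the interval.\<close>

lemma bump_integral_tendsto:
  assumes w: "locally_integrable w"
  shows "(\<lambda>n. \<integral>x. bump n a b x *\<^sub>R w x \<partial>lebesgue) \<longlonglongrightarrow> (LINT x:{a<..<b}|lebesgue. w x)"
  unfolding set_lebesgue_integral_def
proof (rule integral_dominated_convergence)
  have i: "set_integrable lebesgue {a<..<b} w"
    using w unfolding locally_integrable_def
    by (meson absolutely_integrable_on_Icc_iff_Ioo)
  then show "integrable lebesgue (\<lambda>x. norm (indicat_real {a<..<b} x *\<^sub>R w x))"
    unfolding set_integrable_def by (rule Bochner_Integration.integrable_norm)
  show "(\<lambda>x. indicat_real {a<..<b} x *\<^sub>R w x) \<in> borel_measurable lebesgue"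
    using i by (auto simp: set_integrable_def)
  show "(\<lambda>x. bump n a b x *\<^sub>R w x) \<in> borel_measurable lebesgue" for n
    using test_function_times_integrable[OF bump_test_function w] by auto
  show "AE x in lebesgue. (\<lambda>n. bump n a b x *\<^sub>R w x) \<longlonglongrightarrow> indicat_real {a<..<b} x *\<^sub>R w x"
    by (intro AE_I2 tendsto_intros bump_tendsto)
  show "AE x in lebesgue. norm (bump n a b x *\<^sub>R w x) \<le> norm (indicat_real {a<..<b} x *\<^sub>R w x)" for n
    using bump_bounds[of n a b] by (intro AE_I2) (auto intro!: mult_right_mono simp: abs_of_nonneg)
qed

text \<open>Vanishing over intervals propagates to Borel sets, which intervals generate, then to
  Lebesgue sets by discarding null sets; a density all of whose integrals vanish is 0. Bounded
  windows make \<open>w\<close> integrable.\<close>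

lemma AE_zero_if_interval_integrals_zero_real:
  fixes w :: "real \<Rightarrow> real"
  assumes w: "locally_integrable w"
    and zero: "\<And>a b. (LINT x:{a<..<b}|lebesgue. w x) = 0"
  shows "AE x in lebesgue. w x = 0"
proof -
  have "AE x in lebesgue. indicator {- real N<..<real N} x *\<^sub>R w x = 0" for N :: nat
  proof (rule density_unique_real)
    let ?g = "\<lambda>x. indicator {- real N<..<real N} x *\<^sub>R w x"
    show g: "integrable lebesgue ?g"
      using w unfolding locally_integrable_def set_integrable_def[symmetric]
      by (meson absolutely_integrable_on_Icc_iff_Ioo)
    then have si: "set_integrable lebesgue A ?g" if "A \<in> sets lebesgue" for A
      using integrable_mult_indicator[OF that g] by (simp add: set_integrable_def)
    have tot: "(\<integral>x. ?g x \<partial>lebesgue) = 0"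
      using zero[of "- real N" "real N"] by (simp add: set_lebesgue_integral_def)
    have borel: "(LINT x:A|lebesgue. ?g x) = 0" if "A \<in> sets borel" for A
      using that
    proof (induction rule: borel_set_induct)
      case (interval a b)
      \<comment> \<open>Endpoints are null, so the closed interval of the induction may be taken to
        meet the window in an open interval.\<close>
      have "AE x in lebesgue. x \<noteq> a" "AE x in lebesgue. x \<noteq> b"
        by (rule AE_I'[of "{a}"] AE_I'[of "{b}"]; auto simp: negligible_iff_null_sets[symmetric])+
      then have "AE x in lebesgue. indicator {a..b} x *\<^sub>R ?g x =
          indicator {max a (- real N)<..<min b (real N)} x *\<^sub>R w x"
        by eventually_elim (auto split: split_indicator)
      then have "(\<integral>x. indicator {a..b} x *\<^sub>R ?g x \<partial>lebesgue) =
          (\<integral>x. indicator {max a (- real N)<..<min b (real N)} x *\<^sub>R w x \<partial>lebesgue)"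
        by (rule integral_cong_AE[rotated 2])
           (use si[of "{a..b}"] locally_integrable_Ioo[OF w] in \<open>auto simp: set_integrable_def
              intro: borel_measurable_integrable\<close>)
      then show ?case
        using zero by (simp add: set_lebesgue_integral_def)
    next
      case (compl A)
      have "(LINT x:A \<union> - A|lebesgue. ?g x) = (LINT x:A|lebesgue. ?g x) + (LINT x:-A|lebesgue. ?g x)"
        using compl by (intro set_integral_Un si) auto
      then show ?case using compl tot by (simp add: set_lebesgue_integral_def)
    next
      case (union f)
      have "(LINT x:(\<Union>i. f i)|lebesgue. ?g x) = (\<Sum>i. (LINT x:(f i)|lebesgue. ?g x))"
        using union by (intro lebesgue_integral_countable_add si) (auto simp: disjoint_family_on_def)
      then show ?case using union by simp
    qed (simp add: set_lebesgue_integral_def)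
    fix A :: "real set" assume A: "A \<in> sets lebesgue"
    \<comment> \<open>A Lebesgue set is a Borel set together with part of a Borel null set.\<close>
    obtain S B N' where S: "A = S \<union> B" "S \<in> sets borel" "B \<subseteq> N'" "N' \<in> null_sets lborel"
      using sets_completionE[OF A] by (metis sets_lborel)
    have "AE x in lebesgue. x \<notin> N'"
      using S(4) by (intro AE_not_in null_sets_completionI)
    then have "AE x in lebesgue. x \<notin> B"
      by eventually_elim (use S(3) in auto)
    then have "AE x in lebesgue. indicator A x *\<^sub>R ?g x = indicator S x *\<^sub>R ?g x"
      by eventually_elim (auto simp: S(1) split: split_indicator)
    then have "(\<integral>x. indicator A x *\<^sub>R ?g x \<partial>lebesgue) = (\<integral>x. indicator S x *\<^sub>R ?g x \<partial>lebesgue)"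
      by (rule integral_cong_AE[rotated 2])
         (use si[OF A] si[of S] S(2) in \<open>auto simp: set_integrable_def intro: borel_measurable_integrable\<close>)
    then show "(LINT x:A|lebesgue. ?g x) = (LINT x:A|lebesgue. 0)"
      using borel[OF S(2)] by (simp add: set_lebesgue_integral_def)
  qed simp
  then have "AE x in lebesgue. \<forall>N. indicator {- real N<..<real N} x *\<^sub>R w x = 0"
    by (subst AE_all_countable) blast
  then show ?thesis
  proof eventually_elim
    case (elim x)
    obtain N :: nat where "\<bar>x\<bar> < real N" using reals_Archimedean2 by blast
    then show ?case using elim[rule_format, of N] by (auto split: split_indicator_asm)
  qed
qed

lemma AE_zero_if_interval_integrals_zero:
  fixes w :: "real \<Rightarrow> 'a::euclidean_space"
  assumes w: "locally_integrable w"
    and zero: "\<And>a b. (LINT x:{a<..<b}|lebesgue. w x) = 0"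
  shows "AE x in lebesgue. w x = 0"
proof -
  have "AE x in lebesgue. w x \<bullet> i = 0" for i
  proof (rule AE_zero_if_interval_integrals_zero_real)
    have lin: "bounded_linear (\<lambda>y. y \<bullet> i)" by (rule bounded_linear_inner_left)
    show "locally_integrable (\<lambda>x. w x \<bullet> i)"
      using absolutely_integrable_linear[OF _ lin, where f = w] w by (simp add: locally_integrable_def o_def)
    fix a b :: real
    have "set_integrable lebesgue {a<..<b} w"
      using w unfolding locally_integrable_def by (meson absolutely_integrable_on_Icc_iff_Ioo)
    then show "(LINT x:{a<..<b}|lebesgue. w x \<bullet> i) = 0"
      using zero[of a b] Bochner_Integration.integral_inner_left[where c = i and M = lebesgue
          and f = "\<lambda>x. indicator {a<..<b} x *\<^sub>R w x"]
      by (simp add: set_lebesgue_integral_def set_integrable_def)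
  qed
  then have "AE x in lebesgue. \<forall>i\<in>Basis. w x \<bullet> i = 0"
    by (simp add: AE_finite_all)
  then show ?thesis
  proof (rule AE_mp, intro AE_I2 impI)
    fix x assume "\<forall>i\<in>Basis. w x \<bullet> i = 0"
    then show "w x = 0" by (rule euclidean_all_zero_iff[THEN iffD1])
  qed
qed

lemma AE_zero_if_test_integrals_zero:
  fixes w :: "real \<Rightarrow> 'a::euclidean_space"
  assumes w: "locally_integrable w"
    and zero: "\<And>\<phi>. test_function \<phi> \<Longrightarrow> (\<integral>x. \<phi> x *\<^sub>R w x \<partial>lebesgue) = 0"
  shows "AE x in lebesgue. w x = 0"
proof (rule AE_zero_if_interval_integrals_zero[OF w])
  fix a b :: real
  have "(\<lambda>n::nat. 0) \<longlonglongrightarrow> (LINT x:{a<..<b}|lebesgue. w x)"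
    using bump_integral_tendsto[OF w, of a b] zero[OF bump_test_function] by simp
  then show "(LINT x:{a<..<b}|lebesgue. w x) = 0"
    using LIMSEQ_unique[OF tendsto_const] by metis
qed

text \<open>Du Bois-Reymond: subtracting a multiple of a fixed bump turns a bump into the derivative of a
  test function.\<close>

lemma AE_const_if_test_derivative_integrals_zero:
  fixes w :: "real \<Rightarrow> 'a::euclidean_space"
  assumes w: "locally_integrable w"
    and zero: "\<And>\<phi>. test_function \<phi> \<Longrightarrow> (\<integral>x. deriv \<phi> x *\<^sub>R w x \<partial>lebesgue) = 0"
  shows "\<exists>c. AE x in lebesgue. w x = c"
proof -
  define \<psi> where "\<psi> = bump 0 0 1"
  have \<psi>: "test_function \<psi>" by (simp add: \<psi>_def bump_test_function)
  have one: "locally_integrable (\<lambda>x. 1::real)"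
    by (intro continuous_locally_integrable continuous_intros)
  note int = test_function_times_integrable[OF _ w] and int1 = test_function_times_integrable[OF _ one, simplified]
  define J where "J = (\<integral>x. \<psi> x \<partial>lebesgue)"
  have "J > 0"
  proof -
    have "J \<noteq> 0"
    proof
      assume "J = 0"
      then have "AE x in lebesgue. \<psi> x = 0"
        unfolding J_def using bump_bounds(1) int1[OF \<psi>]
        by (subst (asm) integral_nonneg_eq_0_iff_AE) (auto simp: \<psi>_def)
      then have "AE x in lebesgue. x \<notin> {0::real<..<1}"
        by eventually_elim (use bump_pos[of 0 _ 1 0] in \<open>force simp: \<psi>_def\<close>)
      then have "{0::real<..<1} \<in> null_sets lebesgue"
        by (subst (asm) AE_iff_null_sets[symmetric]) auto
      then show False
        by (simp add: null_sets_def)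
    qed
    moreover have "J \<ge> 0"
      unfolding J_def \<psi>_def by (intro integral_nonneg_AE AE_I2 bump_bounds)
    ultimately show ?thesis by linarith
  qed
  \<comment> \<open>The mean of \<open>w\<close> with respect to \<open>\<psi>\<close>: the only
    constant that \<open>w\<close> can equal.\<close>
  define c where "c = (\<integral>x. \<psi> x *\<^sub>R w x \<partial>lebesgue) /\<^sub>R J"
  have c: "locally_integrable (\<lambda>x. c)"
    by (intro continuous_locally_integrable continuous_intros)
  have "AE x in lebesgue. w x - c = 0"
  proof (rule AE_zero_if_interval_integrals_zero)
    show "locally_integrable (\<lambda>x. w x - c)"
      by (intro locally_integrable_diff w c)
    fix a b :: real
    have "(\<integral>x. bump n a b x *\<^sub>R (w x - c) \<partial>lebesgue) = 0" for n
    proof -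
      \<comment> \<open>\<open>K\<close> gives \<open>?\<eta>\<close> total integral 0, which is
        what makes its primitive vanish to the right of the support as well.\<close>
      define K where "K = (\<integral>x. bump n a b x \<partial>lebesgue) / J"
      let ?\<eta> = "\<lambda>x. bump n a b x - K * \<psi> x"
      have \<eta>1: "?\<eta> \<in> flat_algebra"
      proof -
        have "(\<lambda>x. bump n a b x + (- K) * \<psi> x) \<in> flat_algebra"
          unfolding \<psi>_def by (intro flat_algebra.intros bump_flat_algebra)
        then show ?thesis by simp
      qed
      define R where "R = \<bar>a\<bar> + \<bar>b\<bar> + 1"
      have \<eta>0: "?\<eta> x = 0" if "R \<le> \<bar>x\<bar>" for x
      proof -
        have "x \<notin> {a<..<b}" "x \<notin> {0<..<1}"
          using that by (auto simp: R_def abs_if split: if_splits)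
        then show ?thesis using bump_outside by (simp add: \<psi>_def)
      qed
      have \<eta>: "test_function ?\<eta>"
        by (rule flat_algebra_test_function[OF \<eta>1, of R]) (intro \<eta>0, simp)
      have cont: "continuous_on S ?\<eta>" for S by (rule test_function_continuous[OF \<eta>])
      have \<eta>i: "(\<integral>x. ?\<eta> x \<partial>lebesgue) = 0"
        using \<open>J > 0\<close> by (subst Bochner_Integration.integral_diff) (auto simp: int1 bump_test_function \<psi> K_def J_def)
      obtain \<Phi>0 where \<Phi>0: "primitive \<Phi>0 ?\<eta>"
        using primitive_exists[of ?\<eta> 0] continuous_locally_integrable[OF cont]
        unfolding locally_integrable_def by blast
      define \<Phi> where "\<Phi> x = \<Phi>0 x - \<Phi>0 (-R)" for x
      have \<Phi>: "primitive \<Phi> ?\<eta>"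
        unfolding \<Phi>_def using primitive_diff[OF \<Phi>0 primitive_const] by simp
      have d\<Phi>: "(\<Phi> has_real_derivative ?\<eta> x) (at x)" for x
      proof -
        have "((\<lambda>y. integral {x-1..y} ?\<eta>) has_vector_derivative ?\<eta> x) (at x within {x-1..x+1})"
          by (rule integral_has_vector_derivative[OF cont]) auto
        then have "((\<lambda>y. integral {x-1..y} ?\<eta>) has_vector_derivative ?\<eta> x) (at x)"
          by (simp add: at_within_Icc_at)
        then have "((\<lambda>y. \<Phi> (x-1) + integral {x-1..y} ?\<eta>) has_real_derivative ?\<eta> x) (at x)"
          by (auto simp: has_real_derivative_iff_has_vector_derivative intro!: derivative_eq_intros)
        then show ?thesis
        proof (rule has_field_derivative_transform_within_open)
          show "open {x-1<..<x+1}" by simp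
          show "\<Phi> (x-1) + integral {x-1..y} ?\<eta> = \<Phi> y" if "y \<in> {x-1<..<x+1}" for y
            using primitiveD(4)[OF \<Phi>, of "x-1" y] that by simp
        qed simp
      qed
      have "deriv \<Phi> = ?\<eta>"
        using d\<Phi> by (intro ext DERIV_imp_deriv)
      have \<Phi>l: "\<Phi> x = 0" if "x \<le> -R" for x
      proof -
        have "integral {x..-R} ?\<eta> = integral {x..-R} (\<lambda>x. 0)"
          by (rule Henstock_Kurzweil_Integration.integral_cong) (rule \<eta>0, simp, linarith)
        then show ?thesis
          using primitiveD(4)[OF \<Phi> that] by (simp add: \<Phi>_def)
      qed
      have \<Phi>r: "\<Phi> x = 0" if "R \<le> x" for x
      proof -
        have "-R \<le> x" using that by (simp add: R_def)
        have "integral {-R..x} ?\<eta> = (LINT y:{-R..x}|lebesgue. ?\<eta> y)"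
          by (rule set_lebesgue_integral_eq_integral(2)[symmetric, OF primitiveD(1)[OF \<Phi>]])
        also have "\<dots> = (\<integral>x. ?\<eta> x \<partial>lebesgue)"
          unfolding set_lebesgue_integral_def
        proof (rule Bochner_Integration.integral_cong)
          fix y
          show "indicat_real {-R..x} y *\<^sub>R ?\<eta> y = ?\<eta> y"
          proof (cases "y \<in> {-R..x}")
            case False
            then have "R \<le> \<bar>y\<bar>" using that by (cases "y < -R") auto
            then show ?thesis using \<eta>0[of y] by simp
          qed simp
        qed simp
        finally show ?thesis
          using primitiveD(4)[OF \<Phi> \<open>-R \<le> x\<close>] \<eta>i by (simp add: \<Phi>_def)
      qed
      have "test_function \<Phi>"
        unfolding test_function_def
      proof (intro conjI allI exI[of _ R] impI)
        show "\<Phi> x = 0" if "R < \<bar>x\<bar>" for x using \<Phi>l[of x] \<Phi>r[of x] that by linarith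
        show "(deriv ^^ k) \<Phi> differentiable at x" for k x
        proof (cases k)
          case 0 then show ?thesis using d\<Phi> real_differentiable_def by auto
        next
          case (Suc j)
          have "(deriv ^^ j) ?\<eta> differentiable at x"
            using \<eta> by (simp add: test_function_def)
          then show ?thesis
            using Suc \<open>deriv \<Phi> = ?\<eta>\<close> by (simp only: funpow_Suc_right o_apply)
        qed
      qed
      from zero[OF this] have "(\<integral>x. ?\<eta> x *\<^sub>R w x \<partial>lebesgue) = 0"
        by (simp add: \<open>deriv \<Phi> = ?\<eta>\<close>)
      also have "(\<integral>x. ?\<eta> x *\<^sub>R w x \<partial>lebesgue) =
          (\<integral>x. bump n a b x *\<^sub>R w x \<partial>lebesgue) - K *\<^sub>R (\<integral>x. \<psi> x *\<^sub>R w x \<partial>lebesgue)"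
      proof -
        have "(\<integral>x. ?\<eta> x *\<^sub>R w x \<partial>lebesgue) =
            (\<integral>x. bump n a b x *\<^sub>R w x - K *\<^sub>R (\<psi> x *\<^sub>R w x) \<partial>lebesgue)"
          by (simp add: scaleR_diff_left)
        also have "\<dots> = (\<integral>x. bump n a b x *\<^sub>R w x \<partial>lebesgue) - (\<integral>x. K *\<^sub>R (\<psi> x *\<^sub>R w x) \<partial>lebesgue)"
          by (intro Bochner_Integration.integral_diff integrable_scaleR_right int \<psi> bump_test_function)
        finally show ?thesis by (simp only: integral_scaleR_right)
      qed
      also have "K *\<^sub>R (\<integral>x. \<psi> x *\<^sub>R w x \<partial>lebesgue) = (\<integral>x. bump n a b x \<partial>lebesgue) *\<^sub>R c"
        by (simp add: c_def K_def divide_inverse)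
      also have "\<dots> = (\<integral>x. bump n a b x *\<^sub>R c \<partial>lebesgue)"
        by (rule integral_scaleR_left[symmetric]) (simp add: int1 bump_test_function)
      finally show ?thesis
        using int[OF bump_test_function[of n a b]]
          test_function_times_integrable[OF bump_test_function[of n a b] c]
        by (simp add: scaleR_diff_right)
    qed
    then have "(\<lambda>n::nat. 0) \<longlonglongrightarrow> (LINT x:{a<..<b}|lebesgue. w x - c)"
      using bump_integral_tendsto[OF locally_integrable_diff[OF w c], of a b] by simp
    then show "(LINT x:{a<..<b}|lebesgue. w x - c) = 0"
      using LIMSEQ_unique[OF tendsto_const] by metis
  qed
  then show ?thesis by auto
qed

section \<open>Complex-valued primitives and comparison of increments\<close>

lemma primitive_Re: "primitive F f \<Longrightarrow> primitive (\<lambda>x. Re (F x)) (\<lambda>x. Re (f x))"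
  by (rule primitive_linear[OF _ bounded_linear_Re])

lemma primitive_Im: "primitive F f \<Longrightarrow> primitive (\<lambda>x. Im (F x)) (\<lambda>x. Im (f x))"
  by (rule primitive_linear[OF _ bounded_linear_Im])

lemma primitive_complexI:
  assumes "primitive (\<lambda>x. Re (F x)) (\<lambda>x. Re (f x))" "primitive (\<lambda>x. Im (F x)) (\<lambda>x. Im (f x))"
  shows "primitive F f"
proof -
  have "bounded_linear (\<lambda>y. \<i> * complex_of_real y)"
    by (intro bounded_linear_mult_right[THEN bounded_linear_compose] bounded_linear_of_real)
  then have "primitive (\<lambda>x. complex_of_real (Re (F x)) + \<i> * complex_of_real (Im (F x)))
      (\<lambda>x. complex_of_real (Re (f x)) + \<i> * complex_of_real (Im (f x)))"
    by (intro primitive_add primitive_linear[OF assms(1)] primitive_linear[OF assms(2)] bounded_linear_of_real)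
  then show ?thesis by (simp add: complex_eq[symmetric])
qed

lemma primitive_mono:
  fixes f g :: "real \<Rightarrow> real"
  assumes F: "primitive F f" and G: "primitive G g" and "a \<le> b"
    and le: "\<And>x. a \<le> x \<Longrightarrow> x \<le> b \<Longrightarrow> f x \<le> g x"
  shows "F b - F a \<le> G b - G a"
proof -
  have "integral {a..b} f \<le> integral {a..b} g"
    by (rule integral_le) (use le primitiveD(2)[OF F] primitiveD(2)[OF G] in auto)
  then show ?thesis
    using primitiveD(4)[OF F \<open>a \<le> b\<close>] primitiveD(4)[OF G \<open>a \<le> b\<close>] by simp
qed

lemma primitive_increment_eq_lebesgue:
  assumes "primitive F f" "a \<le> b"
  shows "F b - F a = (\<integral>x. indicator {a..b} x *\<^sub>R f x \<partial>lebesgue)"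
  using primitiveD(4)[OF assms] set_lebesgue_integral_eq_integral(2)[OF primitiveD(1)[OF assms(1)], of a b]
  by (simp add: set_lebesgue_integral_def)

lemma integrable_lebesgue_locally_integrable:
  fixes f :: "real \<Rightarrow> 'a::euclidean_space"
  shows "integrable lebesgue f \<Longrightarrow> locally_integrable f"
  unfolding locally_integrable_def set_integrable_def
  by (intro allI integrable_mult_indicator) auto

lemma primitive_increment_le_total:
  fixes f :: "real \<Rightarrow> real"
  assumes "primitive F f" "integrable lebesgue f" "\<And>x. 0 \<le> f x"
  shows "F b - F a \<le> (\<integral>x. f x \<partial>lebesgue)"
proof (cases "a \<le> b")
  case True
  show ?thesis
    unfolding primitive_increment_eq_lebesgue[OF assms(1) True]
    by (intro integral_mono integrable_mult_indicator assms(2))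
       (auto simp: assms(3) split: split_indicator)
next
  \<comment> \<open>For \<open>b < a\<close> the increment is nonpositive. Used with both orders of
    the endpoints, the lemma bounds the absolute increment.\<close>
  case False
  then have "F b - F a \<le> 0"
    using primitive_mono[OF primitive_const[of 0] assms(1), of b a] assms(3) by simp
  also have "0 \<le> (\<integral>x. f x \<partial>lebesgue)"
    by (rule Bochner_Integration.integral_nonneg) (rule assms(3))
  finally show ?thesis .
qed

subsection \<open>Weak derivatives and primitives\<close>

lemma primitive_times_test_function:
  assumes "test_function \<phi>" "primitive U v"
  shows "primitive (\<lambda>x. \<phi> x *\<^sub>R U x) (\<lambda>x. deriv \<phi> x *\<^sub>R U x + \<phi> x *\<^sub>R (v x :: complex))"
proof -
  have \<phi>: "primitive \<phi> (deriv \<phi>)"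
    by (rule primitive_of_derivative)
       (auto intro: test_function_deriv[OF assms(1)] test_function_continuous)
  show ?thesis
    by (rule primitive_complexI)
       (use primitive_mult[OF \<phi> primitive_Re[OF assms(2)]] primitive_mult[OF \<phi> primitive_Im[OF assms(2)]] in simp_all)
qed

text \<open>The integrated product rule; the boundary term vanishes beyond the support of
  \<open>\<phi>\<close>.\<close>

lemma primitive_integral_test:
  assumes \<phi>: "test_function \<phi>" and U: "primitive U (v :: real \<Rightarrow> complex)"
  shows "(\<integral>x. deriv \<phi> x *\<^sub>R U x \<partial>lebesgue) = - (\<integral>x. \<phi> x *\<^sub>R v x \<partial>lebesgue)"
proof -
  obtain R where R: "R > 0" "\<And>x. R \<le> \<bar>x\<bar> \<Longrightarrow> \<phi> x = 0"
    using test_function_support[OF \<phi>] by blast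
  obtain R' where R': "R' > 0" "\<And>x. R' \<le> \<bar>x\<bar> \<Longrightarrow> deriv \<phi> x = 0"
    using test_function_support[OF test_function_deriv(1)[OF \<phi>]] by blast
  define S where "S = max R R'"
  have S: "S > 0" "\<And>x. S \<le> \<bar>x\<bar> \<Longrightarrow> \<phi> x = 0" "\<And>x. S \<le> \<bar>x\<bar> \<Longrightarrow> deriv \<phi> x = 0"
    using R R' by (auto simp: S_def)
  have "(\<integral>x. deriv \<phi> x *\<^sub>R U x + \<phi> x *\<^sub>R v x \<partial>lebesgue) =
      (\<integral>x. indicator {-S..S} x *\<^sub>R (deriv \<phi> x *\<^sub>R U x + \<phi> x *\<^sub>R v x) \<partial>lebesgue)"
  proof (rule Bochner_Integration.integral_cong)
    fix x
    show "deriv \<phi> x *\<^sub>R U x + \<phi> x *\<^sub>R v x = indicator {-S..S} x *\<^sub>R (deriv \<phi> x *\<^sub>R U x + \<phi> x *\<^sub>R v x)"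
      using S(2,3)[of x] by (cases "x \<in> {-S..S}") auto
  qed simp
  also have "\<dots> = \<phi> S *\<^sub>R U S - \<phi> (-S) *\<^sub>R U (-S)"
    using primitive_increment_eq_lebesgue[OF primitive_times_test_function[OF \<phi> U], of "-S" S] S(1) by simp
  also have "\<dots> = 0" using S by simp
  finally have "(\<integral>x. deriv \<phi> x *\<^sub>R U x + \<phi> x *\<^sub>R v x \<partial>lebesgue) = 0" .
  moreover have "(\<integral>x. deriv \<phi> x *\<^sub>R U x + \<phi> x *\<^sub>R v x \<partial>lebesgue) =
      (\<integral>x. deriv \<phi> x *\<^sub>R U x \<partial>lebesgue) + (\<integral>x. \<phi> x *\<^sub>R v x \<partial>lebesgue)"
    by (intro Bochner_Integration.integral_add test_function_times_integrable test_function_deriv(1) \<phi>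
        primitive_locally_integrable[OF U] continuous_locally_integrable primitive_continuous[OF U])
  ultimately show ?thesis by (simp add: eq_neg_iff_add_eq_0)
qed

lemma has_weak_derivative_unique:
  assumes "has_weak_derivative k u v" "has_weak_derivative k u v'"
    and "locally_integrable v" "locally_integrable v'"
  shows "AE x in lebesgue. v x = v' x"
proof -
  have "AE x in lebesgue. v x - v' x = 0"
  proof (rule AE_zero_if_test_integrals_zero)
    show "locally_integrable (\<lambda>x. v x - v' x)"
      by (intro locally_integrable_diff assms)
    fix \<phi> assume \<phi>: "test_function \<phi>"
    have "(\<integral>x. \<phi> x *\<^sub>R v x \<partial>lebesgue) = (\<integral>x. \<phi> x *\<^sub>R v' x \<partial>lebesgue)"
      using assms(1,2) \<phi> by (auto simp: has_weak_derivative_def)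
    then show "(\<integral>x. \<phi> x *\<^sub>R (v x - v' x) \<partial>lebesgue) = 0"
      using test_function_times_integrable[OF \<phi> assms(3)] test_function_times_integrable[OF \<phi> assms(4)]
      by (simp add: scaleR_diff_right)
  qed
  then show ?thesis by simp
qed

text \<open>Any primitive of \<open>v\<close> has the same weak derivative as \<open>w\<close>. The
  difference is constant by du Bois-Reymond, and the constant is absorbed into the
  primitive.\<close>

lemma AE_eq_primitive:
  fixes w v :: "real \<Rightarrow> complex"
  assumes w: "locally_integrable w" and v: "locally_integrable v"
    and eq: "\<And>\<phi>. test_function \<phi> \<Longrightarrow>
      (\<integral>x. deriv \<phi> x *\<^sub>R w x \<partial>lebesgue) = - (\<integral>x. \<phi> x *\<^sub>R v x \<partial>lebesgue)"
  obtains W where "primitive W v" "AE x in lebesgue. w x = W x"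
proof -
  obtain W0 where W0: "primitive W0 v"
    using primitive_exists v unfolding locally_integrable_def by blast
  have lW0: "locally_integrable W0"
    by (intro continuous_locally_integrable primitive_continuous[OF W0])
  have "\<exists>c. AE x in lebesgue. w x - W0 x = c"
  proof (rule AE_const_if_test_derivative_integrals_zero)
    show "locally_integrable (\<lambda>x. w x - W0 x)" by (intro locally_integrable_diff w lW0)
    fix \<phi> assume \<phi>: "test_function \<phi>"
    show "(\<integral>x. deriv \<phi> x *\<^sub>R (w x - W0 x) \<partial>lebesgue) = 0"
      using test_function_times_integrable[OF test_function_deriv(1)[OF \<phi>] w]
        test_function_times_integrable[OF test_function_deriv(1)[OF \<phi>] lW0]
        eq[OF \<phi>] primitive_integral_test[OF \<phi> W0]
      by (simp add: scaleR_diff_right)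
  qed
  then obtain c where c: "AE x in lebesgue. w x - W0 x = c" by blast
  show ?thesis
  proof (rule that)
    show "primitive (\<lambda>x. W0 x + c) v"
      using primitive_add[OF W0 primitive_const[of c]] by simp
    show "AE x in lebesgue. w x = W0 x + c"
      using c by eventually_elim (auto simp: algebra_simps)
  qed
qed

section \<open>Closure properties of square integrable functions\<close>

lemma L2_cong_AE:
  assumes "f \<in> L2" "AE x in lebesgue. f x = g x"
  shows "g \<in> L2"
proof -
  have "f \<in> borel_measurable lebesgue" using assms(1) by (simp add: L2_def)
  then have g: "g \<in> borel_measurable lebesgue"
    by (rule borel_measurable_AE[OF _ assms(2)])
  have "AE x in lebesgue. (cmod (f x))\<^sup>2 = (cmod (g x))\<^sup>2"
    using assms(2) by eventually_elim simp
  then have "integrable lebesgue (\<lambda>x. (cmod (f x))\<^sup>2) \<longleftrightarrow> integrable lebesgue (\<lambda>x. (cmod (g x))\<^sup>2)"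
    using assms(1) g by (intro integrable_cong_AE) (auto simp: L2_def)
  then show ?thesis using assms(1) g by (simp add: L2_def)
qed

lemma L2_norm_cong_AE:
  assumes "f \<in> L2" "AE x in lebesgue. f x = g x"
  shows "L2_norm f = L2_norm g"
proof -
  have "AE x in lebesgue. (cmod (f x))\<^sup>2 = (cmod (g x))\<^sup>2"
    using assms(2) by eventually_elim simp
  then have "(\<integral>x. (cmod (f x))\<^sup>2 \<partial>lebesgue) = (\<integral>x. (cmod (g x))\<^sup>2 \<partial>lebesgue)"
    using assms(1) L2_cong_AE[OF assms] by (intro integral_cong_AE) (auto simp: L2_def)
  then show ?thesis by (simp add: L2_norm_def)
qed

lemma L2_add:
  assumes "f \<in> L2" "g \<in> L2"
  shows "(\<lambda>x. f x + g x) \<in> L2"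
proof -
  have m: "(\<lambda>x. f x + g x) \<in> borel_measurable lebesgue"
    using assms by (auto simp: L2_def)
  have "integrable lebesgue (\<lambda>x. 2 * (cmod (f x))\<^sup>2 + 2 * (cmod (g x))\<^sup>2)"
    using assms by (auto simp: L2_def)
  then have "integrable lebesgue (\<lambda>x. (cmod (f x + g x))\<^sup>2)"
  proof (rule Bochner_Integration.integrable_bound)
    show "(\<lambda>x. (cmod (f x + g x))\<^sup>2) \<in> borel_measurable lebesgue" using m by simp
    show "AE x in lebesgue. norm ((cmod (f x + g x))\<^sup>2) \<le> norm (2 * (cmod (f x))\<^sup>2 + 2 * (cmod (g x))\<^sup>2)"
    proof (intro AE_I2)
      fix x
      have "(cmod (f x + g x))\<^sup>2 \<le> (cmod (f x) + cmod (g x))\<^sup>2"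
        by (intro power_mono norm_triangle_ineq) simp
      also have "\<dots> \<le> 2 * (cmod (f x))\<^sup>2 + 2 * (cmod (g x))\<^sup>2"
        using zero_le_power2[of "cmod (f x) - cmod (g x)"] unfolding power2_eq_square
        by (simp add: algebra_simps)
      finally show "norm ((cmod (f x + g x))\<^sup>2) \<le> norm (2 * (cmod (f x))\<^sup>2 + 2 * (cmod (g x))\<^sup>2)"
        by simp
    qed
  qed
  then show ?thesis using m by (simp add: L2_def)
qed

lemma L2_bounded_mult:
  assumes q: "q \<in> borel_measurable lebesgue" "\<And>x. cmod (q x) \<le> B" and f: "f \<in> L2"
  shows "(\<lambda>x. q x * f x) \<in> L2"
proof -
  have m: "(\<lambda>x. q x * f x) \<in> borel_measurable lebesgue"
    using f q(1) by (auto simp: L2_def)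
  have "integrable lebesgue (\<lambda>x. B\<^sup>2 * (cmod (f x))\<^sup>2)"
    using f by (auto simp: L2_def)
  then have "integrable lebesgue (\<lambda>x. (cmod (q x * f x))\<^sup>2)"
  proof (rule Bochner_Integration.integrable_bound)
    show "(\<lambda>x. (cmod (q x * f x))\<^sup>2) \<in> borel_measurable lebesgue" using m by simp
    show "AE x in lebesgue. norm ((cmod (q x * f x))\<^sup>2) \<le> norm (B\<^sup>2 * (cmod (f x))\<^sup>2)"
      using q(2) by (intro AE_I2) (auto simp: norm_mult power_mult_distrib intro!: mult_right_mono power_mono)
  qed
  then show ?thesis using m by (simp add: L2_def)
qed

text \<open>Passage from weak derivatives to calculus. Testing the first-order identity with
  \<open>deriv \<phi>\<close> shows that the second weak derivative of \<open>u\<close> is the first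
  one of \<open>v1\<close>, so the representation by primitives applies twice.\<close>

lemma H2_primitive_representative:
  assumes "u \<in> H2"
  obtains U P v where "primitive U P" "primitive P v" "U \<in> L2" "P \<in> L2" "v \<in> L2"
    "AE x in lebesgue. u x = U x" "AE x in lebesgue. weak_derivative 2 u x = v x"
proof -
  obtain v1 where v1: "v1 \<in> L2" "has_weak_derivative 1 u v1"
    using assms by (auto simp: H2_def)
  have "\<exists>v. v \<in> L2 \<and> has_weak_derivative 2 u v"
    using assms by (auto simp: H2_def)
  then have v2: "weak_derivative 2 u \<in> L2" "has_weak_derivative 2 u (weak_derivative 2 u)"
    unfolding weak_derivative_def by (metis (mono_tags, lifting) someI_ex)+
  have u: "u \<in> L2" using assms by (simp add: H2_def)
  have eq1: "(\<integral>x. deriv \<phi> x *\<^sub>R u x \<partial>lebesgue) = - (\<integral>x. \<phi> x *\<^sub>R v1 x \<partial>lebesgue)"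
    if "test_function \<phi>" for \<phi>
    using v1(2) that by (simp add: has_weak_derivative_def)
  have eq2: "(\<integral>x. deriv \<phi> x *\<^sub>R v1 x \<partial>lebesgue) = - (\<integral>x. \<phi> x *\<^sub>R weak_derivative 2 u x \<partial>lebesgue)"
    if "test_function \<phi>" for \<phi>
  proof -
    have "(\<integral>x. deriv (deriv \<phi>) x *\<^sub>R u x \<partial>lebesgue) = (\<integral>x. \<phi> x *\<^sub>R weak_derivative 2 u x \<partial>lebesgue)"
      using v2(2) that by (simp add: has_weak_derivative_def numeral_2_eq_2)
    then show ?thesis using eq1[OF test_function_deriv(1)[OF that]] by (metis minus_minus)
  qed
  obtain P where P: "primitive P (weak_derivative 2 u)" "AE x in lebesgue. v1 x = P x"
    using AE_eq_primitive[OF L2_locally_integrable[OF v1(1)] L2_locally_integrable[OF v2(1)] eq2] by blast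
  obtain U0 where U0: "primitive U0 v1" "AE x in lebesgue. u x = U0 x"
    using AE_eq_primitive[OF L2_locally_integrable[OF u] L2_locally_integrable[OF v1(1)] eq1] by blast
  show ?thesis
    by (rule that[of U0 P "weak_derivative 2 u"])
       (use P U0 v2 L2_cong_AE[OF u U0(2)] L2_cong_AE[OF v1(1) P(2)] in \<open>auto intro: primitive_cong_AE\<close>)
qed

text \<open>\<open>weak_derivative\<close> is only a choice; uniqueness of weak derivatives
  identifies it with \<open>v\<close> almost everywhere.\<close>

lemma H2_if_primitives:
  assumes U: "primitive U P" and P: "primitive P v" and L2: "U \<in> L2" "P \<in> L2" "v \<in> L2"
  shows "U \<in> H2" "AE x in lebesgue. weak_derivative 2 U x = v x"
proof -
  have w1: "has_weak_derivative 1 U P"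
    using primitive_integral_test[OF _ U] by (simp add: has_weak_derivative_def)
  have w2: "has_weak_derivative 2 U v"
    using primitive_integral_test[OF test_function_deriv(1) U] primitive_integral_test[OF _ P]
    by (simp add: has_weak_derivative_def numeral_2_eq_2)
  show "U \<in> H2" using w1 w2 L2 by (auto simp: H2_def)
  have "weak_derivative 2 U \<in> L2 \<and> has_weak_derivative 2 U (weak_derivative 2 U)"
    unfolding weak_derivative_def by (rule someI[of _ v]) (use w2 L2 in auto)
  then show "AE x in lebesgue. weak_derivative 2 U x = v x"
    using has_weak_derivative_unique[OF _ w2] L2_locally_integrable L2(3) by blast
qed

subsection \<open>Behaviour at infinity\<close>

text \<open>An integrable function need not tend to 0, but it is small somewhere in every window of
  one fixed length. This substitutes for decay at infinity.\<close>

lemma integrable_small_somewhere: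
  fixes G :: "real \<Rightarrow> real"
  assumes G: "integrable lebesgue G" and "\<eta> > 0"
  obtains L where "L > 0" "\<And>a. \<exists>y. a < y \<and> y < a + L \<and> \<bar>G y\<bar> < \<eta>"
proof -
  \<comment> \<open>If the absolute value of \<open>G\<close> were at least \<open>\<eta>\<close> on
    a window of this length, its integral there would exceed the total one by
    \<open>\<eta>\<close>.\<close>
  define L where "L = (\<integral>x. \<bar>G x\<bar> \<partial>lebesgue) / \<eta> + 1"
  have nn: "0 \<le> (\<integral>x. \<bar>G x\<bar> \<partial>lebesgue)" by simp
  have L: "L > 0" using nn \<open>\<eta> > 0\<close> by (simp add: L_def add_nonneg_pos)
  have "\<exists>y. a < y \<and> y < a + L \<and> \<bar>G y\<bar> < \<eta>" for a
  proof (rule ccontr)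
    assume "\<nexists>y. a < y \<and> y < a + L \<and> \<bar>G y\<bar> < \<eta>"
    then have *: "\<eta> \<le> \<bar>G y\<bar>" if "a < y" "y < a + L" for y using that by force
    have "(\<integral>x. \<eta> * indicator {a<..<a+L} x \<partial>lebesgue) \<le> (\<integral>x. \<bar>G x\<bar> \<partial>lebesgue)"
    proof (rule integral_mono)
      show "integrable lebesgue (\<lambda>x. \<eta> * indicator {a<..<a+L} x)"
        by (intro integrable_mult_right integrable_real_indicator) (use L in auto)
    qed (use * G in \<open>auto split: split_indicator\<close>)
    then have "\<eta> * L \<le> (\<integral>x. \<bar>G x\<bar> \<partial>lebesgue)" using L by simp
    moreover have "\<eta> * L = (\<integral>x. \<bar>G x\<bar> \<partial>lebesgue) + \<eta>"
      using \<open>\<eta> > 0\<close> by (simp add: L_def distrib_left)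
    ultimately show False using \<open>\<eta> > 0\<close> by linarith
  qed
  then show ?thesis using that L by blast
qed

text \<open>The integral is a limit of increments of \<open>G\<close> between points that tend to
  both infinities and along which \<open>G\<close> is small.\<close>

lemma integral_derivative_eq_0:
  fixes g :: "real \<Rightarrow> real"
  assumes Gg: "primitive G g" and G: "integrable lebesgue G" and g: "integrable lebesgue g"
  shows "(\<integral>x. g x \<partial>lebesgue) = 0"
proof -
  have ex: "\<exists>x y. x < - real n \<and> real n < y \<and> \<bar>G x\<bar> < inverse (real (Suc n)) \<and> \<bar>G y\<bar> < inverse (real (Suc n))" for n
  proof -
    obtain L where L: "L > 0" "\<And>a. \<exists>y. a < y \<and> y < a + L \<and> \<bar>G y\<bar> < inverse (real (Suc n))"
      using integrable_small_somewhere[OF G, of "inverse (real (Suc n))"] by auto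
    \<comment> \<open>Starting the left window at \<open>- real n - L\<close> forces the point found
      in it below \<open>- real n\<close>.\<close>
    obtain x y where "x < (- real n - L) + L" "\<bar>G x\<bar> < inverse (real (Suc n))" "real n < y" "\<bar>G y\<bar> < inverse (real (Suc n))"
      using L(2)[of "- real n - L"] L(2)[of "real n"] by blast
    then show ?thesis by auto
  qed
  then obtain X Y where XY: "\<And>n. X n < - real n" "\<And>n. real n < Y n"
    "\<And>n. \<bar>G (X n)\<bar> < inverse (real (Suc n))" "\<And>n. \<bar>G (Y n)\<bar> < inverse (real (Suc n))"
    by metis
  have "(\<lambda>n. \<integral>x. indicator {X n..Y n} x *\<^sub>R g x \<partial>lebesgue) \<longlonglongrightarrow> (\<integral>x. g x \<partial>lebesgue)"
  proof (rule integral_dominated_convergence)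
    show "integrable lebesgue (\<lambda>x. \<bar>g x\<bar>)" using g by simp
    show "AE x in lebesgue. (\<lambda>n. indicator {X n..Y n} x *\<^sub>R g x) \<longlonglongrightarrow> g x"
    proof (intro AE_I2)
      fix x
      obtain N :: nat where N: "\<bar>x\<bar> < real N" using reals_Archimedean2 by blast
      have "\<forall>\<^sub>F n in sequentially. indicator {X n..Y n} x *\<^sub>R g x = g x"
        using eventually_ge_at_top[of N]
      proof eventually_elim
        case (elim n)
        then have "x \<in> {X n..Y n}" using N XY(1,2)[of n] by auto
        then show ?case by simp
      qed
      then show "(\<lambda>n. indicator {X n..Y n} x *\<^sub>R g x) \<longlonglongrightarrow> g x"
        by (rule tendsto_eventually)
    qed
    show "(\<lambda>x. indicator {X n..Y n} x *\<^sub>R g x) \<in> borel_measurable lebesgue" for n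
      by (rule borel_measurable_integrable, rule integrable_mult_indicator[OF _ g]) simp
  qed (use g in \<open>auto split: split_indicator\<close>)
  moreover have "(\<integral>x. indicator {X n..Y n} x *\<^sub>R g x \<partial>lebesgue) = G (Y n) - G (X n)" for n
    using primitive_increment_eq_lebesgue[OF Gg, of "X n" "Y n"] XY(1,2)[of n] by simp
  ultimately have lim: "(\<lambda>n. G (Y n) - G (X n)) \<longlonglongrightarrow> (\<integral>x. g x \<partial>lebesgue)" by simp
  have "(\<lambda>n. G (Y n)) \<longlonglongrightarrow> 0" "(\<lambda>n. G (X n)) \<longlonglongrightarrow> 0"
    using XY(3,4) by (auto intro!: Lim_null_comparison[OF _ LIMSEQ_inverse_real_of_nat] always_eventually less_imp_le)
  from tendsto_diff[OF this] show ?thesis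
    using LIMSEQ_unique[OF lim] by simp
qed

text \<open>Integrating factor on \<open>[x, y]\<close>; the value at \<open>y\<close> disappears
  because \<open>y\<close> can be taken to the right of \<open>x\<close> at a point where
  \<open>F\<close> is arbitrarily small.\<close>

lemma gronwall_from_infinity:
  fixes F f r s :: "real \<Rightarrow> real"
  assumes F: "primitive F f" "\<And>x. 0 \<le> F x" "integrable lebesgue F"
    and r: "integrable lebesgue r" "\<And>x. 0 \<le> r x" and s: "integrable lebesgue s" "\<And>x. 0 \<le> s x"
    and ae: "AE x in lebesgue. - f x \<le> r x * F x + s x"
  shows "F x \<le> exp (\<integral>x. r x \<partial>lebesgue) * (\<integral>x. s x \<partial>lebesgue)"
proof -
  \<comment> \<open>Altering the derivative on a null set makes the differential inequality hold
    everywhere.\<close>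
  define f' where "f' x = max (f x) (- (r x * F x + s x))" for x
  have F': "primitive F f'"
    by (rule primitive_cong_AE[OF F(1)]) (use ae in eventually_elim, auto simp: f'_def)
  obtain R where R: "primitive R r"
    using primitive_exists integrable_lebesgue_locally_integrable[OF r(1)]
    unfolding locally_integrable_def by blast
  obtain S where S: "primitive S s"
    using primitive_exists integrable_lebesgue_locally_integrable[OF s(1)]
    unfolding locally_integrable_def by blast
  have G: "primitive (\<lambda>x. - (F x * exp (R x))) (\<lambda>x. - (f' x * exp (R x) + F x * (exp (R x) * r x)))"
    by (intro primitive_minus primitive_mult F' primitive_exp R)
  have R_mono: "R a \<le> R b" if "a \<le> b" for a b
    using primitive_mono[OF primitive_const[of 0] R that] r(2) by simp
  let ?A = "\<integral>x. r x \<partial>lebesgue" and ?B = "\<integral>x. s x \<partial>lebesgue"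
  have B: "0 \<le> ?B" using s(2) by (rule Bochner_Integration.integral_nonneg)
  have main: "F x \<le> exp ?A * (F y + ?B)" if "x \<le> y" for y
  proof -
    have "- (F y * exp (R y)) - - (F x * exp (R x)) \<le> exp (R y) * S y - exp (R y) * S x"
    proof (rule primitive_mono[OF G primitive_cmult[OF S] that])
      fix t assume t: "x \<le> t" "t \<le> y"
      have "- f' t \<le> r t * F t + s t" by (simp add: f'_def)
      then have "exp (R t) * (- f' t) \<le> exp (R t) * (r t * F t + s t)"
        by (intro mult_left_mono) auto
      \<comment> \<open>The integrating factor is frozen at its largest value; after division by
        \<open>exp (R x)\<close> this costs no more than the exponential of the total integral of
        \<open>r\<close>.\<close>
      moreover have "exp (R t) * s t \<le> exp (R y) * s t"
        using R_mono[OF t(2)] s(2) by (intro mult_right_mono) auto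
      ultimately show "- (f' t * exp (R t) + F t * (exp (R t) * r t)) \<le> exp (R y) * s t"
        by (simp add: algebra_simps)
    qed
    then have "F x * exp (R x) \<le> exp (R y) * F y + exp (R y) * (S y - S x)"
      by (simp add: algebra_simps)
    also have "\<dots> \<le> exp (R y) * F y + exp (R y) * ?B"
      using primitive_increment_le_total[OF S s(1) s(2), of y x] by simp
    finally have "F x \<le> exp (- R x) * (exp (R y) * (F y + ?B))"
      by (simp add: exp_minus field_simps)
    also have "\<dots> = exp (R y - R x) * (F y + ?B)"
      by (simp add: exp_diff exp_minus field_simps)
    also have "\<dots> \<le> exp ?A * (F y + ?B)"
      using primitive_increment_le_total[OF R r(1) r(2), of y x] F(2)[of y] B
      by (intro mult_right_mono) auto
    finally show ?thesis .
  qed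
  show ?thesis
  proof (rule field_le_epsilon)
    fix e :: real assume "e > 0"
    then have "e / exp ?A > 0" by simp
    from integrable_small_somewhere[OF F(3) this] obtain y where y: "x < y" "\<bar>F y\<bar> < e / exp ?A"
      by metis
    have "F x \<le> exp ?A * (F y + ?B)" using main y(1) by simp
    also have "\<dots> \<le> exp ?A * (e / exp ?A + ?B)" using y(2) by (intro mult_left_mono) auto
    also have "\<dots> = exp ?A * ?B + e" by (simp add: distrib_left)
    finally show "F x \<le> exp ?A * ?B + e" .
  qed
qed

subsection \<open>Initial value problems of Caratheodory type\<close>

text \<open>The exponential is integrated explicitly on each half line; the gain
  \<open>1 / \<mu>\<close> is what makes Picard iteration contract.\<close>

lemma primitive_growth:
  fixes Y y :: "real \<Rightarrow> 'a::euclidean_space" and G g :: "real \<Rightarrow> real"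
  assumes Y: "primitive Y y" and G: "primitive G g" and "\<mu> > 0"
    and le: "\<And>t. norm (y t) \<le> \<alpha> * exp (\<mu> * \<bar>t\<bar>) + g t"
  shows "norm (Y x - Y 0) \<le> \<alpha> / \<mu> * (exp (\<mu> * \<bar>x\<bar>) - 1) + \<bar>G x - G 0\<bar>"
proof (cases "0 \<le> x")
  case True
  have "primitive (\<lambda>t. \<alpha> / \<mu> * exp (\<mu> * t)) (\<lambda>t. \<alpha> * exp (\<mu> * t))"
    by (rule primitive_of_derivative)
       (use \<open>\<mu> > 0\<close> in \<open>auto intro!: derivative_eq_intros continuous_intros\<close>)
  from Y primitive_add[OF this G] True
  have "norm (Y x - Y 0) \<le> \<alpha> / \<mu> * exp (\<mu> * x) + G x - (\<alpha> / \<mu> * exp (\<mu> * 0) + G 0)"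
  proof (rule primitive_increment_norm_le)
    show "norm (y t) \<le> \<alpha> * exp (\<mu> * t) + g t" if "0 \<le> t" for t
      using le[of t] that by simp
  qed
  also have "\<dots> \<le> \<alpha> / \<mu> * (exp (\<mu> * \<bar>x\<bar>) - 1) + \<bar>G x - G 0\<bar>"
    using True by (simp add: right_diff_distrib)
  finally show ?thesis .
next
  case False
  have "primitive (\<lambda>t. - (\<alpha> / \<mu>) * exp (- \<mu> * t)) (\<lambda>t. \<alpha> * exp (- \<mu> * t))"
    by (rule primitive_of_derivative)
       (use \<open>\<mu> > 0\<close> in \<open>auto intro!: derivative_eq_intros continuous_intros\<close>)
  from Y primitive_add[OF this G]
  have "norm (Y 0 - Y x) \<le> - (\<alpha> / \<mu>) * exp (- \<mu> * 0) + G 0 - (- (\<alpha> / \<mu>) * exp (- \<mu> * x) + G x)"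
  proof (rule primitive_increment_norm_le)
    show "x \<le> 0" using False by simp
    show "norm (y t) \<le> \<alpha> * exp (- \<mu> * t) + g t" if "t \<le> 0" for t
      using le[of t] that by simp
  qed
  also have "\<dots> \<le> \<alpha> / \<mu> * (exp (\<mu> * \<bar>x\<bar>) - 1) + \<bar>G x - G 0\<bar>"
    using False by (simp add: right_diff_distrib)
  finally show ?thesis by (simp add: norm_minus_commute)
qed

text \<open>Picard iteration is a contraction for the norm weighted with \<open>exp (- 2 K \<bar>t\<bar>)\<close>, so that the
  solution is obtained on the whole line at once.\<close>

lemma caratheodory_ivp:
  fixes \<Phi> :: "real \<Rightarrow> 'a::euclidean_space \<Rightarrow> 'a"
  assumes int: "\<And>w. continuous_on UNIV w \<Longrightarrow> locally_integrable (\<lambda>t. \<Phi> t (w t))"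
    and lip: "\<And>t v w. norm (\<Phi> t v - \<Phi> t w) \<le> K * norm (v - w)" and "K > 0"
    and bnd: "\<And>t. norm (\<Phi> t 0) \<le> 1 + k t" and k: "integrable lebesgue k" "\<And>t. 0 \<le> k t"
  obtains y where "primitive y (\<lambda>t. \<Phi> t (y t))" "y 0 = c"
proof -
  \<comment> \<open>The contraction factor is \<open>K / \<mu>\<close>, hence 1/2.\<close>
  define \<mu> where "\<mu> = 2 * K"
  have l: "\<mu> > 0" using \<open>K > 0\<close> by (simp add: \<mu>_def)
  define E where "E t = exp (\<mu> * \<bar>t\<bar>)" for t :: real
  have E: "E t > 0" for t by (simp add: E_def)
  have contE: "continuous_on S E" "continuous_on S (\<lambda>t. inverse (E t))" for S
    unfolding E_def by (auto intro!: continuous_intros)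
  \<comment> \<open>The unknown is stored divided by \<open>E\<close>, which keeps it a bounded
    continuous function.\<close>
  let ?\<Phi> = "\<lambda>w t. \<Phi> t (E t *\<^sub>R apply_bcontfun w t)"
  have li: "locally_integrable (?\<Phi> w)" for w
    by (intro int continuous_on_scaleR contE continuous_on_apply_bcontfun)
  have "\<exists>J. J 0 = c \<and> primitive J (?\<Phi> w)" for w
    using li[of w] primitive_exists[of "?\<Phi> w" c] unfolding locally_integrable_def by blast
  then obtain J where J: "\<And>w. J w 0 = c" "\<And>w. primitive (J w) (?\<Phi> w)"
    by metis
  obtain M where M: "primitive M k"
    using primitive_exists integrable_lebesgue_locally_integrable[OF k(1)]
    unfolding locally_integrable_def by blast
  have one: "primitive (\<lambda>t::real. t) (\<lambda>t. 1)"
    by (rule primitive_of_derivative) auto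
  have bc: "(\<lambda>x. inverse (E x) *\<^sub>R J w x) \<in> bcontfun" for w
  proof (rule bcontfun_normI)
    show "continuous_on UNIV (\<lambda>x. inverse (E x) *\<^sub>R J w x)"
      by (intro continuous_intros contE primitive_continuous[OF J(2)])
    fix x
    have "norm (?\<Phi> w t) \<le> (K * norm w) * exp (\<mu> * \<bar>t\<bar>) + (1 + k t)" for t
    proof -
      have "norm (?\<Phi> w t) \<le> norm (?\<Phi> w t - \<Phi> t 0) + norm (\<Phi> t 0)"
        by (metis norm_triangle_sub add.commute)
      also have "norm (?\<Phi> w t - \<Phi> t 0) \<le> K * norm (E t *\<^sub>R apply_bcontfun w t - 0)" by (rule lip)
      also have "\<dots> \<le> K * (E t * norm w)"
        using \<open>K > 0\<close> E[of t] norm_bounded[of w t] by (intro mult_left_mono) (auto intro!: mult_left_mono)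
      also have "\<dots> = (K * norm w) * exp (\<mu> * \<bar>t\<bar>)" by (simp add: E_def)
      finally show ?thesis using bnd[of t] by simp
    qed
    from primitive_growth[OF J(2) primitive_add[OF one M] l this, of x]
    have "norm (J w x - c) \<le> (K * norm w) / \<mu> * (E x - 1) + \<bar>x + (M x - M 0)\<bar>"
      by (simp add: J(1) E_def algebra_simps)
    also have "\<dots> \<le> (K * norm w) / \<mu> * E x + \<bar>x\<bar> + (\<integral>x. k x \<partial>lebesgue)"
    proof -
      have "\<bar>M x - M 0\<bar> \<le> (\<integral>x. k x \<partial>lebesgue)"
        using primitive_increment_le_total[OF M k, of x 0] primitive_increment_le_total[OF M k, of 0 x] by linarith
      moreover have "(K * norm w) / \<mu> * (E x - 1) \<le> (K * norm w) / \<mu> * E x"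
        using \<open>K > 0\<close> l by (intro mult_left_mono) auto
      ultimately show ?thesis by linarith
    qed
    finally have *: "norm (J w x) \<le> norm c + (K * norm w) / \<mu> * E x + \<bar>x\<bar> + (\<integral>x. k x \<partial>lebesgue)"
      using norm_triangle_sub[of "J w x" c] by linarith
    \<comment> \<open>The constant 1 in the bound on \<open>\<Phi> t 0\<close> produces linear
      growth, which the weight dominates.\<close>
    have "\<mu> * \<bar>x\<bar> \<le> E x" unfolding E_def using exp_ge_add_one_self[of "\<mu> * \<bar>x\<bar>"] by linarith
    then have x: "\<bar>x\<bar> \<le> 1 / \<mu> * E x" using l by (simp add: field_simps)
    have "1 \<le> E x" using l by (simp add: E_def)
    moreover have "0 \<le> norm c + (\<integral>x. k x \<partial>lebesgue)"
      using k(2) by (intro add_nonneg_nonneg Bochner_Integration.integral_nonneg) auto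
    ultimately have "norm c + (\<integral>x. k x \<partial>lebesgue) \<le> (norm c + (\<integral>x. k x \<partial>lebesgue)) * E x"
      using mult_left_mono[of 1 "E x" "norm c + (\<integral>x. k x \<partial>lebesgue)"] by simp
    then have "norm (J w x) \<le> (norm c + (\<integral>x. k x \<partial>lebesgue) + (K * norm w) / \<mu> + 1 / \<mu>) * E x"
      using * x by (simp add: algebra_simps)
    then show "norm (inverse (E x) *\<^sub>R J w x) \<le> norm c + (\<integral>x. k x \<partial>lebesgue) + (K * norm w) / \<mu> + 1 / \<mu>"
      using E[of x] by (simp add: field_simps)
  qed
  define T where "T w = Bcontfun (\<lambda>x. inverse (E x) *\<^sub>R J w x)" for w
  have T: "apply_bcontfun (T w) x = inverse (E x) *\<^sub>R J w x" for w x
    unfolding T_def using Bcontfun_inverse[OF bc] by simp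
  have "\<exists>!w. T w = w"
  proof (rule banach_fix_type[of "1/2"])
    show "\<forall>v w. dist (T v) (T w) \<le> 1/2 * dist v w"
    proof (intro allI)
      fix v w :: "real \<Rightarrow>\<^sub>C 'a"
      show "dist (T v) (T w) \<le> 1/2 * dist v w"
      proof (rule dist_bound)
        fix x
        have D: "primitive (\<lambda>x. J v x - J w x) (\<lambda>t. ?\<Phi> v t - ?\<Phi> w t)"
          by (intro primitive_diff J)
        have "norm (?\<Phi> v t - ?\<Phi> w t) \<le> (K * dist v w) * exp (\<mu> * \<bar>t\<bar>) + 0" for t
        proof -
          have "norm (?\<Phi> v t - ?\<Phi> w t) \<le> K * norm (E t *\<^sub>R apply_bcontfun v t - E t *\<^sub>R apply_bcontfun w t)"
            by (rule lip)
          also have "norm (E t *\<^sub>R apply_bcontfun v t - E t *\<^sub>R apply_bcontfun w t) = E t * dist (apply_bcontfun v t) (apply_bcontfun w t)"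
            using E[of t] by (simp add: dist_norm flip: scaleR_diff_right)
          also have "K * (E t * dist (apply_bcontfun v t) (apply_bcontfun w t)) \<le> K * (E t * dist v w)"
            using \<open>K > 0\<close> E[of t] dist_bounded[of v t w] by (intro mult_left_mono) auto
          finally show ?thesis by (simp add: E_def mult_ac)
        qed
        from primitive_growth[OF D primitive_const[of "0::real"] l this, of x]
        have "norm (J v x - J w x) \<le> K * dist v w / \<mu> * (E x - 1)"
          by (simp add: J(1) E_def)
        also have "\<dots> \<le> K * dist v w / \<mu> * E x"
          using \<open>K > 0\<close> l by (intro mult_left_mono) auto
        also have "\<dots> = 1/2 * dist v w * E x"
          using \<open>K > 0\<close> by (simp add: \<mu>_def)
        finally have "norm (J v x - J w x) / E x \<le> 1/2 * dist v w"
          using E[of x] by (simp add: pos_divide_le_eq)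
        moreover have "dist (apply_bcontfun (T v) x) (apply_bcontfun (T w) x) = norm (inverse (E x) *\<^sub>R (J v x - J w x))"
          by (simp add: T dist_norm scaleR_diff_right)
        moreover have "\<dots> = norm (J v x - J w x) / E x"
          unfolding norm_scaleR using E[of x] by (simp add: divide_inverse_commute)
        ultimately show "dist (apply_bcontfun (T v) x) (apply_bcontfun (T w) x) \<le> 1/2 * dist v w"
          by linarith
      qed
    qed
  qed auto
  then obtain w where w: "T w = w" by blast
  have "E x *\<^sub>R apply_bcontfun w x = J w x" for x
    using T[of w x] E[of x] by (simp add: w)
  then have "primitive (J w) (\<lambda>t. \<Phi> t (J w t))"
    using J(2)[of w] by simp
  then show ?thesis using that J(1) by blast
qed

subsection \<open>The Schroedinger equation as a first order system\<close>

text \<open>\<open>p\<close> stands for \<open>h u'\<close>.\<close>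

definition ode :: "(real \<Rightarrow> real) \<Rightarrow> real \<Rightarrow> complex \<Rightarrow> (real \<Rightarrow> complex) \<Rightarrow>
    (real \<Rightarrow> complex) \<Rightarrow> (real \<Rightarrow> complex) \<Rightarrow> bool" where
  "ode V h z f u p \<longleftrightarrow> primitive u (\<lambda>x. p x / of_real h) \<and>
     primitive p (\<lambda>x. ((of_real (V x) - z) * u x - f x) / of_real h)"

lemma locally_integrable_bounded_mult:
  fixes q w :: "real \<Rightarrow> complex"
  assumes q: "q \<in> borel_measurable lebesgue" "\<And>x. cmod (q x) \<le> B" and w: "locally_integrable w"
  shows "locally_integrable (\<lambda>x. q x * w x)"
  unfolding locally_integrable_def
proof (intro allI)
  fix a b :: real
  show "(\<lambda>x. q x * w x) absolutely_integrable_on {a..b}"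
  proof (rule absolutely_integrable_bounded_measurable_product[where h = "(*)"])
    show "q \<in> borel_measurable (lebesgue_on {a..b})"
      using q(1) by (rule measurable_restrict_space1)
    show "bounded (q ` {a..b})" using q(2) by (auto simp: bounded_iff)
    show "bilinear ((*) :: complex \<Rightarrow> complex \<Rightarrow> complex)"
      by (simp add: bilinear_conv_bounded_bilinear bounded_bilinear_mult)
  qed (use w in \<open>auto simp: locally_integrable_def\<close>)
qed

lemma locally_integrable_linear:
  assumes "locally_integrable w" "bounded_linear h"
  shows "locally_integrable (\<lambda>x. h (w x))"
  using absolutely_integrable_linear[OF _ assms(2), where f = w] assms(1)
  by (simp add: locally_integrable_def o_def)

lemma locally_integrable_add:
  "locally_integrable f \<Longrightarrow> locally_integrable g \<Longrightarrow> locally_integrable (\<lambda>x. f x + g x)"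
  by (simp add: locally_integrable_def)

text \<open>As a system for the pair of \<open>u\<close> and \<open>p\<close>, the right side is
  only measurable in \<open>t\<close>, but Lipschitz in the unknown uniformly in \<open>t\<close>,
  since \<open>V\<close> is bounded.\<close>

lemma ode_exists:
  assumes V: "V \<in> borel_measurable lebesgue" "\<And>x. \<bar>V x\<bar> \<le> B" and "h > 0" and f: "f \<in> L2"
  obtains u p where "ode V h z f u p" "u 0 = a" "p 0 = b"
proof -
  have "B \<ge> 0" using V(2)[of 0] by linarith
  let ?q = "\<lambda>x. of_real (V x) - z"
  have q: "?q \<in> borel_measurable lebesgue" "\<And>x. cmod (?q x) \<le> B + cmod z"
    using V by (auto intro!: norm_triangle_le_diff add_right_mono)
  define \<Phi> :: "real \<Rightarrow> complex \<times> complex \<Rightarrow> complex \<times> complex" where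
    "\<Phi> t w = (snd w / of_real h, (?q t * fst w - f t) / of_real h)" for t w
  define K where "K = (1 + B + cmod z) / h"
  have K: "K > 0" using \<open>B \<ge> 0\<close> \<open>h > 0\<close> by (simp add: K_def add_pos_nonneg)
  have lip: "norm (\<Phi> t v - \<Phi> t w) \<le> K * norm (v - w)" for t v w
  proof -
    have "\<Phi> t v - \<Phi> t w = (snd (v - w) / of_real h, ?q t * fst (v - w) / of_real h)"
      using \<open>h > 0\<close> by (simp add: \<Phi>_def field_simps)
    then have "norm (\<Phi> t v - \<Phi> t w) \<le> cmod (snd (v - w)) / h + cmod (?q t) * cmod (fst (v - w)) / h"
      using norm_Pair_le[of "snd (v - w) / of_real h" "?q t * fst (v - w) / of_real h"] \<open>h > 0\<close>
      by (simp add: norm_mult norm_divide)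
    also have "\<dots> \<le> norm (v - w) / h + (B + cmod z) * norm (v - w) / h"
    proof -
      have "cmod (snd (v - w)) \<le> norm (v - w)" "cmod (fst (v - w)) \<le> norm (v - w)"
        by (metis prod.collapse norm_snd_le norm_fst_le)+
      then show ?thesis
        using \<open>h > 0\<close> q(2)[of t] \<open>B \<ge> 0\<close> by (intro add_mono divide_right_mono mult_mono) auto
    qed
    also have "\<dots> = K * norm (v - w)" by (simp add: K_def field_simps add_divide_distrib)
    finally show ?thesis .
  qed
  \<comment> \<open>Turns square integrability of \<open>f\<close> into a forcing bound of the form
    \<open>1 + k\<close> with \<open>k\<close> integrable.\<close>
  have sq: "t \<le> 1 + t\<^sup>2" for t :: real
    using zero_le_power2[of "t - 1/2"] unfolding power2_eq_square by (simp add: algebra_simps)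
  obtain y where y: "primitive y (\<lambda>t. \<Phi> t (y t))" "y 0 = (a, b)"
  proof (rule caratheodory_ivp[where c = "(a, b)", OF _ lip K])
    show "norm (\<Phi> t 0) \<le> 1 + (cmod (f t))\<^sup>2 / h\<^sup>2" for t
    proof -
      have "norm (\<Phi> t 0) \<le> cmod (f t) / h"
        using norm_Pair_le[of 0 "- f t / of_real h"] \<open>h > 0\<close> by (simp add: \<Phi>_def norm_divide)
      then show ?thesis using sq[of "cmod (f t) / h"] by (simp add: power_divide)
    qed
    show "integrable lebesgue (\<lambda>t. (cmod (f t))\<^sup>2 / h\<^sup>2)" using f by (auto simp: L2_def)
    fix w :: "real \<Rightarrow> complex \<times> complex" assume w: "continuous_on UNIV w"
    have c: "locally_integrable (\<lambda>t. fst (w t))" "locally_integrable (\<lambda>t. snd (w t))"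
      by (intro continuous_locally_integrable continuous_intros w)+
    have A: "locally_integrable (\<lambda>t. (snd (w t) / of_real h, 0 :: complex))"
      by (rule locally_integrable_linear[OF c(2)])
         (auto intro!: bounded_linear_Pair bounded_linear_divide bounded_linear_zero)
    have "bounded_linear (\<lambda>y. (0 :: complex, y / complex_of_real h))"
      by (auto intro!: bounded_linear_Pair bounded_linear_divide bounded_linear_zero)
    from locally_integrable_linear[OF locally_integrable_diff[OF
          locally_integrable_bounded_mult[OF q c(1)] L2_locally_integrable[OF f]] this]
    have "locally_integrable (\<lambda>t. (0 :: complex, (?q t * fst (w t) - f t) / of_real h))" .
    from locally_integrable_add[OF A this] show "locally_integrable (\<lambda>t. \<Phi> t (w t))"
      by (simp add: \<Phi>_def)
  qed auto
  have "ode V h z f (\<lambda>x. fst (y x)) (\<lambda>x. snd (y x))"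
    unfolding ode_def
    using primitive_linear[OF y(1) bounded_linear_fst] primitive_linear[OF y(1) bounded_linear_snd]
    by (simp add: \<Phi>_def)
  then show ?thesis using that y(2) by force
qed

lemma ode_lincomb:
  assumes "ode V h z f u p" "ode V h z g v q"
  shows "ode V h z (\<lambda>x. c * f x + d * g x) (\<lambda>x. c * u x + d * v x) (\<lambda>x. c * p x + d * q x)"
  unfolding ode_def
proof
  note lin = primitive_add[OF primitive_linear[OF _ bounded_linear_mult_right[of c]]
      primitive_linear[OF _ bounded_linear_mult_right[of d]]]
  show "primitive (\<lambda>x. c * u x + d * v x) (\<lambda>x. (c * p x + d * q x) / of_real h)"
    using lin[of u _ v, OF assms[unfolded ode_def, THEN conjunct1]] by (simp add: add_divide_distrib)
  have "c * (((V x - z) * u x - f x) / h) + d * (((V x - z) * v x - g x) / h) =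
      ((V x - z) * (c * u x + d * v x) - (c * f x + d * g x)) / complex_of_real h" for x
    by (simp add: add_divide_distrib[symmetric] diff_divide_distrib[symmetric] algebra_simps)
  with lin[of p _ q, OF assms[unfolded ode_def, THEN conjunct2]]
  show "primitive (\<lambda>x. c * p x + d * q x)
      (\<lambda>x. ((V x - z) * (c * u x + d * v x) - (c * f x + d * g x)) / complex_of_real h)"
    by simp
qed

text \<open>Real part of the product rule for \<open>p * cnj u\<close>; integrated, it expresses the
  mass of \<open>p\<close> through that of \<open>u\<close>.\<close>

lemma ode_primitive_Re:
  assumes ode: "ode V h z f u p" and "h > 0"
  shows "primitive (\<lambda>x. h * Re (p x * cnj (u x)))
    (\<lambda>x. (V x - Re z) * (cmod (u x))\<^sup>2 - Re (f x * cnj (u x)) + (cmod (p x))\<^sup>2)"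
proof -
  note u = ode[unfolded ode_def, THEN conjunct1] and p = ode[unfolded ode_def, THEN conjunct2]
  have "primitive (\<lambda>x. h * (Re (p x) * Re (u x) + Im (p x) * Im (u x)))
    (\<lambda>x. h * ((Re (((V x - z) * u x - f x) / h) * Re (u x) + Re (p x) * Re (p x / h)) +
              (Im (((V x - z) * u x - f x) / h) * Im (u x) + Im (p x) * Im (p x / h))))"
    by (intro primitive_cmult primitive_add primitive_mult primitive_Re[OF u] primitive_Re[OF p]
        primitive_Im[OF u] primitive_Im[OF p])
  then show ?thesis
    unfolding cmod_power2 using \<open>h > 0\<close> by (simp add: power2_eq_square algebra_simps add_divide_distrib diff_divide_distrib)
qed

text \<open>\<open>V\<close> and the square of \<open>cmod (p x)\<close> are real and drop out of
  the imaginary part, leaving only \<open>Im z\<close> and the forcing.\<close>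

lemma ode_primitive_Im:
  assumes ode: "ode V h z f u p" and "h > 0"
  shows "primitive (\<lambda>x. h * Im (p x * cnj (u x)))
    (\<lambda>x. - Im z * (cmod (u x))\<^sup>2 - Im (f x * cnj (u x)))"
proof -
  note u = ode[unfolded ode_def, THEN conjunct1] and p = ode[unfolded ode_def, THEN conjunct2]
  have "primitive (\<lambda>x. h * (Im (p x) * Re (u x) - Re (p x) * Im (u x)))
    (\<lambda>x. h * ((Im (((V x - z) * u x - f x) / h) * Re (u x) + Im (p x) * Re (p x / h)) -
              (Re (((V x - z) * u x - f x) / h) * Im (u x) + Re (p x) * Im (p x / h))))"
    by (intro primitive_cmult primitive_diff primitive_mult primitive_Re[OF u] primitive_Re[OF p]
        primitive_Im[OF u] primitive_Im[OF p])
  then show ?thesis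
    unfolding cmod_power2 using \<open>h > 0\<close> by (simp add: power2_eq_square algebra_simps add_divide_distrib diff_divide_distrib)
qed

lemma ode_continuous:
  assumes "ode V h z f u p"
  shows "continuous_on S u" "continuous_on S p"
  using assms primitive_continuous unfolding ode_def by blast+

subsection \<open>Square integrable solutions\<close>

lemma ode_square_primitives:
  assumes ode: "ode V h z f u p"
  obtains M N where "primitive M (\<lambda>x. (cmod (u x))\<^sup>2)" "primitive N (\<lambda>x. (cmod (p x))\<^sup>2)"
proof -
  have c: "continuous_on UNIV (\<lambda>x. (cmod (u x))\<^sup>2)" "continuous_on UNIV (\<lambda>x. (cmod (p x))\<^sup>2)"
    by (intro continuous_intros ode_continuous[OF ode])+
  show ?thesis
    using primitive_exists[of "\<lambda>x. (cmod (u x))\<^sup>2"] primitive_exists[of "\<lambda>x. (cmod (p x))\<^sup>2"]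
      continuous_locally_integrable[OF c(1)] continuous_locally_integrable[OF c(2)] that
    unfolding locally_integrable_def by metis
qed

lemma continuous_eq_0_if_primitive_eq:
  fixes f :: "real \<Rightarrow> real"
  assumes "primitive F f" "continuous_on {a..b} f" "\<And>x. 0 \<le> f x" "a < b" "F b \<le> F a" "x \<in> {a..b}"
  shows "f x = 0"
proof -
  have "F a \<le> F b"
    using primitive_mono[OF primitive_const[of 0] assms(1), of a b] assms(3,4) by simp
  then have "integral {a..b} f = 0"
    using primitiveD(4)[OF assms(1), of a b] assms(4,5) by simp
  then show ?thesis
    using integral_eq_0_iff[OF assms(2,4)] assms(3,6) by blast
qed

lemma primitive_cmod_power2:
  assumes "primitive w w'"
  shows "primitive (\<lambda>x. (cmod (w x))\<^sup>2) (\<lambda>x. 2 * Re (w' x * cnj (w x)))"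
proof -
  have "primitive (\<lambda>x. (Re (w x) * Re (w x) + Im (w x) * Im (w x)))
     (\<lambda>x. (Re (w' x) * Re (w x) + Re (w x) * Re (w' x)) + (Im (w' x) * Im (w x) + Im (w x) * Im (w' x)))"
    by (intro primitive_add primitive_mult primitive_Re primitive_Im assms)
  then show ?thesis
    unfolding cmod_power2 by (simp add: power2_eq_square algebra_simps)
qed

lemma two_mult_le_squares:
  fixes a b e :: real
  assumes "e > 0"
  shows "a * b \<le> a\<^sup>2 / (2 * e) + e / 2 * b\<^sup>2"
proof -
  have "0 \<le> (a - e * b)\<^sup>2 / (2 * e)" using assms by simp
  also have "\<dots> = a\<^sup>2 / (2 * e) + e / 2 * b\<^sup>2 - a * b"
    using assms by (simp add: power2_eq_square field_simps)
  finally show ?thesis by simp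
qed

text \<open>Integrating the two identities for \<open>p * cnj u\<close> over an interval on whose boundary \<open>u\<close> vanishes.\<close>

lemma dirichlet_bounds:
  assumes ode: "ode V h z f u p" and "h > 0" and V: "\<And>x. \<bar>V x\<bar> \<le> B" and z: "Im z \<noteq> 0"
    and f: "f \<in> L2" and "a \<le> b" and bd: "u a = 0" "u b = 0"
    and M: "primitive M (\<lambda>x. (cmod (u x))\<^sup>2)" and N: "primitive N (\<lambda>x. (cmod (p x))\<^sup>2)"
  shows "M b - M a \<le> (L2_norm f)\<^sup>2 / (Im z)\<^sup>2"
    and "N b - N a \<le> (B + cmod z + 1) * ((L2_norm f)\<^sup>2 / (Im z)\<^sup>2) + (L2_norm f)\<^sup>2"
proof -
  have fi: "integrable lebesgue (\<lambda>x. (cmod (f x))\<^sup>2)" using f by (simp add: L2_def)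
  have f2: "(L2_norm f)\<^sup>2 = (\<integral>x. (cmod (f x))\<^sup>2 \<partial>lebesgue)"
    by (simp add: L2_norm_def)
  obtain Q where Q: "primitive Q (\<lambda>x. (cmod (f x))\<^sup>2)"
    using primitive_exists integrable_lebesgue_locally_integrable[OF fi]
    unfolding locally_integrable_def by blast
  have Qle: "Q b - Q a \<le> (L2_norm f)\<^sup>2"
    unfolding f2 by (rule primitive_increment_le_total[OF Q fi]) simp
  have fu: "\<bar>Im (f x * cnj (u x))\<bar> \<le> cmod (f x) * cmod (u x)" "\<bar>Re (f x * cnj (u x))\<bar> \<le> cmod (f x) * cmod (u x)" for x
    using abs_Im_le_cmod[of "f x * cnj (u x)"] abs_Re_le_cmod[of "f x * cnj (u x)"] by (simp_all add: norm_mult)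
  define e where "e = \<bar>Im z\<bar>"
  have e: "e > 0" using z by (simp add: e_def)
  \<comment> \<open>The sign that turns \<open>- Im z\<close> into its absolute value.\<close>
  define \<sigma> where "\<sigma> = (if Im z > 0 then -1 else 1 :: real)"
  have \<sigma>: "\<sigma> * - Im z = e" "\<bar>\<sigma>\<bar> = 1" by (auto simp: \<sigma>_def e_def)
  have "primitive (\<lambda>x. \<sigma> * (h * Im (p x * cnj (u x)))) (\<lambda>x. \<sigma> * (- Im z * (cmod (u x))\<^sup>2 - Im (f x * cnj (u x))))"
    by (intro primitive_cmult ode_primitive_Im[OF ode \<open>h > 0\<close>])
  then have "e / 2 * M b - e / 2 * M a - 1 / (2 * e) * (Q b - Q a) \<le> \<sigma> * (h * Im (p b * cnj (u b))) - \<sigma> * (h * Im (p a * cnj (u a)))"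
  proof -
    assume G: "primitive (\<lambda>x. \<sigma> * (h * Im (p x * cnj (u x)))) (\<lambda>x. \<sigma> * (- Im z * (cmod (u x))\<^sup>2 - Im (f x * cnj (u x))))"
    have "(e / 2 * M b - 1 / (2 * e) * Q b) - (e / 2 * M a - 1 / (2 * e) * Q a) \<le>
        \<sigma> * (h * Im (p b * cnj (u b))) - \<sigma> * (h * Im (p a * cnj (u a)))"
    proof (rule primitive_mono[OF primitive_diff[OF primitive_cmult[OF M] primitive_cmult[OF Q]] G \<open>a \<le> b\<close>])
      fix x
      have "\<sigma> * Im (f x * cnj (u x)) \<le> \<bar>\<sigma> * Im (f x * cnj (u x))\<bar>" by simp
      also have "\<dots> \<le> cmod (f x) * cmod (u x)"
        using fu(1)[of x] \<sigma>(2) by (simp add: abs_mult)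
      \<comment> \<open>With the weight \<open>e\<close>, only half of the term to be estimated is
        used up.\<close>
      also have "\<dots> \<le> (cmod (f x))\<^sup>2 / (2 * e) + e / 2 * (cmod (u x))\<^sup>2"
        by (rule two_mult_le_squares[OF e])
      finally have "\<sigma> * Im (f x * cnj (u x)) \<le> (cmod (f x))\<^sup>2 / (2 * e) + e / 2 * (cmod (u x))\<^sup>2" .
      moreover have "\<sigma> * (- Im z * (cmod (u x))\<^sup>2 - Im (f x * cnj (u x))) =
          e * (cmod (u x))\<^sup>2 - \<sigma> * Im (f x * cnj (u x))"
        unfolding \<sigma>(1)[symmetric] by (simp add: algebra_simps)
      ultimately show "e / 2 * (cmod (u x))\<^sup>2 - 1 / (2 * e) * (cmod (f x))\<^sup>2 \<le> \<sigma> * (- Im z * (cmod (u x))\<^sup>2 - Im (f x * cnj (u x)))"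
        by simp
    qed
    then show ?thesis unfolding right_diff_distrib by linarith
  qed
  then have "e / 2 * (M b - M a) \<le> 1 / (2 * e) * (Q b - Q a)"
    by (simp add: bd right_diff_distrib)
  also have "\<dots> \<le> 1 / (2 * e) * (L2_norm f)\<^sup>2" using Qle e by (intro mult_left_mono) auto
  finally have "M b - M a \<le> (L2_norm f)\<^sup>2 / e\<^sup>2"
    using e by (simp add: field_simps power2_eq_square)
  then show M1: "M b - M a \<le> (L2_norm f)\<^sup>2 / (Im z)\<^sup>2" by (simp add: e_def)
  \<comment> \<open>This bound may depend on \<open>B\<close>: it only serves to construct solutions
    and does not reach the final estimate.\<close>
  have "(- (B + cmod z + 1) * M b - Q b + N b) - (- (B + cmod z + 1) * M a - Q a + N a)
      \<le> h * Re (p b * cnj (u b)) - h * Re (p a * cnj (u a))"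
  proof (rule primitive_mono[OF primitive_add[OF primitive_diff[OF primitive_cmult[OF M] Q] N]
        ode_primitive_Re[OF ode \<open>h > 0\<close>] \<open>a \<le> b\<close>])
    fix x
    have "- (B + cmod z) * (cmod (u x))\<^sup>2 \<le> (V x - Re z) * (cmod (u x))\<^sup>2"
      using V[of x] abs_Re_le_cmod[of z] by (intro mult_right_mono) auto
    moreover have "Re (f x * cnj (u x)) \<le> (cmod (f x))\<^sup>2 + (cmod (u x))\<^sup>2"
      using fu(2)[of x] two_mult_le_squares[of 1 "cmod (f x)" "cmod (u x)"] by simp
    ultimately show "- (B + cmod z + 1) * (cmod (u x))\<^sup>2 - (cmod (f x))\<^sup>2 + (cmod (p x))\<^sup>2
        \<le> (V x - Re z) * (cmod (u x))\<^sup>2 - Re (f x * cnj (u x)) + (cmod (p x))\<^sup>2"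
      by (simp add: algebra_simps)
  qed
  then have "N b - N a \<le> (B + cmod z + 1) * (M b - M a) + (Q b - Q a)"
    by (simp add: bd algebra_simps)
  also have "\<dots> \<le> (B + cmod z + 1) * ((L2_norm f)\<^sup>2 / (Im z)\<^sup>2) + (L2_norm f)\<^sup>2"
    using M1 Qle V[of 0] norm_ge_zero[of z] by (intro add_mono mult_left_mono) auto
  finally show "N b - N a \<le> (B + cmod z + 1) * ((L2_norm f)\<^sup>2 / (Im z)\<^sup>2) + (L2_norm f)\<^sup>2" .
qed

lemma zero_L2: "(\<lambda>x. 0) \<in> L2" and L2_norm_zero: "L2_norm (\<lambda>x. 0) = 0"
  by (simp_all add: L2_def L2_norm_def)

text \<open>The boundary values depend linearly on the two coefficients. The map is injective, since
  a nonreal spectral parameter excludes nontrivial Dirichlet solutions, hence surjective by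
  dimension.\<close>

lemma dirichlet_exists:
  assumes V: "V \<in> borel_measurable lebesgue" "\<And>x. \<bar>V x\<bar> \<le> B" and "h > 0" and z: "Im z \<noteq> 0"
    and f: "f \<in> L2" and "R > 0"
    and 1: "ode V h z (\<lambda>x. 0) u1 p1" "u1 0 = 1" "p1 0 = 0"
    and 2: "ode V h z (\<lambda>x. 0) u2 p2" "u2 0 = 0" "p2 0 = 1"
    and 3: "ode V h z f u3 p3"
  obtains a b where "a * u1 R + b * u2 R + u3 R = 0" "a * u1 (-R) + b * u2 (-R) + u3 (-R) = 0"
proof -
  define L where "L w = (fst w * u1 R + snd w * u2 R, fst w * u1 (-R) + snd w * u2 (-R))"
    for w :: "complex \<times> complex"
  have lin: "linear L"
    by (rule linearI) (auto simp: L_def algebra_simps)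
  have "w = 0" if "L w = 0" for w
  proof -
    obtain a b where w: "w = (a, b)" by fastforce
    have bd: "a * u1 R + b * u2 R = 0" "a * u1 (-R) + b * u2 (-R) = 0"
      using that by (auto simp: L_def w zero_prod_def)
    let ?u = "\<lambda>x. a * u1 x + b * u2 x" and ?p = "\<lambda>x. a * p1 x + b * p2 x"
    have ode: "ode V h z (\<lambda>x. 0) ?u ?p"
      using ode_lincomb[OF 1(1) 2(1), of a b] by simp
    obtain M N where MN: "primitive M (\<lambda>x. (cmod (?u x))\<^sup>2)" "primitive N (\<lambda>x. (cmod (?p x))\<^sup>2)"
      using ode_square_primitives[OF ode] by blast
    have le: "-R \<le> R" "-R < R" "0 \<in> {-R..R}" using \<open>R > 0\<close> by auto
    \<comment> \<open>For zero forcing the bounds say that the masses of \<open>?u\<close> and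
      \<open>?p\<close> over the interval vanish, so both functions are 0 at 0, where their values
      are \<open>a\<close> and \<open>b\<close>.\<close>
    note bounds = dirichlet_bounds[OF ode \<open>h > 0\<close> V(2) z zero_L2 le(1) bd(2,1) MN, unfolded L2_norm_zero, simplified]
    have "(cmod (?u 0))\<^sup>2 = 0"
      by (rule continuous_eq_0_if_primitive_eq[OF MN(1) _ _ le(2) _ le(3)])
         (use bounds in \<open>auto intro!: continuous_intros ode_continuous[OF 1(1)] ode_continuous[OF 2(1)]\<close>)
    moreover have "(cmod (?p 0))\<^sup>2 = 0"
      by (rule continuous_eq_0_if_primitive_eq[OF MN(2) _ _ le(2) _ le(3)])
         (use bounds in \<open>auto intro!: continuous_intros ode_continuous[OF 1(1)] ode_continuous[OF 2(1)]\<close>)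
    ultimately show "w = 0" using 1 2 by (simp add: w zero_prod_def)
  qed
  then have "inj L" using linear_injective_0[OF lin] by blast
  then have "surj L" by (rule linear_injective_imp_surjective[OF lin _ refl])
  then obtain w where "L w = (- u3 R, - u3 (-R))" by (metis surjD)
  then show ?thesis using that[of "fst w" "snd w"] by (simp add: L_def)
qed

text \<open>The mean value over \<open>[0, 1]\<close> controls the energy at some point, and the equation
  controls its variation.\<close>

lemma ode_initial_bound:
  assumes ode: "ode V h z f u p" and "h > 0" and V: "\<And>x. \<bar>V x\<bar> \<le> B" and f: "f \<in> L2"
    and M: "primitive M (\<lambda>x. (cmod (u x))\<^sup>2)" and N: "primitive N (\<lambda>x. (cmod (p x))\<^sup>2)"
  shows "(cmod (u 0))\<^sup>2 + (cmod (p 0))\<^sup>2 \<le>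
    (1 + (2 + B + cmod z) / h) * ((M 1 - M 0) + (N 1 - N 0)) + (L2_norm f)\<^sup>2 / h"
proof -
  define H where "H x = (cmod (u x))\<^sup>2 + (cmod (p x))\<^sup>2" for x
  define c where "c = (2 + B + cmod z) / h"
  have fi: "integrable lebesgue (\<lambda>x. (cmod (f x))\<^sup>2)" using f by (simp add: L2_def)
  obtain Q where Q: "primitive Q (\<lambda>x. (cmod (f x))\<^sup>2)"
    using primitive_exists integrable_lebesgue_locally_integrable[OF fi]
    unfolding locally_integrable_def by blast
  have Qm: "Q x - Q 0 \<le> (L2_norm f)\<^sup>2" for x
    using primitive_increment_le_total[OF Q fi, of x 0] by (simp add: L2_norm_def)
  have MN: "primitive (\<lambda>x. M x + N x) H"
    unfolding H_def by (intro primitive_add M N)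
  obtain x where x: "0 \<le> x" "x \<le> 1" "H x \<le> (M 1 - M 0) + (N 1 - N 0)"
  proof (rule ccontr)
    assume "\<not> thesis"
    then have gt: "H x > (M 1 - M 0) + (N 1 - N 0)" if "0 \<le> x" "x \<le> 1" for x
      using that \<open>\<And>x. _ \<Longrightarrow> _ \<Longrightarrow> _ \<Longrightarrow> thesis\<close> by force
    have one: "primitive (\<lambda>x. ((M 1 - M 0) + (N 1 - N 0)) * x) (\<lambda>x. (M 1 - M 0) + (N 1 - N 0))"
      by (rule primitive_of_derivative) (auto intro!: derivative_eq_intros)
    have D: "primitive (\<lambda>x. M x + N x - ((M 1 - M 0) + (N 1 - N 0)) * x) (\<lambda>x. H x - ((M 1 - M 0) + (N 1 - N 0)))"
      by (intro primitive_diff MN one)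
    have contH: "continuous_on {0..1} (\<lambda>x. H x - ((M 1 - M 0) + (N 1 - N 0)))"
      unfolding H_def by (intro continuous_intros ode_continuous[OF ode])
    have "integral {0..1} (\<lambda>x. H x - ((M 1 - M 0) + (N 1 - N 0))) = 0"
      using primitiveD(4)[OF D, of 0 1] by simp
    then have "H 0 - ((M 1 - M 0) + (N 1 - N 0)) = 0"
      using integral_eq_0_iff[OF contH] gt by (force intro: less_imp_le)
    then show False using gt[of 0] by simp
  qed
  note u = ode[unfolded ode_def, THEN conjunct1] and p = ode[unfolded ode_def, THEN conjunct2]
  let ?p' = "\<lambda>x. ((V x - z) * u x - f x) / of_real h"
  \<comment> \<open>The sign is reversed because the value at 0 is to be bounded by the value at
    \<open>x\<close>, against the direction of integration.\<close>
  have H: "primitive (\<lambda>x. - H x) (\<lambda>x. - (2 * Re (p x / h * cnj (u x)) + 2 * Re (?p' x * cnj (p x))))"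
    unfolding H_def by (intro primitive_minus primitive_add primitive_cmod_power2 u p)
  have "- H x - - H 0 \<le> (c * (M x + N x) + 1 / h * Q x) - (c * (M 0 + N 0) + 1 / h * Q 0)"
  proof (rule primitive_mono[OF H primitive_add[OF primitive_cmult[OF MN] primitive_cmult[OF Q]] x(1)])
    fix t
    have "- (2 * Re (p t / h * cnj (u t)) + 2 * Re (?p' t * cnj (p t))) \<le>
        2 * cmod (p t / h * cnj (u t)) + 2 * cmod (?p' t * cnj (p t))"
      using abs_Re_le_cmod[of "p t / h * cnj (u t)"] abs_Re_le_cmod[of "?p' t * cnj (p t)"] by linarith
    also have "\<dots> = (2 * (cmod (p t) * cmod (u t)) + 2 * (cmod ((V t - z) * u t - f t) * cmod (p t))) / h"
      using \<open>h > 0\<close> by (simp add: norm_mult norm_divide add_divide_distrib)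
    also have "\<dots> \<le> ((2 + B + cmod z) * H t + (cmod (f t))\<^sup>2) / h"
    proof (rule divide_right_mono)
      have "cmod ((V t - z) * u t - f t) \<le> cmod (V t - z) * cmod (u t) + cmod (f t)"
        by (metis norm_mult norm_triangle_ineq4)
      also have "cmod (V t - z) * cmod (u t) \<le> (B + cmod z) * cmod (u t)"
        using V[of t] by (intro mult_right_mono) (auto intro!: norm_triangle_le_diff add_right_mono)
      finally have "cmod ((V t - z) * u t - f t) * cmod (p t) \<le> ((B + cmod z) * cmod (u t) + cmod (f t)) * cmod (p t)"
        by (intro mult_right_mono) auto
      moreover have "2 * (cmod (p t) * cmod (u t)) \<le> H t"
        using two_mult_le_squares[of 1 "cmod (p t)" "cmod (u t)"] by (simp add: H_def)
      moreover have "(B + cmod z) * (2 * (cmod (p t) * cmod (u t))) \<le> (B + cmod z) * H t"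
        using calculation(2) V[of t] by (intro mult_left_mono) auto
      moreover have "2 * (cmod (f t) * cmod (p t)) \<le> (cmod (f t))\<^sup>2 + H t"
      proof -
        have "cmod (f t) * cmod (p t) \<le> (cmod (f t))\<^sup>2 / 2 + (cmod (p t))\<^sup>2 / 2"
          using two_mult_le_squares[of 1 "cmod (f t)" "cmod (p t)"] by simp
        then show ?thesis
          using zero_le_power2[of "cmod (u t)"] unfolding H_def by linarith
      qed
      ultimately show "2 * (cmod (p t) * cmod (u t)) + 2 * (cmod ((V t - z) * u t - f t) * cmod (p t)) \<le>
          (2 + B + cmod z) * H t + (cmod (f t))\<^sup>2"
        by (simp add: algebra_simps)
    qed (use \<open>h > 0\<close> in simp)
    also have "\<dots> = c * H t + 1 / h * (cmod (f t))\<^sup>2"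
      using \<open>h > 0\<close> by (simp add: c_def field_simps)
    finally show "- (2 * Re (p t / h * cnj (u t)) + 2 * Re (?p' t * cnj (p t))) \<le> c * H t + 1 / h * (cmod (f t))\<^sup>2" .
  qed
  then have "H 0 \<le> H x + c * ((M x + N x) - (M 0 + N 0)) + 1 / h * (Q x - Q 0)"
    by (simp add: algebra_simps)
  also have "\<dots> \<le> ((M 1 - M 0) + (N 1 - N 0)) + c * ((M 1 + N 1) - (M 0 + N 0)) + 1 / h * (L2_norm f)\<^sup>2"
  proof -
    have "(M x + N x) \<le> M 1 + N 1"
      using primitive_mono[OF primitive_const[of 0] MN x(2)] by (simp add: H_def)
    moreover have "c \<ge> 0" using \<open>h > 0\<close> V[of 0] by (simp add: c_def)
    ultimately show ?thesis
      using x(3) Qm[of x] \<open>h > 0\<close> by (intro add_mono mult_left_mono) auto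
  qed
  finally show ?thesis by (simp add: H_def c_def algebra_simps)
qed

text \<open>Fatou's lemma; every point eventually lies in the windows because
  \<open>real n \<le> R n\<close>.\<close>

lemma L2_if_local_bound:
  fixes w :: "real \<Rightarrow> complex" and wn :: "nat \<Rightarrow> real \<Rightarrow> complex"
  assumes cont: "continuous_on UNIV w" "\<And>n. continuous_on UNIV (wn n)"
    and lim: "\<And>x. (\<lambda>n. wn n x) \<longlonglongrightarrow> w x" and R: "\<And>n. real n \<le> R n"
    and M: "\<And>n. primitive (M n) (\<lambda>x. (cmod (wn n x))\<^sup>2)" "\<And>n. M n (R n) - M n (- R n) \<le> C"
  shows "w \<in> L2"
proof -
  have meas: "w \<in> borel_measurable lebesgue" "wn n \<in> borel_measurable lebesgue" for n
    using borel_measurable_continuous_onI[OF cont(1)] borel_measurable_continuous_onI[OF cont(2)]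
    by (auto intro: measurable_completion simp: measurable_lborel2)
  let ?g = "\<lambda>n x. indicator {- R n..R n} x * (cmod (wn n x))\<^sup>2"
  have int: "integrable lebesgue (?g n)" for n
    using primitiveD(1)[OF M(1)] by (simp add: set_integrable_def)
  have bound: "(\<integral>\<^sup>+x. ennreal (?g n x) \<partial>lebesgue) \<le> ennreal C" for n
  proof -
    have "- R n \<le> R n" using R[of n] by simp
    then have "(\<integral>x. ?g n x \<partial>lebesgue) \<le> C"
      using primitive_increment_eq_lebesgue[OF M(1)] M(2)[of n] by simp
    then show ?thesis
      by (subst nn_integral_eq_integral[OF int]) (auto intro: ennreal_leI)
  qed
  have "(\<integral>\<^sup>+x. ennreal ((cmod (w x))\<^sup>2) \<partial>lebesgue) \<le> (\<integral>\<^sup>+x. liminf (\<lambda>n. ennreal (?g n x)) \<partial>lebesgue)"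
  proof (rule nn_integral_mono)
    fix x
    obtain n0 :: nat where n0: "\<bar>x\<bar> < real n0" using reals_Archimedean2 by blast
    have "(\<lambda>n. ennreal (?g n x)) \<longlonglongrightarrow> ennreal ((cmod (w x))\<^sup>2)"
    proof (rule Lim_transform_eventually)
      show "(\<lambda>n. ennreal ((cmod (wn n x))\<^sup>2)) \<longlonglongrightarrow> ennreal ((cmod (w x))\<^sup>2)"
        by (intro tendsto_ennrealI tendsto_intros lim)
      show "\<forall>\<^sub>F n in sequentially. ennreal ((cmod (wn n x))\<^sup>2) = ennreal (?g n x)"
        using eventually_ge_at_top[of n0]
      proof eventually_elim
        case (elim n)
        then have "x \<in> {- R n..R n}" using n0 R[of n] by auto
        then show ?case by simp
      qed
    qed
    then have "liminf (\<lambda>n. ennreal (?g n x)) = ennreal ((cmod (w x))\<^sup>2)"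
      by (intro lim_imp_Liminf) auto
    then show "ennreal ((cmod (w x))\<^sup>2) \<le> liminf (\<lambda>n. ennreal (?g n x))" by simp
  qed
  also have "\<dots> \<le> liminf (\<lambda>n. \<integral>\<^sup>+x. ennreal (?g n x) \<partial>lebesgue)"
    by (rule nn_integral_liminf) (use int in \<open>auto intro: borel_measurable_integrable\<close>)
  also have "\<dots> \<le> ennreal C"
    by (rule Liminf_le) (auto simp: bound)
  finally have "(\<integral>\<^sup>+x. ennreal ((cmod (w x))\<^sup>2) \<partial>lebesgue) < \<infinity>"
    by (metis ennreal_less_top infinity_ennreal_def le_less_trans)
  then have "integrable lebesgue (\<lambda>x. (cmod (w x))\<^sup>2)"
    using meas(1) by (intro integrableI_bounded) auto
  then show ?thesis using meas(1) by (simp add: L2_def)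
qed

text \<open>In the fixed basis \<open>u1\<close>, \<open>u2\<close> with particular solution
  \<open>u3\<close>, the coefficients of a solution are its values at 0. A convergent subsequence of
  these pairs gives pointwise convergence of \<open>u\<close> and \<open>p\<close> at once.\<close>

lemma L2_solution_exists:
  assumes V: "V \<in> borel_measurable lebesgue" "\<And>x. \<bar>V x\<bar> \<le> B" and "h > 0" and z: "Im z \<noteq> 0"
    and f: "f \<in> L2"
  obtains u p where "ode V h z f u p" "u \<in> L2" "p \<in> L2"
proof -
  obtain u1 p1 where 1: "ode V h z (\<lambda>x. 0) u1 p1" "u1 0 = 1" "p1 0 = 0"
    using ode_exists[OF V \<open>h > 0\<close> zero_L2] by blast
  obtain u2 p2 where 2: "ode V h z (\<lambda>x. 0) u2 p2" "u2 0 = 0" "p2 0 = 1"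
    using ode_exists[OF V \<open>h > 0\<close> zero_L2] by blast
  obtain u3 p3 where 3: "ode V h z f u3 p3" "u3 0 = 0" "p3 0 = 0"
    using ode_exists[OF V \<open>h > 0\<close> f] by blast
  define u where "u a b x = a * u1 x + b * u2 x + u3 x" for a b x
  define p where "p a b x = a * p1 x + b * p2 x + p3 x" for a b x
  have ode: "ode V h z f (u a b) (p a b)" for a b
    using ode_lincomb[OF ode_lincomb[OF 1(1) 2(1), of a b] 3(1), of 1 1]
    by (simp add: u_def[abs_def] p_def[abs_def])
  have u0: "u a b 0 = a" "p a b 0 = b" for a b
    using 1 2 3 by (simp_all add: u_def p_def)
  \<comment> \<open>The radius \<open>n + 1\<close> lets every interval contain
    \<open>[0, 1]\<close>, on which the initial values are estimated.\<close>
  have "\<exists>a b. u a b (real n + 1) = 0 \<and> u a b (- (real n + 1)) = 0" for n :: nat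
  proof -
    obtain a b where "a * u1 (real n + 1) + b * u2 (real n + 1) + u3 (real n + 1) = 0"
        "a * u1 (- (real n + 1)) + b * u2 (- (real n + 1)) + u3 (- (real n + 1)) = 0"
      using dirichlet_exists[OF V \<open>h > 0\<close> z f _ 1 2 3(1), of "real n + 1"] by auto
    then show ?thesis unfolding u_def by blast
  qed
  then obtain a b where ab: "\<And>n. u (a n) (b n) (real n + 1) = 0" "\<And>n. u (a n) (b n) (- (real n + 1)) = 0"
    by metis
  have "\<exists>M N. primitive M (\<lambda>x. (cmod (u (a n) (b n) x))\<^sup>2) \<and> primitive N (\<lambda>x. (cmod (p (a n) (b n) x))\<^sup>2)" for n
    using ode_square_primitives[OF ode] by metis
  then obtain M N where MN: "\<And>n. primitive (M n) (\<lambda>x. (cmod (u (a n) (b n) x))\<^sup>2)"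
      "\<And>n. primitive (N n) (\<lambda>x. (cmod (p (a n) (b n) x))\<^sup>2)"
    by metis
  define CM where "CM = (L2_norm f)\<^sup>2 / (Im z)\<^sup>2"
  define CN where "CN = (B + cmod z + 1) * ((L2_norm f)\<^sup>2 / (Im z)\<^sup>2) + (L2_norm f)\<^sup>2"
  have bounds: "M n (real n + 1) - M n (- (real n + 1)) \<le> CM" "N n (real n + 1) - N n (- (real n + 1)) \<le> CN" for n
    unfolding CM_def CN_def
    using dirichlet_bounds[OF ode \<open>h > 0\<close> V(2) z f _ ab(2)[of n] ab(1)[of n] MN] by simp_all
  have mono: "M n x \<le> M n y" "N n x \<le> N n y" if "x \<le> y" for n x y
    using primitive_mono[OF primitive_const[of 0] MN(1) that] primitive_mono[OF primitive_const[of 0] MN(2) that]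
    by simp_all
  define C where "C = (1 + (2 + B + cmod z) / h) * (CM + CN) + (L2_norm f)\<^sup>2 / h"
  have "(cmod (a n))\<^sup>2 + (cmod (b n))\<^sup>2 \<le> C" for n
  proof -
    have "(cmod (a n))\<^sup>2 + (cmod (b n))\<^sup>2 \<le>
        (1 + (2 + B + cmod z) / h) * ((M n 1 - M n 0) + (N n 1 - N n 0)) + (L2_norm f)\<^sup>2 / h"
      using ode_initial_bound[OF ode \<open>h > 0\<close> V(2) f MN] by (simp add: u0)
    also have "\<dots> \<le> C"
      unfolding C_def using bounds[of n] mono[of 1 "real n + 1" n] mono[of "- (real n + 1)" 0 n] \<open>h > 0\<close> V(2)[of 0]
      by (intro add_right_mono mult_left_mono) auto
    finally show ?thesis .
  qed
  then have "norm (a n, b n) \<le> sqrt C" for n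
    by (simp add: norm_Pair)
  then have "bounded (range (\<lambda>n. (a n, b n)))"
    by (auto simp: bounded_iff)
  from bounded_imp_convergent_subsequence[OF this] obtain l and r :: "nat \<Rightarrow> nat"
    where r: "strict_mono r" and lim: "((\<lambda>n. (a n, b n)) \<circ> r) \<longlonglongrightarrow> l" by blast
  have lima: "(\<lambda>n. a (r n)) \<longlonglongrightarrow> fst l" and limb: "(\<lambda>n. b (r n)) \<longlonglongrightarrow> snd l"
    using tendsto_fst[OF lim] tendsto_snd[OF lim] by (simp_all add: o_def)
  \<comment> \<open>Subsequence indices satisfy \<open>n \<le> r n\<close>, so the windows still
    exhaust the line.\<close>
  have R: "real n \<le> real (r n) + 1" for n
    using seq_suble[OF r, of n] by simp
  have "u (fst l) (snd l) \<in> L2"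
    by (rule L2_if_local_bound[OF ode_continuous(1)[OF ode] ode_continuous(1)[OF ode] _ R, where M = "\<lambda>n. M (r n)" and C = CM])
       (use bounds MN in \<open>auto simp: u_def intro!: tendsto_intros lima limb\<close>)
  moreover have "p (fst l) (snd l) \<in> L2"
    by (rule L2_if_local_bound[OF ode_continuous(2)[OF ode] ode_continuous(2)[OF ode] _ R, where M = "\<lambda>n. N (r n)" and C = CN])
       (use bounds MN in \<open>auto simp: p_def intro!: tendsto_intros lima limb\<close>)
  ultimately show ?thesis using that ode by blast
qed

subsection \<open>Products of square integrable functions\<close>

lemma L2_cmod_mult_integrable:
  assumes "f \<in> L2" "g \<in> L2"
  shows "integrable lebesgue (\<lambda>x. cmod (f x) * cmod (g x))"
proof (rule Bochner_Integration.integrable_bound)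
  show "integrable lebesgue (\<lambda>x. (cmod (f x))\<^sup>2 / 2 + (cmod (g x))\<^sup>2 / 2)"
    using assms by (simp add: L2_def)
  show "(\<lambda>x. cmod (f x) * cmod (g x)) \<in> borel_measurable lebesgue"
    using assms by (auto simp: L2_def)
  show "AE x in lebesgue. norm (cmod (f x) * cmod (g x)) \<le> norm ((cmod (f x))\<^sup>2 / 2 + (cmod (g x))\<^sup>2 / 2)"
    using two_mult_le_squares[of 1 "cmod (f _)" "cmod (g _)"] by (intro AE_I2) simp
qed

lemma L2_mult_integrable:
  assumes "f \<in> L2" "g \<in> L2"
  shows "integrable lebesgue (\<lambda>x. f x * cnj (g x))"
proof (rule Bochner_Integration.integrable_bound[OF L2_cmod_mult_integrable[OF assms]])
  have "g \<in> borel_measurable lebesgue" using assms by (simp add: L2_def)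
  then have "(\<lambda>x. cnj (g x)) \<in> borel_measurable lebesgue"
    by (rule measurable_compose) (intro borel_measurable_continuous_onI continuous_intros)
  then show "(\<lambda>x. f x * cnj (g x)) \<in> borel_measurable lebesgue"
    using assms by (auto simp: L2_def)
qed (simp add: norm_mult)

lemma L2_norm_nonneg: "0 \<le> L2_norm f"
  by (simp add: L2_norm_def)

lemma L2_norm_power2: "(L2_norm f)\<^sup>2 = (\<integral>x. (cmod (f x))\<^sup>2 \<partial>lebesgue)"
  by (simp add: L2_norm_def)

lemma L2_Cauchy_Schwarz:
  assumes "f \<in> L2" "g \<in> L2"
  shows "(\<integral>x. cmod (f x) * cmod (g x) \<partial>lebesgue) \<le> L2_norm f * L2_norm g"
proof -
  have m: "(\<lambda>x. ennreal (cmod (f x))) \<in> borel_measurable lebesgue" "(\<lambda>x. ennreal (cmod (g x))) \<in> borel_measurable lebesgue"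
    using assms by (auto simp: L2_def)
  have i: "(\<integral>\<^sup>+x. (ennreal (cmod (w x)))\<^sup>2 \<partial>lebesgue) = ennreal ((L2_norm w)\<^sup>2)" if "w \<in> L2" for w
  proof -
    have "(\<integral>\<^sup>+x. (ennreal (cmod (w x)))\<^sup>2 \<partial>lebesgue) = (\<integral>\<^sup>+x. ennreal ((cmod (w x))\<^sup>2) \<partial>lebesgue)"
      by (simp add: ennreal_power)
    also have "\<dots> = ennreal ((L2_norm w)\<^sup>2)"
      unfolding L2_norm_power2 using that by (intro nn_integral_eq_integral) (auto simp: L2_def)
    finally show ?thesis .
  qed
  let ?I = "\<integral>x. cmod (f x) * cmod (g x) \<partial>lebesgue"
  have "ennreal (?I\<^sup>2) = (\<integral>\<^sup>+x. ennreal (cmod (f x)) * ennreal (cmod (g x)) \<partial>lebesgue)\<^sup>2"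
    using nn_integral_eq_integral[OF L2_cmod_mult_integrable[OF assms]]
    by (simp add: ennreal_power ennreal_mult)
  also have "\<dots> \<le> ennreal ((L2_norm f)\<^sup>2) * ennreal ((L2_norm g)\<^sup>2)"
    using Cauchy_Schwarz_nn_integral[OF m] by (simp only: i assms)
  also have "\<dots> = ennreal ((L2_norm f * L2_norm g)\<^sup>2)"
    by (simp add: ennreal_mult power_mult_distrib)
  finally have "?I\<^sup>2 \<le> (L2_norm f * L2_norm g)\<^sup>2" by simp
  then show ?thesis
    by (rule power2_le_imp_le) (simp add: L2_norm_nonneg)
qed

subsection \<open>The resolvent\<close>

lemma resolvent_eq_if_ode:
  assumes V: "V \<in> borel_measurable lebesgue" "\<And>x. \<bar>V x\<bar> \<le> B" and "h > 0" and f: "f \<in> L2"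
    and ode: "ode V h z f u p" and L2: "u \<in> L2" "p \<in> L2"
  shows "resolvent_eq V h z f u"
proof -
  note u = ode[unfolded ode_def, THEN conjunct1] and p = ode[unfolded ode_def, THEN conjunct2]
  let ?q = "\<lambda>x. of_real (V x) - z"
  let ?v = "\<lambda>x. ((?q x * u x - f x) / of_real h) / of_real h"
  have q: "?q \<in> borel_measurable lebesgue" "\<And>x. cmod (?q x) \<le> B + cmod z"
    using V by (auto intro!: norm_triangle_le_diff add_right_mono)
  have scale: "(\<lambda>x. c * w x) \<in> L2" if "w \<in> L2" for w c
    by (rule L2_bounded_mult[OF _ _ that, of _ "cmod c"]) auto
  have p': "primitive (\<lambda>x. p x / of_real h) ?v"
    by (rule primitive_linear[OF p]) (intro bounded_linear_divide)
  have "(\<lambda>x. inverse (of_real h) * p x) \<in> L2" by (intro scale L2)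
  then have 1: "(\<lambda>x. p x / of_real h) \<in> L2" by (simp add: field_simps)
  have "(\<lambda>x. inverse (of_real (h * h)) * (?q x * u x + (- 1) * f x)) \<in> L2"
    by (intro scale L2_add L2_bounded_mult[OF q L2(1)] f)
  moreover have "inverse (of_real (h * h)) * (?q x * u x + (- 1) * f x) = ?v x" for x
    using \<open>h > 0\<close> by (simp add: field_simps)
  ultimately have 2: "?v \<in> L2" by simp
  have H2: "u \<in> H2" "AE x in lebesgue. weak_derivative 2 u x = ?v x"
    by (rule H2_if_primitives[OF u p' L2(1) 1 2])+
  from H2(2) have "AE x in lebesgue. schroedinger V h u x - z * u x = f x"
    by eventually_elim (use \<open>h > 0\<close> in \<open>simp add: schroedinger_def field_simps power2_eq_square\<close>)
  then show ?thesis using H2(1) by (simp add: resolvent_eq_def)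
qed

text \<open>An element of \<open>H2\<close> is an arbitrary member of its class; the pointwise
  energy argument needs the locally absolutely continuous one.\<close>

lemma ode_if_resolvent_eq:
  assumes "h > 0" and eq: "resolvent_eq V h z f u"
  obtains U p where "ode V h z f U p" "U \<in> L2" "p \<in> L2" "AE x in lebesgue. u x = U x"
proof -
  have "u \<in> H2" using eq by (simp add: resolvent_eq_def)
  then obtain U P v where U: "primitive U P" "primitive P v" "U \<in> L2" "P \<in> L2" "v \<in> L2"
      "AE x in lebesgue. u x = U x" "AE x in lebesgue. weak_derivative 2 u x = v x"
    using H2_primitive_representative by blast
  let ?p = "\<lambda>x. of_real h * P x"
  have "AE x in lebesgue. of_real h * v x = ((of_real (V x) - z) * U x - f x) / of_real h"
    using U(6,7) eq[unfolded resolvent_eq_def, THEN conjunct2]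
    by eventually_elim (use \<open>h > 0\<close> in \<open>auto simp: schroedinger_def field_simps power2_eq_square\<close>)
  then have "primitive ?p (\<lambda>x. ((of_real (V x) - z) * U x - f x) / of_real h)"
    by (rule primitive_cong_AE[OF primitive_linear[OF U(2) bounded_linear_mult_right]])
  moreover have "primitive U (\<lambda>x. ?p x / of_real h)"
    using U(1) \<open>h > 0\<close> by simp
  moreover have "?p \<in> L2"
    by (rule L2_bounded_mult[OF _ _ U(4), of _ h]) (use \<open>h > 0\<close> in auto)
  ultimately show ?thesis using that[of U ?p] U unfolding ode_def by blast
qed

lemma L2_bounded_mult_integrable:
  fixes w :: "real \<Rightarrow> real"
  assumes "w \<in> borel_measurable lebesgue" "\<And>x. \<bar>w x\<bar> \<le> B" "u \<in> L2"
  shows "integrable lebesgue (\<lambda>x. w x * (cmod (u x))\<^sup>2)"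
proof (rule Bochner_Integration.integrable_bound)
  show "integrable lebesgue (\<lambda>x. B * (cmod (u x))\<^sup>2)" using assms(3) by (simp add: L2_def)
  show "AE x in lebesgue. norm (w x * (cmod (u x))\<^sup>2) \<le> norm (B * (cmod (u x))\<^sup>2)"
    by (intro AE_I2) (auto simp: abs_mult intro!: mult_right_mono order_trans[OF assms(2) abs_ge_self])
  show "(\<lambda>x. w x * (cmod (u x))\<^sup>2) \<in> borel_measurable lebesgue" using assms by (auto simp: L2_def)
qed

text \<open>Since \<open>p * cnj u\<close> is integrable over the line, the integrals of the
  derivatives of its real and imaginary parts vanish.\<close>

lemma ode_integral_identities:
  assumes V: "V \<in> borel_measurable lebesgue" "\<And>x. \<bar>V x\<bar> \<le> B" and "h > 0" and f: "f \<in> L2"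
    and ode: "ode V h z f u p" and L2: "u \<in> L2" "p \<in> L2"
  shows "Im z * (L2_norm u)\<^sup>2 = - (\<integral>x. Im (f x * cnj (u x)) \<partial>lebesgue)"
    and "(L2_norm p)\<^sup>2 = (\<integral>x. (Re z - V x) * (cmod (u x))\<^sup>2 \<partial>lebesgue) + (\<integral>x. Re (f x * cnj (u x)) \<partial>lebesgue)"
proof -
  note fu = L2_mult_integrable[OF f L2(1)] and pu = L2_mult_integrable[OF L2(2,1)]
  have u2: "integrable lebesgue (\<lambda>x. (cmod (u x))\<^sup>2)" and p2: "integrable lebesgue (\<lambda>x. (cmod (p x))\<^sup>2)"
    using L2 by (auto simp: L2_def)
  have Vu: "integrable lebesgue (\<lambda>x. (V x - Re z) * (cmod (u x))\<^sup>2)"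
  proof (rule L2_bounded_mult_integrable[OF _ _ L2(1), where B = "B + \<bar>Re z\<bar>"])
    show "\<bar>V x - Re z\<bar> \<le> B + \<bar>Re z\<bar>" for x using V(2)[of x] by linarith
  qed (use V(1) in simp)
  have "(\<integral>x. - Im z * (cmod (u x))\<^sup>2 - Im (f x * cnj (u x)) \<partial>lebesgue) = 0"
    by (rule integral_derivative_eq_0[OF ode_primitive_Im[OF ode \<open>h > 0\<close>]])
       (intro integrable_mult_right Bochner_Integration.integrable_diff integrable_Im fu pu u2)+
  moreover have "(\<integral>x. - Im z * (cmod (u x))\<^sup>2 - Im (f x * cnj (u x)) \<partial>lebesgue) =
      - Im z * (\<integral>x. (cmod (u x))\<^sup>2 \<partial>lebesgue) - (\<integral>x. Im (f x * cnj (u x)) \<partial>lebesgue)"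
    by (subst Bochner_Integration.integral_diff) (intro integrable_mult_right integrable_Im fu u2 refl | simp only: integral_mult_right_zero)+
  ultimately show "Im z * (L2_norm u)\<^sup>2 = - (\<integral>x. Im (f x * cnj (u x)) \<partial>lebesgue)"
    by (simp add: L2_norm_power2)
  have "(\<integral>x. (V x - Re z) * (cmod (u x))\<^sup>2 - Re (f x * cnj (u x)) + (cmod (p x))\<^sup>2 \<partial>lebesgue) = 0"
    by (rule integral_derivative_eq_0[OF ode_primitive_Re[OF ode \<open>h > 0\<close>]])
       (intro integrable_mult_right Bochner_Integration.integrable_diff Bochner_Integration.integrable_add integrable_Re fu pu Vu p2)+
  moreover have "(\<integral>x. (V x - Re z) * (cmod (u x))\<^sup>2 - Re (f x * cnj (u x)) + (cmod (p x))\<^sup>2 \<partial>lebesgue) =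
      (\<integral>x. (V x - Re z) * (cmod (u x))\<^sup>2 \<partial>lebesgue) - (\<integral>x. Re (f x * cnj (u x)) \<partial>lebesgue) + (\<integral>x. (cmod (p x))\<^sup>2 \<partial>lebesgue)"
    by (subst Bochner_Integration.integral_add, intro Bochner_Integration.integrable_diff integrable_Re fu Vu, rule p2)
       (subst Bochner_Integration.integral_diff, rule Vu, intro integrable_Re fu, rule refl)
  moreover have "(\<integral>x. (Re z - V x) * (cmod (u x))\<^sup>2 \<partial>lebesgue) = - (\<integral>x. (V x - Re z) * (cmod (u x))\<^sup>2 \<partial>lebesgue)"
    by (subst integral_minus[symmetric]) (simp add: algebra_simps)
  ultimately show "(L2_norm p)\<^sup>2 = (\<integral>x. (Re z - V x) * (cmod (u x))\<^sup>2 \<partial>lebesgue) + (\<integral>x. Re (f x * cnj (u x)) \<partial>lebesgue)"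
    by (simp add: L2_norm_power2)
qed

text \<open>The quantitative form of self-adjointness: it yields uniqueness, the bound for large
  \<open>Im z\<close>, and the control of the term with \<open>\<epsilon>\<close>.\<close>

lemma ode_Im_bound:
  assumes V: "V \<in> borel_measurable lebesgue" "\<And>x. \<bar>V x\<bar> \<le> B" and "h > 0" and f: "f \<in> L2"
    and ode: "ode V h z f u p" and L2: "u \<in> L2" "p \<in> L2"
  shows "\<bar>Im z\<bar> * (L2_norm u)\<^sup>2 \<le> (\<integral>x. cmod (f x) * cmod (u x) \<partial>lebesgue)"
proof -
  have "\<bar>Im z\<bar> * (L2_norm u)\<^sup>2 = \<bar>\<integral>x. Im (f x * cnj (u x)) \<partial>lebesgue\<bar>"
    using ode_integral_identities(1)[OF assms] by (metis abs_minus_cancel abs_mult abs_power2)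
  also have "\<dots> \<le> (\<integral>x. cmod (f x) * cmod (u x) \<partial>lebesgue)"
    by (rule integral_abs_bound_integral)
       (use L2_mult_integrable[OF f L2(1)] L2_cmod_mult_integrable[OF f L2(1)] abs_Im_le_cmod[of "f _ * cnj (u _)"]
         in \<open>auto simp: norm_mult simp del: Im_complex_div_eq_0 times_complex.sel intro: integrable_Im\<close>)
  finally show ?thesis .
qed

lemma shift_bijective_if_Im_nonzero:
  assumes V: "V \<in> borel_measurable lebesgue" "\<And>x. \<bar>V x\<bar> \<le> B" and "h > 0" and z: "Im z \<noteq> 0"
  shows "shift_bijective V h z"
  unfolding shift_bijective_def
proof (intro conjI ballI allI impI)
  fix f assume f: "f \<in> L2"
  show "\<exists>u. resolvent_eq V h z f u"
    using L2_solution_exists[OF assms f] resolvent_eq_if_ode[OF V \<open>h > 0\<close> f] by metis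
  fix u v assume "resolvent_eq V h z f u" "resolvent_eq V h z f v"
  obtain u' p where u: "ode V h z f u' p" "u' \<in> L2" "p \<in> L2" "AE x in lebesgue. u x = u' x"
    using ode_if_resolvent_eq[OF \<open>h > 0\<close> \<open>resolvent_eq V h z f u\<close>] by blast
  obtain v' q where v: "ode V h z f v' q" "v' \<in> L2" "q \<in> L2" "AE x in lebesgue. v x = v' x"
    using ode_if_resolvent_eq[OF \<open>h > 0\<close> \<open>resolvent_eq V h z f v\<close>] by blast
  have sub: "(\<lambda>x. 1 * a x + (- 1) * b x) \<in> L2" if "a \<in> L2" "b \<in> L2" for a b
    by (intro L2_add L2_bounded_mult[where B = 1] that) auto
  have "ode V h z (\<lambda>x. 0) (\<lambda>x. 1 * u' x + (- 1) * v' x) (\<lambda>x. 1 * p x + (- 1) * q x)"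
    using ode_lincomb[OF u(1) v(1), of 1 "-1"] by simp
  from ode_Im_bound[OF V \<open>h > 0\<close> zero_L2 this sub[OF u(2) v(2)] sub[OF u(3) v(3)]]
  have "(L2_norm (\<lambda>x. 1 * u' x + (- 1) * v' x))\<^sup>2 = 0"
    using z by (simp add: mult_le_0_iff)
  then have "AE x in lebesgue. (cmod (1 * u' x + (- 1) * v' x))\<^sup>2 = 0"
    unfolding L2_norm_power2 using sub[OF u(2) v(2)]
    by (subst (asm) integral_nonneg_eq_0_iff_AE) (auto simp: L2_def)
  then show "AE x in lebesgue. u x = v x"
    using u(4) v(4) by eventually_elim simp
qed

subsection \<open>The energy estimate\<close>

lemma weight_L2:
  assumes "f \<in> L2" "s > 0"
  shows "weight s f \<in> L2" "L2_norm (weight s f) \<le> L2_norm f"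
proof -
  have jb: "1 \<le> japanese_bracket x" for x by (simp add: japanese_bracket_def)
  have le: "japanese_bracket x powr (- s) \<le> 1" "0 \<le> japanese_bracket x powr (- s)" for x
    using powr_mono[of "- s" 0 "japanese_bracket x"] jb[of x] \<open>s > 0\<close> by auto
  have "japanese_bracket \<in> borel_measurable borel"
    unfolding japanese_bracket_def[abs_def] by simp
  then have m: "japanese_bracket \<in> borel_measurable lebesgue"
    by (intro measurable_completion) (simp add: measurable_lborel2)
  show 1: "weight s f \<in> L2"
    unfolding weight_def[abs_def]
    by (rule L2_bounded_mult[where B = 1, OF _ _ assms(1)]) (use m le in auto)
  have "(L2_norm (weight s f))\<^sup>2 \<le> (L2_norm f)\<^sup>2"
    unfolding L2_norm_power2
  proof (rule integral_mono)
    show "(cmod (weight s f x))\<^sup>2 \<le> (cmod (f x))\<^sup>2" for x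
      using le[of x] by (intro power_mono) (auto simp: weight_def norm_mult intro: mult_left_le_one_le)
  qed (use 1 assms in \<open>auto simp: L2_def\<close>)
  then show "L2_norm (weight s f) \<le> L2_norm f"
    by (rule power2_le_imp_le) (rule L2_norm_nonneg)
qed

text \<open>The condition \<open>s > 1/2\<close> is the integrability at infinity of the power with
  exponent \<open>- 2 * s\<close>, which dominates the squared weight outside
  \<open>[-1, 1]\<close>.\<close>

lemma bracket_powr_integrable:
  assumes "s > 1/2"
  shows "integrable lebesgue (\<lambda>x. (japanese_bracket x powr (- s))\<^sup>2)"
proof -
  let ?j = "\<lambda>x. (japanese_bracket x powr (- s))\<^sup>2"
  have jb: "1 \<le> japanese_bracket x" "\<bar>x\<bar> \<le> japanese_bracket x" for x
    by (auto simp: japanese_bracket_def intro: real_le_rsqrt)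
  have j: "?j x = japanese_bracket x powr (- 2 * s)" for x
    using jb[of x] by (simp add: powr_powr mult.commute flip: powr_realpow)
  have "continuous_on UNIV japanese_bracket"
    unfolding japanese_bracket_def[abs_def] by (intro continuous_intros)
  then have "japanese_bracket \<in> borel_measurable borel" by (rule borel_measurable_continuous_onI)
  then have m: "?j \<in> borel_measurable lebesgue"
    by (intro borel_measurable_power measurable_completion) (simp add: measurable_lborel2)
  let ?g = "\<lambda>x. indicator {1..} x * x powr (- 2 * s)"
  have "(\<lambda>x. x powr (- 2 * s)) absolutely_integrable_on {1::real..}"
    using has_integral_powr_to_inf[of "- 2 * s" 1] assms
    by (intro nonnegative_absolutely_integrable_1) (auto simp: integrable_on_def)
  then have g: "integrable lebesgue ?g" by (simp add: set_integrable_def)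
  have g': "integrable lebesgue (\<lambda>x. ?g (0 + (- 1) * x))"
    using lebesgue_integrable_real_affine[OF g, of "-1" 0] by simp
  have ind: "integrable lebesgue (indicat_real {-1..1::real})"
    by (intro integrable_real_indicator) auto
  show ?thesis
  proof (rule Bochner_Integration.integrable_bound[OF Bochner_Integration.integrable_add[OF ind Bochner_Integration.integrable_add[OF g g']] m], intro AE_I2)
    fix x
    have 1: "?j x \<le> 1"
      using powr_mono[of "- 2 * s" 0 "japanese_bracket x"] jb[of x] assms by (simp add: j)
    have 2: "?j x \<le> \<bar>x\<bar> powr (- 2 * s)" if "\<bar>x\<bar> \<ge> 1"
      unfolding j using jb[of x] assms that by (intro powr_mono2') auto
    consider "x \<in> {-1..1}" | "x > 1" | "x < -1" by fastforce
    then have "?j x \<le> indicat_real {-1..1::real} x + (?g x + ?g (0 + (- 1) * x))"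
    proof cases
      case 1 with \<open>?j x \<le> 1\<close> show ?thesis by (simp add: add_increasing2)
    qed (use 2 in auto)
    then show "norm (?j x) \<le> norm (indicat_real {-1..1::real} x + (?g x + ?g (0 + (- 1) * x)))"
      by simp
  qed
qed

text \<open>Converts a pointwise energy bound into a weighted norm; the factor \<open>c\<close> will
  be 1, \<open>\<kappa>\<close> and \<open>S + 1\<close>.\<close>

lemma weighted_norm_le_sup:
  assumes "s > 1/2" "w \<in> L2" and bd: "\<And>x. c * (cmod (w x))\<^sup>2 \<le> X"
  shows "c * (L2_norm (weight s w))\<^sup>2 \<le> (\<integral>x. (japanese_bracket x powr (- s))\<^sup>2 \<partial>lebesgue) * X"
proof -
  have "c * (L2_norm (weight s w))\<^sup>2 = (\<integral>x. c * (cmod (weight s w x))\<^sup>2 \<partial>lebesgue)"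
    by (simp add: L2_norm_power2)
  also have "\<dots> \<le> (\<integral>x. (japanese_bracket x powr (- s))\<^sup>2 * X \<partial>lebesgue)"
  proof (rule integral_mono)
    show "integrable lebesgue (\<lambda>x. c * (cmod (weight s w x))\<^sup>2)"
      using weight_L2(1)[OF assms(2), of s] assms(1) by (simp add: L2_def)
    show "integrable lebesgue (\<lambda>x. (japanese_bracket x powr (- s))\<^sup>2 * X)"
      by (intro integrable_mult_left bracket_powr_integrable assms)
    show "c * (cmod (weight s w x))\<^sup>2 \<le> (japanese_bracket x powr (- s))\<^sup>2 * X" for x
      using mult_left_mono[OF bd[of x], of "(japanese_bracket x powr (- s))\<^sup>2"]
      by (simp add: weight_def norm_mult power_mult_distrib mult_ac)
  qed
  finally show ?thesis by simp
qed

text \<open>Moves the weight from the data to the solution, whose weighted norm the energy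
  controls.\<close>

lemma weight_transfer:
  assumes "f \<in> L2" "w \<in> L2" "s > 0"
  shows "(\<integral>x. cmod (weight s f x) * cmod (w x) \<partial>lebesgue) \<le> L2_norm f * L2_norm (weight s w)"
proof -
  have "(\<integral>x. cmod (weight s f x) * cmod (w x) \<partial>lebesgue) = (\<integral>x. cmod (f x) * cmod (weight s w x) \<partial>lebesgue)"
    by (simp add: weight_def norm_mult mult_ac)
  also have "\<dots> \<le> L2_norm f * L2_norm (weight s w)"
    by (intro L2_Cauchy_Schwarz weight_L2 assms)
  finally show ?thesis .
qed

text \<open>In the derivative of the energy the contributions of \<open>V - Re z\<close> and of
  \<open>W\<close> are multiples of the same \<open>Re (u x * cnj (p x))\<close> and add up. Thus,
  besides the terms with \<open>Im z\<close> and \<open>f\<close>, only the discrepancy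
  \<open>V - Re z + W\<close> is divided by \<open>h\<close>.\<close>

lemma energy_bound:
  assumes V: "V \<in> borel_measurable lebesgue" "\<And>x. \<bar>V x\<bar> \<le> B" and "h > 0" and f: "f \<in> L2"
    and ode: "ode V h z f u p" and L2: "u \<in> L2" "p \<in> L2"
    and W: "primitive W w" "\<And>x. \<kappa> \<le> W x" "\<And>x. W x \<le> BW" and "\<kappa> > 0"
    and r1: "integrable lebesgue r1" "\<And>x. 0 \<le> r1 x" and r2: "integrable lebesgue r2" "\<And>x. 0 \<le> r2 x"
    and ae: "AE x in lebesgue. \<bar>w x\<bar> \<le> r1 x * W x" "AE x in lebesgue. \<bar>V x - Re z + W x\<bar> \<le> r2 x * sqrt (W x)"
  shows "(cmod (p x))\<^sup>2 + W x * (cmod (u x))\<^sup>2 \<le>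
    exp ((\<integral>x. r1 x \<partial>lebesgue) + (\<integral>x. r2 x \<partial>lebesgue) / h) *
    (2 / h * (\<bar>Im z\<bar> * (\<integral>x. cmod (u x) * cmod (p x) \<partial>lebesgue) + (\<integral>x. cmod (f x) * cmod (p x) \<partial>lebesgue)))"
proof -
  note ode_u = ode[unfolded ode_def, THEN conjunct1] and ode_p = ode[unfolded ode_def, THEN conjunct2]
  define F where "F x = (cmod (p x))\<^sup>2 + W x * (cmod (u x))\<^sup>2" for x
  let ?p' = "\<lambda>x. ((V x - z) * u x - f x) / of_real h"
  define F' where "F' x = 2 * Re (?p' x * cnj (p x)) + (w x * (cmod (u x))\<^sup>2 + W x * (2 * Re (p x / of_real h * cnj (u x))))" for x
  have F: "primitive F F'"
    unfolding F_def[abs_def] F'_def[abs_def]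
    by (intro primitive_add primitive_mult primitive_cmod_power2 ode_u ode_p W(1))
  have Wpos: "0 < W x" for x using W(2)[of x] \<open>\<kappa> > 0\<close> by linarith
  have F0: "0 \<le> F x" for x using Wpos[of x] by (simp add: F_def)
  have Wm: "W \<in> borel_measurable lebesgue"
    using primitive_continuous[OF W(1)] borel_measurable_continuous_onI[of W]
    by (auto intro: measurable_completion simp: measurable_lborel2)
  have "\<bar>W x\<bar> \<le> BW" for x using W(3)[of x] Wpos[of x] by linarith
  then have Fi: "integrable lebesgue F"
    unfolding F_def[abs_def] using L2
    by (intro Bochner_Integration.integrable_add L2_bounded_mult_integrable[OF Wm]) (auto simp: L2_def)
  let ?r = "\<lambda>x. r1 x + r2 x / h"
  let ?s = "\<lambda>x. 2 / h * (\<bar>Im z\<bar> * (cmod (u x) * cmod (p x)) + cmod (f x) * cmod (p x))"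
  have r: "integrable lebesgue ?r" "\<And>x. 0 \<le> ?r x" using r1 r2 \<open>h > 0\<close> by auto
  have up: "integrable lebesgue (\<lambda>x. cmod (u x) * cmod (p x))" "integrable lebesgue (\<lambda>x. cmod (f x) * cmod (p x))"
    by (intro L2_cmod_mult_integrable L2 f)+
  have s: "integrable lebesgue ?s"
    by (intro integrable_mult_right Bochner_Integration.integrable_add up)
  have s0: "0 \<le> ?s x" for x using \<open>h > 0\<close> by simp
  have "AE x in lebesgue. - F' x \<le> ?r x * F x + ?s x"
    using ae
  proof eventually_elim
    case (elim x)
    have "F' x = 2 / h * ((V x - Re z + W x) * Re (u x * cnj (p x)) + Im z * Im (u x * cnj (p x))
        - Re (f x * cnj (p x))) + w x * (cmod (u x))\<^sup>2"
      using \<open>h > 0\<close> by (simp add: F'_def field_simps)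
    moreover have "\<bar>(V x - Re z + W x) * Re (u x * cnj (p x))\<bar> \<le> r2 x * F x / 2"
    proof -
      have "\<bar>(V x - Re z + W x) * Re (u x * cnj (p x))\<bar> \<le> (r2 x * sqrt (W x)) * (cmod (u x) * cmod (p x))"
        using elim(2) abs_Re_le_cmod[of "u x * cnj (p x)"] unfolding abs_mult
        by (intro mult_mono) (auto simp: norm_mult simp del: times_complex.sel)
      also have "\<dots> = r2 x * ((sqrt (W x) * cmod (u x)) * cmod (p x))" by simp
      also have "\<dots> \<le> r2 x * (F x / 2)"
      proof (rule mult_left_mono[OF _ r2(2)])
        \<comment> \<open>The factor \<open>sqrt (W x)\<close> in the hypothesis on
          \<open>r2\<close> is exactly what turns \<open>cmod (u x) * cmod (p x)\<close> into at
          most half the energy.\<close>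
        have "(sqrt (W x) * cmod (u x)) * cmod (p x) \<le> (sqrt (W x) * cmod (u x))\<^sup>2 / 2 + (cmod (p x))\<^sup>2 / 2"
          using two_mult_le_squares[of 1 "sqrt (W x) * cmod (u x)" "cmod (p x)"] by simp
        also have "\<dots> = F x / 2" using Wpos[of x] by (simp add: F_def power_mult_distrib add_divide_distrib)
        finally show "(sqrt (W x) * cmod (u x)) * cmod (p x) \<le> F x / 2" .
      qed
      finally show ?thesis by simp
    qed
    moreover have "\<bar>Im z * Im (u x * cnj (p x))\<bar> \<le> \<bar>Im z\<bar> * (cmod (u x) * cmod (p x))"
      using abs_Im_le_cmod[of "u x * cnj (p x)"] unfolding abs_mult
      by (intro mult_left_mono) (auto simp: norm_mult simp del: times_complex.sel)
    moreover have "\<bar>Re (f x * cnj (p x))\<bar> \<le> cmod (f x) * cmod (p x)"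
      using abs_Re_le_cmod[of "f x * cnj (p x)"] by (simp add: norm_mult del: times_complex.sel)
    ultimately have "- F' x \<le> 2 / h * (r2 x * F x / 2 + \<bar>Im z\<bar> * (cmod (u x) * cmod (p x)) + cmod (f x) * cmod (p x))
        - w x * (cmod (u x))\<^sup>2"
    proof -
      assume *: "F' x = 2 / h * ((V x - Re z + W x) * Re (u x * cnj (p x)) + Im z * Im (u x * cnj (p x))
          - Re (f x * cnj (p x))) + w x * (cmod (u x))\<^sup>2"
        and b: "\<bar>(V x - Re z + W x) * Re (u x * cnj (p x))\<bar> \<le> r2 x * F x / 2"
          "\<bar>Im z * Im (u x * cnj (p x))\<bar> \<le> \<bar>Im z\<bar> * (cmod (u x) * cmod (p x))"
          "\<bar>Re (f x * cnj (p x))\<bar> \<le> cmod (f x) * cmod (p x)"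
      have "- ((V x - Re z + W x) * Re (u x * cnj (p x)) + Im z * Im (u x * cnj (p x)) - Re (f x * cnj (p x)))
          \<le> r2 x * F x / 2 + \<bar>Im z\<bar> * (cmod (u x) * cmod (p x)) + cmod (f x) * cmod (p x)"
        using b by linarith
      moreover have "0 \<le> 2 / h" using \<open>h > 0\<close> by simp
      ultimately show ?thesis
        using mult_left_mono[of "- ((V x - Re z + W x) * Re (u x * cnj (p x)) + Im z * Im (u x * cnj (p x))
          - Re (f x * cnj (p x)))" _ "2 / h"]
        unfolding * mult_minus_right by fastforce
    qed
    moreover have "- w x * (cmod (u x))\<^sup>2 \<le> r1 x * F x"
    proof -
      have "- w x * (cmod (u x))\<^sup>2 \<le> (r1 x * W x) * (cmod (u x))\<^sup>2"
        using elim(1) by (intro mult_right_mono) auto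
      also have "\<dots> \<le> r1 x * F x"
        using r1(2)[of x] by (simp add: F_def mult.assoc mult_left_mono)
      finally show ?thesis .
    qed
    ultimately show ?case by (simp add: algebra_simps)
  qed
  from gronwall_from_infinity[OF F F0 Fi r s s0 this, of x]
  show ?thesis
    using r1(1) r2(1) up by (simp add: F_def)
qed

text \<open>The energy bound \<open>X\<close> contains integrals of \<open>u\<close> and
  \<open>p\<close>; these are at most a multiple of \<open>sqrt X\<close>, so the inequality can be
  divided by \<open>sqrt X\<close>. \<open>S\<close> may be large, but it is compared with
  \<open>W\<close> through \<open>\<Lambda>\<close>, and only \<open>\<Lambda>\<close>
  survives.\<close>

lemma weighted_solution_bound:
  assumes V: "V \<in> borel_measurable lebesgue" "\<And>x. \<bar>V x\<bar> \<le> B" and "h > 0" and g: "g \<in> L2" "L2_norm g \<le> 1"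
    and "s > 1/2" and ode: "ode V h z (weight s g) u p" and L2: "u \<in> L2" "p \<in> L2" and z: "\<bar>Im z\<bar> \<le> 1"
    and W: "primitive W w" "\<And>x. \<kappa> \<le> W x" "\<And>x. W x \<le> BW" and "\<kappa> > 0"
    and r1: "integrable lebesgue r1" "\<And>x. 0 \<le> r1 x" and r2: "integrable lebesgue r2" "\<And>x. 0 \<le> r2 x"
    and ae: "AE x in lebesgue. \<bar>w x\<bar> \<le> r1 x * W x" "AE x in lebesgue. \<bar>V x - Re z + W x\<bar> \<le> r2 x * sqrt (W x)"
    and S: "0 \<le> S" "AE x in lebesgue. Re z - V x \<le> S" and \<Lambda>: "0 \<le> \<Lambda>" "\<And>x. S + 1 \<le> \<Lambda>\<^sup>2 * W x"
  shows "L2_norm (weight s u) \<le> 2 / h * exp ((\<integral>x. r1 x \<partial>lebesgue) + (\<integral>x. r2 x \<partial>lebesgue) / h) *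
    (\<Lambda> + 1) * (\<integral>x. (japanese_bracket x powr (- s))\<^sup>2 \<partial>lebesgue) / sqrt \<kappa>"
proof -
  have "s > 0" using \<open>s > 1/2\<close> by simp
  let ?f = "weight s g"
  have f: "?f \<in> L2" by (rule weight_L2[OF g(1) \<open>s > 0\<close>])
  define cs where "cs = (\<integral>x. (japanese_bracket x powr (- s))\<^sup>2 \<partial>lebesgue)"
  define D where "D = exp ((\<integral>x. r1 x \<partial>lebesgue) + (\<integral>x. r2 x \<partial>lebesgue) / h) * (2 / h)"
  define Iup where "Iup = (\<integral>x. cmod (u x) * cmod (p x) \<partial>lebesgue)"
  define Ifp where "Ifp = (\<integral>x. cmod (?f x) * cmod (p x) \<partial>lebesgue)"
  define Ifu where "Ifu = (\<integral>x. cmod (?f x) * cmod (u x) \<partial>lebesgue)"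
  define X where "X = D * (\<bar>Im z\<bar> * Iup + Ifp)"
  have FX: "(cmod (p x))\<^sup>2 + W x * (cmod (u x))\<^sup>2 \<le> X" for x
    using energy_bound[OF V \<open>h > 0\<close> f ode L2 W \<open>\<kappa> > 0\<close> r1 r2 ae, of x]
    unfolding X_def D_def Iup_def Ifp_def by (simp only: mult.assoc)
  have Wpos: "0 < W x" for x using W(2)[of x] \<open>\<kappa> > 0\<close> by linarith
  have cs: "0 \<le> cs" unfolding cs_def by simp
  have D: "0 \<le> D" using \<open>h > 0\<close> by (simp add: D_def)
  have WX: "W x * (cmod (u x))\<^sup>2 \<le> X" for x using FX[of x] zero_le_power2[of "cmod (p x)"] by linarith
  have X0: "0 \<le> X" using WX[of 0] Wpos[of 0] by (meson less_imp_le mult_nonneg_nonneg order_trans zero_le_power2)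
  let ?nu = "L2_norm (weight s u)" and ?np = "L2_norm (weight s p)"
  have np: "?np\<^sup>2 \<le> cs * X"
    using weighted_norm_le_sup[OF \<open>s > 1/2\<close> L2(2), of 1 X] FX Wpos unfolding cs_def
    by (smt (verit, best) mult_1 mult_nonneg_nonneg zero_le_power2)
  have nu: "\<kappa> * ?nu\<^sup>2 \<le> cs * X"
    unfolding cs_def
  proof (rule weighted_norm_le_sup[OF \<open>s > 1/2\<close> L2(1)])
    show "\<kappa> * (cmod (u x))\<^sup>2 \<le> X" for x
      using mult_right_mono[OF W(2)[of x], of "(cmod (u x))\<^sup>2"] WX[of x] by simp
  qed
  have nuS: "(S + 1) * ?nu\<^sup>2 \<le> cs * (\<Lambda>\<^sup>2 * X)"
    unfolding cs_def
  proof (rule weighted_norm_le_sup[OF \<open>s > 1/2\<close> L2(1)])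
    fix x
    have "(S + 1) * (cmod (u x))\<^sup>2 \<le> (\<Lambda>\<^sup>2 * W x) * (cmod (u x))\<^sup>2"
      by (intro mult_right_mono \<Lambda>) simp
    also have "\<dots> \<le> \<Lambda>\<^sup>2 * X"
      using mult_left_mono[OF WX[of x], of "\<Lambda>\<^sup>2"] by (simp add: mult.assoc)
    finally show "(S + 1) * (cmod (u x))\<^sup>2 \<le> \<Lambda>\<^sup>2 * X" .
  qed
  have Ifp: "Ifp \<le> ?np"
    unfolding Ifp_def using weight_transfer[OF g(1) L2(2) \<open>s > 0\<close>] g(2) L2_norm_nonneg[of "weight s p"]
      mult_right_mono[OF g(2), of ?np] by simp
  have Ifu: "Ifu \<le> ?nu"
    unfolding Ifu_def using weight_transfer[OF g(1) L2(1) \<open>s > 0\<close>] g(2) L2_norm_nonneg[of "weight s u"]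
      mult_right_mono[OF g(2), of ?nu] by simp
  have Ifu0: "0 \<le> Ifu" unfolding Ifu_def by simp
  have eu: "\<bar>Im z\<bar> * (L2_norm u)\<^sup>2 \<le> Ifu"
    unfolding Ifu_def by (rule ode_Im_bound[OF V \<open>h > 0\<close> f ode L2])
  have pS: "(L2_norm p)\<^sup>2 \<le> S * (L2_norm u)\<^sup>2 + Ifu"
  proof -
    have "(\<integral>x. (Re z - V x) * (cmod (u x))\<^sup>2 \<partial>lebesgue) \<le> (\<integral>x. S * (cmod (u x))\<^sup>2 \<partial>lebesgue)"
    proof (rule integral_mono_AE)
      show "integrable lebesgue (\<lambda>x. (Re z - V x) * (cmod (u x))\<^sup>2)"
      proof (rule L2_bounded_mult_integrable[OF _ _ L2(1)])
        show "\<bar>Re z - V x\<bar> \<le> \<bar>Re z\<bar> + B" for x using V(2)[of x] by linarith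
      qed (use V(1) in simp)
      show "integrable lebesgue (\<lambda>x. S * (cmod (u x))\<^sup>2)" using L2(1) by (simp add: L2_def)
      show "AE x in lebesgue. (Re z - V x) * (cmod (u x))\<^sup>2 \<le> S * (cmod (u x))\<^sup>2"
        using S(2) by eventually_elim (auto intro: mult_right_mono)
    qed
    moreover have "(\<integral>x. Re (?f x * cnj (u x)) \<partial>lebesgue) \<le> Ifu"
      unfolding Ifu_def
    proof (rule integral_mono)
      show "integrable lebesgue (\<lambda>x. Re (?f x * cnj (u x)))"
        by (intro integrable_Re L2_mult_integrable f L2)
      show "integrable lebesgue (\<lambda>x. cmod (?f x) * cmod (u x))"
        by (intro L2_cmod_mult_integrable f L2)
      show "Re (?f x * cnj (u x)) \<le> cmod (?f x) * cmod (u x)" for x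
        using complex_Re_le_cmod[of "?f x * cnj (u x)"] by (simp add: norm_mult del: times_complex.sel)
    qed
    ultimately show ?thesis
      unfolding ode_integral_identities(2)[OF V \<open>h > 0\<close> f ode L2] by (simp add: L2_norm_power2)
  qed
  \<comment> \<open>After Cauchy-Schwarz each of the two squared norms receives one factor
    \<open>\<bar>Im z\<bar>\<close>, as \<open>ode_Im_bound\<close> requires; no inverse power of
    \<open>Im z\<close> remains.\<close>
  have "(\<bar>Im z\<bar> * Iup)\<^sup>2 \<le> cs * (\<Lambda>\<^sup>2 * X)"
  proof -
    have "0 \<le> Iup" unfolding Iup_def by simp
    moreover have "Iup \<le> L2_norm u * L2_norm p"
      unfolding Iup_def by (rule L2_Cauchy_Schwarz[OF L2])
    ultimately have "(\<bar>Im z\<bar> * Iup)\<^sup>2 \<le> (\<bar>Im z\<bar> * (L2_norm u * L2_norm p))\<^sup>2"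
      by (intro power_mono mult_left_mono) auto
    also have "\<dots> = (\<bar>Im z\<bar> * (L2_norm u)\<^sup>2) * (\<bar>Im z\<bar> * (L2_norm p)\<^sup>2)"
      by (simp add: power2_eq_square)
    also have "\<dots> \<le> Ifu * ((S + 1) * Ifu)"
    proof (rule mult_mono[OF eu _ Ifu0])
      have "\<bar>Im z\<bar> * (L2_norm p)\<^sup>2 \<le> S * (\<bar>Im z\<bar> * (L2_norm u)\<^sup>2) + \<bar>Im z\<bar> * Ifu"
        using mult_left_mono[OF pS, of "\<bar>Im z\<bar>"] by (simp add: algebra_simps)
      \<comment> \<open>The restriction to small imaginary parts enters in the last summand.\<close>
      also have "\<dots> \<le> S * Ifu + 1 * Ifu"
        using S(1) eu z Ifu0 by (intro add_mono mult_left_mono mult_right_mono) auto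
      finally show "\<bar>Im z\<bar> * (L2_norm p)\<^sup>2 \<le> (S + 1) * Ifu" by (simp add: algebra_simps)
    qed simp
    also have "\<dots> = (S + 1) * Ifu\<^sup>2" by (simp add: power2_eq_square)
    also have "\<dots> \<le> (S + 1) * ?nu\<^sup>2"
      using Ifu Ifu0 S(1) by (intro mult_left_mono power_mono) auto
    also note nuS
    finally show ?thesis .
  qed
  then have "\<bar>Im z\<bar> * Iup \<le> sqrt (\<Lambda>\<^sup>2 * (cs * X))"
    by (intro real_le_rsqrt) (simp add: mult_ac)
  also have "\<dots> = \<Lambda> * sqrt (cs * X)" using \<Lambda>(1) by (simp add: real_sqrt_mult)
  finally have t: "\<bar>Im z\<bar> * Iup \<le> \<Lambda> * sqrt (cs * X)" .
  have "?np \<le> sqrt (cs * X)" by (rule real_le_rsqrt[OF np])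
  with t Ifp have "\<bar>Im z\<bar> * Iup + Ifp \<le> (\<Lambda> + 1) * sqrt (cs * X)" by (simp add: algebra_simps)
  from mult_left_mono[OF this D] have "X \<le> D * ((\<Lambda> + 1) * sqrt (cs * X))"
    by (simp only: X_def)
  then have "sqrt X * sqrt X \<le> (D * (\<Lambda> + 1) * sqrt cs) * sqrt X"
    using X0 by (simp add: real_sqrt_mult mult_ac)
  \<comment> \<open>Division by \<open>sqrt X\<close> requires \<open>X\<close> to be nonzero;
    otherwise the claim is trivial.\<close>
  have sX: "sqrt X \<le> D * (\<Lambda> + 1) * sqrt cs"
  proof (cases "X = 0")
    case True then show ?thesis using D \<Lambda>(1) cs by simp
  next
    case False
    then have "0 < sqrt X" using X0 by simp
    with \<open>sqrt X * sqrt X \<le> _\<close> show ?thesis by (rule mult_right_le_imp_le)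
  qed
  have "sqrt \<kappa> * ?nu \<le> sqrt (cs * X)"
    by (rule real_le_rsqrt) (use nu \<open>\<kappa> > 0\<close> in \<open>simp add: power_mult_distrib\<close>)
  also have "\<dots> = sqrt cs * sqrt X" by (simp add: real_sqrt_mult)
  also have "\<dots> \<le> sqrt cs * (D * (\<Lambda> + 1) * sqrt cs)"
    using sX cs by (intro mult_left_mono) auto
  also have "\<dots> = D * (\<Lambda> + 1) * cs"
    using cs by (simp add: mult_ac)
  finally have "?nu \<le> D * (\<Lambda> + 1) * cs / sqrt \<kappa>"
    using \<open>\<kappa> > 0\<close> by (simp add: pos_le_divide_eq mult.commute)
  then show ?thesis unfolding D_def cs_def by (simp add: mult_ac)
qed

lemma weighted_solution_bound_large_Im:
  assumes V: "V \<in> borel_measurable lebesgue" "\<And>x. \<bar>V x\<bar> \<le> B" and "h > 0" and g: "g \<in> L2" "L2_norm g \<le> 1"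
    and "s > 0" and ode: "ode V h z (weight s g) u p" and L2: "u \<in> L2" "p \<in> L2" and z: "1 \<le> \<bar>Im z\<bar>"
  shows "L2_norm (weight s u) \<le> 1"
proof -
  note f = weight_L2[OF g(1) \<open>s > 0\<close>]
  have "1 * (L2_norm u)\<^sup>2 \<le> \<bar>Im z\<bar> * (L2_norm u)\<^sup>2" using z by (intro mult_right_mono) auto
  also have "\<dots> \<le> (\<integral>x. cmod (weight s g x) * cmod (u x) \<partial>lebesgue)"
    by (rule ode_Im_bound[OF V \<open>h > 0\<close> f(1) ode L2])
  also have "\<dots> \<le> L2_norm (weight s g) * L2_norm u"
    by (rule L2_Cauchy_Schwarz[OF f(1) L2(1)])
  also have "\<dots> \<le> 1 * L2_norm u"
    using f(2) g(2) by (intro mult_right_mono) (auto simp: L2_norm_nonneg)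
  finally have "L2_norm u * L2_norm u \<le> 1 * L2_norm u" by (simp add: power2_eq_square)
  then have "L2_norm u \<le> 1"
    using L2_norm_nonneg[of u] by (cases "L2_norm u = 0") auto
  then show ?thesis using weight_L2(2)[OF L2(1) \<open>s > 0\<close>] by simp
qed

text \<open>\<open>resolvent\<close> is a choice among solutions that agree almost everywhere, so an
  a priori bound for every solution of the system bounds the operator norm; bijectivity excludes the
  infinite value.\<close>

lemma weighted_resolvent_norm_le:
  assumes V: "V \<in> borel_measurable lebesgue" "\<And>x. \<bar>V x\<bar> \<le> B" and "h > 0" and "s > 0"
    and \<sigma>: "\<sigma> * \<epsilon> \<noteq> 0"
    and le: "\<And>g u p. g \<in> L2 \<Longrightarrow> L2_norm g \<le> 1 \<Longrightarrow> ode V h (Complex E (- \<sigma> * \<epsilon>)) (weight s g) u p \<Longrightarrow>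
      u \<in> L2 \<Longrightarrow> p \<in> L2 \<Longrightarrow> L2_norm (weight s u) \<le> C"
  shows "weighted_resolvent_norm \<sigma> V E s h \<epsilon> \<le> ereal C"
proof -
  let ?z = "Complex E (- \<sigma> * \<epsilon>)"
  have bij: "shift_bijective V h ?z"
    by (rule shift_bijective_if_Im_nonzero[OF V \<open>h > 0\<close>]) (use \<sigma> in simp)
  have "L2_norm (weight s (resolvent V h ?z (weight s g))) \<le> C" if g: "g \<in> L2" "L2_norm g \<le> 1" for g
  proof -
    have "weight s g \<in> L2" by (rule weight_L2[OF g(1) \<open>s > 0\<close>])
    then have "\<exists>u. resolvent_eq V h ?z (weight s g) u"
      using bij by (simp add: shift_bijective_def)
    then have "resolvent_eq V h ?z (weight s g) (resolvent V h ?z (weight s g))"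
      unfolding resolvent_def by (rule someI_ex)
    from ode_if_resolvent_eq[OF \<open>h > 0\<close> this] obtain u p where
      u: "ode V h ?z (weight s g) u p" "u \<in> L2" "p \<in> L2" "AE x in lebesgue. resolvent V h ?z (weight s g) x = u x"
      by blast
    have "AE x in lebesgue. weight s u x = weight s (resolvent V h ?z (weight s g)) x"
      using u(4) by eventually_elim (simp add: weight_def)
    from L2_norm_cong_AE[OF weight_L2(1)[OF u(2) \<open>s > 0\<close>] this] show ?thesis
      using le[OF g u(1-3)] by simp
  qed
  then show ?thesis
    using bij by (auto simp: weighted_resolvent_norm_def L2_operator_norm_def intro!: SUP_least)
qed

subsection \<open>An absolutely continuous replacement of the potential\<close>

lemma primitive_shift:
  fixes f :: "real \<Rightarrow> 'a::euclidean_space"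
  assumes F: "primitive F f"
  shows "primitive (\<lambda>x. F (x + c)) (\<lambda>x. f (x + c))"
  unfolding primitive_def
proof (intro allI impI conjI)
  fix a b :: real assume "a \<le> b"
  let ?g = "\<lambda>x. indicator {a + c..b + c} x *\<^sub>R f x"
  have eq: "?g (c + 1 * x) = indicator {a..b} x *\<^sub>R f (x + c)" for x
    by (auto simp: add.commute split: split_indicator)
  have g: "integrable lebesgue ?g"
    using primitiveD(1)[OF F] by (simp add: set_integrable_def)
  from lebesgue_integrable_real_affine[OF this, of 1 c]
  have si: "set_integrable lebesgue {a..b} (\<lambda>x. f (x + c))"
    unfolding set_integrable_def eq by simp
  then show "(\<lambda>x. f (x + c)) absolutely_integrable_on {a..b}" .
  have "F (b + c) - F (a + c) = (\<integral>x. ?g x \<partial>lebesgue)"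
    using primitive_increment_eq_lebesgue[OF F, of "a + c" "b + c"] \<open>a \<le> b\<close> by simp
  also have "\<dots> = (LINT x:{a..b}|lebesgue. f (x + c))"
    using lebesgue_integral_real_affine[of 1 ?g c] unfolding eq by (simp add: set_lebesgue_integral_def)
  finally show "((\<lambda>x. f (x + c)) has_integral F (b + c) - F (a + c)) {a..b}"
    using has_integral_set_lebesgue[OF si] by simp
qed

text \<open>\<open>W x\<close> is the average of \<open>max \<kappa> (E - V)\<close> over \<open>[x, x + \<theta>]\<close>.\<close>

lemma averaged_potential:
  fixes V \<mu> :: "real \<Rightarrow> real"
  assumes V: "V \<in> borel_measurable lebesgue" "\<And>x. \<bar>V x\<bar> \<le> B" and "\<theta> > 0" and "\<kappa> > 0"
    and osc: "\<And>x y. x \<noteq> 0 \<Longrightarrow> 0 < y \<Longrightarrow> y \<le> \<theta> \<Longrightarrow> \<bar>V x - V (x + y)\<bar> \<le> \<mu> x"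
  obtains W w where "primitive W w" "\<And>x. \<kappa> \<le> W x" "\<And>x. W x \<le> \<kappa> + \<bar>E\<bar> + B"
    "\<And>x. x \<noteq> 0 \<Longrightarrow> \<bar>w x\<bar> \<le> \<mu> x / \<theta>" "\<And>x. x \<noteq> 0 \<Longrightarrow> \<bar>W x - max \<kappa> (E - V x)\<bar> \<le> \<mu> x"
proof -
  define q where "q x = max \<kappa> (E - V x)" for x
  have qb: "\<kappa> \<le> q x" "q x \<le> \<kappa> + \<bar>E\<bar> + B" for x
    using V(2)[of x] \<open>\<kappa> > 0\<close> by (auto simp: q_def)
  \<comment> \<open>Truncation is 1-Lipschitz and inherits the oscillation bound.\<close>
  have qV: "\<bar>q x - q y\<bar> \<le> \<bar>V x - V y\<bar>" for x y by (auto simp: q_def)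
  have "q absolutely_integrable_on {a..b}" for a b
  proof (rule measurable_bounded_by_integrable_imp_absolutely_integrable)
    have "q \<in> borel_measurable lebesgue" using V(1) by (simp add: q_def[abs_def])
    then show "q \<in> borel_measurable (lebesgue_on {a..b})" by (rule measurable_restrict_space1)
    show "(\<lambda>x. \<kappa> + \<bar>E\<bar> + B) integrable_on {a..b}" by (rule integrable_const_ivl)
    show "norm (q x) \<le> \<kappa> + \<bar>E\<bar> + B" for x using qb[of x] \<open>\<kappa> > 0\<close> by simp
  qed auto
  then obtain Q where Q: "primitive Q q" using primitive_exists by blast
  have line: "primitive (\<lambda>x. c * x) (\<lambda>x. c)" for c :: real
    by (rule primitive_of_derivative) (auto intro!: derivative_eq_intros)
  \<comment> \<open>The window lies to the right of \<open>x\<close> because \<open>osc\<close>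
    compares \<open>V x\<close> with values at \<open>x + y\<close> for \<open>y > 0\<close>, with a
    bound depending on \<open>x\<close> only.\<close>
  define W where "W x = 1 / \<theta> * (Q (x + \<theta>) - Q x)" for x
  define w where "w x = 1 / \<theta> * (q (x + \<theta>) - q x)" for x
  have avg: "W x \<in> {c..d}" if "\<And>t. x \<le> t \<Longrightarrow> t \<le> x + \<theta> \<Longrightarrow> c \<le> q t \<and> q t \<le> d" for c d x
  proof -
    have "x \<le> x + \<theta>" using \<open>\<theta> > 0\<close> by simp
    from primitive_mono[OF line Q this, of c] primitive_mono[OF Q line this, of d] that
    have "c * \<theta> \<le> Q (x + \<theta>) - Q x" "Q (x + \<theta>) - Q x \<le> d * \<theta>"
      by (simp_all add: distrib_left)
    then show ?thesis using \<open>\<theta> > 0\<close> by (simp add: W_def field_simps)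
  qed
  show ?thesis
  proof
    show "primitive W w"
      unfolding W_def[abs_def] w_def[abs_def] by (intro primitive_cmult primitive_diff primitive_shift Q)
    show "\<kappa> \<le> W x" "W x \<le> \<kappa> + \<bar>E\<bar> + B" for x
      using avg[of x \<kappa> "\<kappa> + \<bar>E\<bar> + B"] qb by auto
    fix x :: real assume x: "x \<noteq> 0"
    have "\<bar>q (x + \<theta>) - q x\<bar> \<le> \<mu> x"
      using qV[of x "x + \<theta>"] osc[OF x \<open>\<theta> > 0\<close>] by (simp add: abs_minus_commute)
    then show "\<bar>w x\<bar> \<le> \<mu> x / \<theta>"
      using \<open>\<theta> > 0\<close> by (simp add: w_def abs_mult divide_right_mono)
    have "\<mu> x \<ge> 0" using osc[OF x \<open>\<theta> > 0\<close>] by (simp add: order_trans[OF abs_ge_zero])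
    have "\<bar>q x - q t\<bar> \<le> \<mu> x" if "x \<le> t" "t \<le> x + \<theta>" for t
      using qV[of x t] osc[OF x, of "t - x"] that \<open>\<mu> x \<ge> 0\<close> by (cases "t = x") auto
    then have "W x \<in> {q x - \<mu> x..q x + \<mu> x}"
      by (intro avg) (force simp: abs_le_iff)
    then show "\<bar>W x - max \<kappa> (E - V x)\<bar> \<le> \<mu> x" by (auto simp: q_def)
  qed
qed

section \<open>Consequences of the conditions on \<open>m0\<close> and on the potential\<close>

lemma even_extension_integrable:
  fixes m :: "real \<Rightarrow> real"
  assumes "m absolutely_integrable_on {0<..}"
  shows "integrable lebesgue (\<lambda>x. if x = 0 then 0 else m \<bar>x\<bar>)"
proof -
  let ?g = "\<lambda>x. indicator {0<..} x *\<^sub>R m x"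
  have g: "integrable lebesgue ?g" using assms by (simp add: set_integrable_def)
  have "integrable lebesgue (\<lambda>x. ?g x + ?g (0 + (- 1) * x))"
    by (intro Bochner_Integration.integrable_add g lebesgue_integrable_real_affine) simp
  moreover have "?g x + ?g (0 + (- 1) * x) = (if x = 0 then 0 else m \<bar>x\<bar>)" for x
    by (cases x "0 :: real" rule: linorder_cases) auto
  ultimately show ?thesis by simp
qed

text \<open>Truncating \<open>w\<close> between \<open>- k\<close> and \<open>k\<close> changes it
  on a null set only and makes the comparison pointwise. The lemma supplies the uniform bound on the
  oscillation of the averaged potential.\<close>

lemma primitive_increment_le_total_AE:
  fixes k :: "real \<Rightarrow> real"
  assumes W: "primitive W w" and k: "integrable lebesgue k" "\<And>x. 0 \<le> k x" and ae: "AE x in lebesgue. \<bar>w x\<bar> \<le> k x"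
  shows "W y - W x \<le> (\<integral>x. k x \<partial>lebesgue)"
proof -
  obtain K where K: "primitive K k"
    using primitive_exists integrable_lebesgue_locally_integrable[OF k(1)]
    unfolding locally_integrable_def by blast
  define w' where "w' x = max (- k x) (min (w x) (k x))" for x
  have W': "primitive W w'"
  proof (rule primitive_cong_AE[OF W])
    show "AE x in lebesgue. w x = w' x" using ae by eventually_elim (auto simp: w'_def)
  qed
  have *: "norm (w' t) \<le> k t" for t using k(2)[of t] by (auto simp: w'_def)
  have "W y - W x \<le> \<bar>K y - K x\<bar>"
  proof (cases "x \<le> y")
    case True
    from primitive_increment_norm_le[OF W' K this] * show ?thesis by simp
  next
    case False
    then have "y \<le> x" by simp
    from primitive_increment_norm_le[OF W' K this] * show ?thesis by simp
  qed
  also have "\<dots> \<le> (\<integral>x. k x \<partial>lebesgue)"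
    using primitive_increment_le_total[OF K k, of y x] primitive_increment_le_total[OF K k, of x y] by linarith
  finally show ?thesis .
qed

text \<open>A length below the infimum does not belong to the set that defines it. The inequality
  \<open>y < \<delta>\<close> is strict, as the infimum might be attained at
  \<open>\<delta>\<close>.\<close>

lemma oscillation_le_if_delta0:
  assumes "ereal \<delta> \<le> delta0 m0 c0 V" "0 < y" "y < \<delta>" "x \<noteq> 0" "0 < m0 \<bar>x\<bar>"
  shows "\<bar>V x - V (x + y)\<bar> \<le> 2 * c0 * m0 \<bar>x\<bar>"
proof -
  have "\<not> relative_oscillation m0 V y > ereal (2 * c0)"
  proof
    assume "relative_oscillation m0 V y > ereal (2 * c0)"
    then have "delta0 m0 c0 V \<le> ereal y"
      unfolding delta0_def using assms(2) by (intro INF_lower) simp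
    then show False using assms(1,3) by (metis ereal_less_eq(3) not_le order_trans)
  qed
  then have "ereal (\<bar>V x - V (x + y)\<bar> / m0 \<bar>x\<bar>) \<le> ereal (2 * c0)"
    unfolding relative_oscillation_def using assms(4) by (auto simp: not_less SUP_le_iff)
  then show ?thesis using assms(5) by (simp add: pos_divide_le_eq)
qed

text \<open>Raising \<open>V_infinity V\<close> to \<open>E_inf\<close> only raises the threshold,
  so the radius also serves for the explicit level.\<close>

lemma potential_le_outside_R_energy:
  assumes "R_energy E V \<le> ereal R" "V_infinity V \<le> ereal E_inf" "R < \<bar>x\<bar>"
  shows "V x \<le> (E + 3 * E_inf) / 4"
proof -
  have "\<not> ereal (V x) > (ereal E + 3 * V_infinity V) / 4"
  proof
    assume "ereal (V x) > (ereal E + 3 * V_infinity V) / 4"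
    then have "ereal \<bar>x\<bar> \<le> R_energy E V"
      unfolding R_energy_def by (intro Sup_upper) blast
    then show False using assms(1,3) by (metis ereal_less_eq(3) not_le order_trans)
  qed
  then have "ereal (V x) \<le> (ereal E + 3 * V_infinity V) / 4" by simp
  also have "\<dots> \<le> (ereal E + 3 * ereal E_inf) / 4"
    by (intro ereal_divide_right_mono add_left_mono ereal_mult_left_mono assms(2)) auto
  also have "\<dots> = ereal ((E + 3 * E_inf) / 4)"
    by simp
  finally show ?thesis by simp
qed

theorem theorem3:
  fixes m0 :: "real \<Rightarrow> real" and c0 R_E C_V E_inf E :: real
  assumes "\<And>r. 0 < r \<Longrightarrow> 0 < m0 r \<and> m0 r \<le> 1"
    and "m0 absolutely_integrable_on {0<..}"
    and "0 < c0" and "0 < R_E" and "E_inf < E"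
  shows "\<exists>C>0. \<forall>\<delta>0>0. \<exists>h0\<in>{0<..1}. \<forall>s>1/2. \<exists>C_s>0. \<forall>V :: real \<Rightarrow> real.
           V \<in> borel_measurable lebesgue \<longrightarrow> bounded (range V) \<longrightarrow>
           Limsup (at 0) (relative_oscillation m0 V) \<le> ereal c0 \<longrightarrow>
           ereal \<delta>0 \<le> delta0 m0 c0 V \<longrightarrow>
           (SUP x. V x) \<le> C_V \<longrightarrow>
           V_infinity V \<le> ereal E_inf \<longrightarrow>
           R_energy E V \<le> ereal R_E \<longrightarrow>
           (\<forall>\<sigma>\<in>{1, -1}. \<forall>\<epsilon>>0. \<forall>h\<in>{0<..h0}.
              weighted_resolvent_norm \<sigma> V E s h \<epsilon> \<le> ereal (C_s * exp (C * h powi (-1))))"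
proof -
  define \<kappa> where "\<kappa> = 3 / 4 * (E - E_inf)"
  have \<kappa>: "\<kappa> > 0" using \<open>E_inf < E\<close> by (simp add: \<kappa>_def)
  \<comment> \<open>The value at 0 is set to 0, as \<open>m0\<close> is meaningful for positive
    arguments only.\<close>
  define m where "m x = (if x = 0 then 0 else m0 \<bar>x\<bar>)" for x
  have m: "integrable lebesgue m"
    unfolding m_def[abs_def] by (rule even_extension_integrable[OF assms(2)])
  have m01: "0 \<le> m x" "m x \<le> 1" for x
    using assms(1)[of "\<bar>x\<bar>"] by (auto simp: m_def)
  \<comment> \<open>Where the truncation acts, it raises \<open>E - V\<close> by at most
    \<open>\<kappa> - E + C_V\<close>; elsewhere it changes nothing, which the maximum with 0
    covers.\<close>
  define D where "D = max 0 (\<kappa> - E + C_V)"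
  \<comment> \<open>The averaging error plus the truncation error, divided by the lower bound
    \<open>sqrt \<kappa>\<close> of \<open>sqrt (W x)\<close>.\<close>
  define r2 where "r2 x = (2 * c0 * m x + D * indicator {-R_E..R_E} x) / sqrt \<kappa>" for x
  have r2: "integrable lebesgue r2" "\<And>x. 0 \<le> r2 x"
  proof -
    have "integrable lebesgue (indicat_real {-R_E..R_E})"
      by (intro integrable_real_indicator) (auto simp: emeasure_lborel_Icc_eq)
    then show "integrable lebesgue r2"
      unfolding r2_def[abs_def] using m by simp
    show "0 \<le> r2 x" for x
      using m01[of x] \<open>0 < c0\<close> \<kappa> by (simp add: r2_def D_def)
  qed
  define A2 where "A2 = (\<integral>x. r2 x \<partial>lebesgue)"
  have A2: "0 \<le> A2" unfolding A2_def by (intro Bochner_Integration.integral_nonneg r2)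
  have ae0: "AE x in lebesgue. x \<noteq> (0::real)"
    by (rule AE_I'[of "{0}"]) (auto simp: negligible_iff_null_sets[symmetric])
  show ?thesis
  \<comment> \<open>\<open>A2\<close> is the integral of the rate paid with \<open>1 / h\<close>;
    the additional 1 absorbs the prefactor through \<open>1 / h \<le> exp (1 / h)\<close>.\<close>
  proof (intro exI[of _ "A2 + 1"] conjI allI impI)
    show "0 < A2 + 1" using A2 by simp
    fix \<delta>0 :: real assume "\<delta>0 > 0"
    \<comment> \<open>Half, because the oscillation bound needs lengths strictly below
      \<open>\<delta>0\<close>.\<close>
    define \<theta> where "\<theta> = \<delta>0 / 2"
    have \<theta>: "0 < \<theta>" "\<theta> < \<delta>0" using \<open>\<delta>0 > 0\<close> by (auto simp: \<theta>_def)
    define k where "k x = 2 * c0 * m x / \<theta>" for x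
    define r1 where "r1 x = k x / \<kappa>" for x
    have k: "integrable lebesgue k" "\<And>x. 0 \<le> k x"
      unfolding k_def[abs_def] using m m01 \<open>0 < c0\<close> \<theta> by auto
    have r1: "integrable lebesgue r1" "\<And>x. 0 \<le> r1 x"
      unfolding r1_def[abs_def] using k \<kappa> by auto
    define K where "K = (\<integral>x. k x \<partial>lebesgue)"
    have K: "0 \<le> K" unfolding K_def by (intro Bochner_Integration.integral_nonneg k)
    define A1 where "A1 = (\<integral>x. r1 x \<partial>lebesgue)"
    \<comment> \<open>Chosen so that \<open>W x \<ge> \<kappa>\<close> makes
      \<open>\<Lambda>\<^sup>2 * W x\<close> at least
      \<open>W x + (2 * K + 2 * c0 + 1)\<close>.\<close>
    define \<Lambda> where "\<Lambda> = sqrt (1 + (2 * K + 2 * c0 + 1) / \<kappa>)"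
    have \<Lambda>: "0 \<le> \<Lambda>" "\<Lambda>\<^sup>2 = 1 + (2 * K + 2 * c0 + 1) / \<kappa>"
      using K \<kappa> \<open>0 < c0\<close> by (simp_all add: \<Lambda>_def)
    show "\<exists>h0\<in>{0<..1}. \<forall>s>1/2. \<exists>C_s>0. \<forall>V :: real \<Rightarrow> real.
           V \<in> borel_measurable lebesgue \<longrightarrow> bounded (range V) \<longrightarrow>
           Limsup (at 0) (relative_oscillation m0 V) \<le> ereal c0 \<longrightarrow>
           ereal \<delta>0 \<le> delta0 m0 c0 V \<longrightarrow>
           (SUP x. V x) \<le> C_V \<longrightarrow>
           V_infinity V \<le> ereal E_inf \<longrightarrow>
           R_energy E V \<le> ereal R_E \<longrightarrow>
           (\<forall>\<sigma>\<in>{1, -1}. \<forall>\<epsilon>>0. \<forall>h\<in>{0<..h0}.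
              weighted_resolvent_norm \<sigma> V E s h \<epsilon> \<le> ereal (C_s * exp ((A2 + 1) * h powi (-1))))"
    \<comment> \<open>\<open>h0 = 1\<close> works for every \<open>\<delta>0\<close>, as the cost of
      averaging has gone into \<open>C_s\<close>.\<close>
    proof (rule bexI[of _ 1], intro allI impI)
      fix s :: real assume s: "s > 1/2"
      define cs where "cs = (\<integral>x. (japanese_bracket x powr (- s))\<^sup>2 \<partial>lebesgue)"
      have cs: "0 \<le> cs" unfolding cs_def by simp
      define G where "G = 2 * exp A1 * (\<Lambda> + 1) * cs / sqrt \<kappa>"
      have G: "0 \<le> G" using cs \<Lambda>(1) \<kappa> by (simp add: G_def)
      show "\<exists>C_s>0. \<forall>V :: real \<Rightarrow> real.
           V \<in> borel_measurable lebesgue \<longrightarrow> bounded (range V) \<longrightarrow>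
           Limsup (at 0) (relative_oscillation m0 V) \<le> ereal c0 \<longrightarrow>
           ereal \<delta>0 \<le> delta0 m0 c0 V \<longrightarrow>
           (SUP x. V x) \<le> C_V \<longrightarrow>
           V_infinity V \<le> ereal E_inf \<longrightarrow>
           R_energy E V \<le> ereal R_E \<longrightarrow>
           (\<forall>\<sigma>\<in>{1, -1}. \<forall>\<epsilon>>0. \<forall>h\<in>{0<..1}.
              weighted_resolvent_norm \<sigma> V E s h \<epsilon> \<le> ereal (C_s * exp ((A2 + 1) * h powi (-1))))"
      \<comment> \<open>The summand 1 makes the constant positive and covers
        \<open>\<epsilon> > 1\<close>, where the norm is at most 1.\<close>
      proof (rule exI[of _ "G + 1"], intro conjI allI impI ballI)
        show "0 < G + 1" using G by simp
        fix V :: "real \<Rightarrow> real" and \<sigma> \<epsilon> h :: real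
        assume V: "V \<in> borel_measurable lebesgue" and "bounded (range V)"
          and \<delta>: "ereal \<delta>0 \<le> delta0 m0 c0 V" and sup: "(SUP x. V x) \<le> C_V"
          and inf: "V_infinity V \<le> ereal E_inf" and R: "R_energy E V \<le> ereal R_E"
          and \<sigma>: "\<sigma> \<in> {1, -1}" and \<epsilon>: "\<epsilon> > 0" and h': "h \<in> {0<..1}"
        have h: "h > 0" "h \<le> 1" using h' by auto
        obtain B where B: "\<And>x. \<bar>V x\<bar> \<le> B"
          using \<open>bounded (range V)\<close> by (auto simp: bounded_iff)
        have VC: "V x \<le> C_V" for x
        proof -
          have "V x \<le> (SUP x. V x)"
            using \<open>bounded (range V)\<close> by (intro cSUP_upper bounded_imp_bdd_above) auto
          then show ?thesis using sup by simp
        qed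
        have osc: "\<bar>V x - V (x + y)\<bar> \<le> 2 * c0 * m x" if "x \<noteq> 0" "0 < y" "y \<le> \<theta>" for x y
          using oscillation_le_if_delta0[OF \<delta>, of y x] assms(1)[of "\<bar>x\<bar>"] that \<theta>(2)
          by (simp add: m_def)
        obtain W w where W: "primitive W w" "\<And>x. \<kappa> \<le> W x" "\<And>x. W x \<le> \<kappa> + \<bar>E\<bar> + B"
            and w: "\<And>x. x \<noteq> 0 \<Longrightarrow> \<bar>w x\<bar> \<le> 2 * c0 * m x / \<theta>"
            and WQ: "\<And>x. x \<noteq> 0 \<Longrightarrow> \<bar>W x - max \<kappa> (E - V x)\<bar> \<le> 2 * c0 * m x"
          using averaged_potential[OF V B \<theta>(1) \<kappa> osc] by blast
        have far: "\<kappa> \<le> E - V x" if "R_E < \<bar>x\<bar>" for x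
          using potential_le_outside_R_energy[OF R inf that] by (simp add: \<kappa>_def)
        have wk: "AE x in lebesgue. \<bar>w x\<bar> \<le> k x"
          using ae0 by eventually_elim (use w in \<open>simp add: k_def\<close>)
        have Winc: "W y - W x \<le> K" for x y
          unfolding K_def by (rule primitive_increment_le_total_AE[OF W(1) k wk])
        have ae1: "AE x in lebesgue. \<bar>w x\<bar> \<le> r1 x * W x"
          using wk
        proof eventually_elim
          case (elim x)
          have "k x = r1 x * \<kappa>" using \<kappa> by (simp add: r1_def)
          also have "\<dots> \<le> r1 x * W x" using W(2) r1(2) by (intro mult_left_mono)
          finally show ?case using elim by simp
        qed
        have ae2: "AE x in lebesgue. \<bar>V x - E + W x\<bar> \<le> r2 x * sqrt (W x)"
          using ae0
        proof eventually_elim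
          case (elim x)
          have "\<bar>V x - E + max \<kappa> (E - V x)\<bar> \<le> D * indicator {-R_E..R_E} x"
          proof (cases "x \<in> {-R_E..R_E}")
            case True
            then show ?thesis using VC[of x] by (auto simp: D_def)
          next
            case False
            then have "R_E < \<bar>x\<bar>" by auto
            then show ?thesis using far[of x] False by simp
          qed
          then have "\<bar>V x - E + W x\<bar> \<le> 2 * c0 * m x + D * indicator {-R_E..R_E} x"
            using WQ[OF elim] by linarith
          also have "\<dots> = r2 x * sqrt \<kappa>" using \<kappa> by (simp add: r2_def)
          also have "\<dots> \<le> r2 x * sqrt (W x)" using W(2) r2(2) by (intro mult_left_mono) auto
          finally show ?case .
        qed
        \<comment> \<open>\<open>W 0 + K\<close> bounds \<open>W\<close> everywhere, and
          \<open>2 * c0\<close> bounds the averaging error since \<open>m x \<le> 1\<close>.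
          \<open>S\<close> depends on \<open>V\<close>, which is harmless because only
          \<open>\<Lambda>\<close> reaches the final constant.\<close>
        define S where "S = W 0 + K + 2 * c0"
        have S0: "0 \<le> S" using W(2)[of 0] \<kappa> K \<open>0 < c0\<close> by (simp add: S_def)
        have aeS: "AE x in lebesgue. E - V x \<le> S"
          using ae0
        proof eventually_elim
          case (elim x)
          have "E - V x \<le> W x + 2 * c0 * m x" using WQ[OF elim] by linarith
          also have "\<dots> \<le> W x + 2 * c0" using m01(2)[of x] \<open>0 < c0\<close> by simp
          also have "\<dots> \<le> S" using Winc[of x 0] by (simp add: S_def)
          finally show ?case .
        qed
        have S\<Lambda>: "S + 1 \<le> \<Lambda>\<^sup>2 * W x" for x
        proof -
          have "S + 1 \<le> W x + (2 * K + 2 * c0 + 1)" using Winc[of 0 x] by (simp add: S_def)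
          also have "(2 * K + 2 * c0 + 1) \<le> (2 * K + 2 * c0 + 1) / \<kappa> * W x"
            using mult_left_mono[OF W(2)[of x], of "(2 * K + 2 * c0 + 1) / \<kappa>"] K \<kappa> \<open>0 < c0\<close> by simp
          finally show ?thesis unfolding \<Lambda>(2) by (simp add: distrib_right)
        qed
        have hinv: "h powi (-1) = 1 / h" by (simp add: power_int_minus divide_inverse)
        have exp1: "1 \<le> exp ((A2 + 1) * (1 / h))" using A2 h by simp
        show "weighted_resolvent_norm \<sigma> V E s h \<epsilon> \<le> ereal ((G + 1) * exp ((A2 + 1) * h powi (-1)))"
          unfolding hinv
        proof (rule weighted_resolvent_norm_le[OF V B h(1)])
          show "s > 0" using s by simp
          show "\<sigma> * \<epsilon> \<noteq> 0" using \<sigma> \<epsilon> by auto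
          fix g u p
          let ?z = "Complex E (- \<sigma> * \<epsilon>)"
          assume g: "g \<in> L2" "L2_norm g \<le> 1" and ode: "ode V h ?z (weight s g) u p" and up: "u \<in> L2" "p \<in> L2"
          have Imz: "\<bar>Im ?z\<bar> = \<epsilon>" using \<sigma> \<epsilon> by auto
          show "L2_norm (weight s u) \<le> (G + 1) * exp ((A2 + 1) * (1 / h))"
          proof (cases "\<epsilon> \<le> 1")
            case True
            have "L2_norm (weight s u) \<le> 2 / h * exp (A1 + A2 / h) * (\<Lambda> + 1) * cs / sqrt \<kappa>"
              unfolding A1_def A2_def cs_def
              by (rule weighted_solution_bound[OF V B h(1) g s ode up _ W \<kappa> r1 r2 ae1 _ S0 _ \<Lambda>(1) S\<Lambda>])
                 (use Imz True ae2 aeS in auto)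
            also have "\<dots> = G * (1 / h * exp (A2 / h))" by (simp add: G_def exp_add mult_ac)
            also have "\<dots> \<le> G * (exp (1 / h) * exp (A2 / h))"
            proof -
              have "1 / h \<le> exp (1 / h)" using exp_ge_add_one_self[of "1 / h"] by linarith
              then show ?thesis using G by (intro mult_left_mono mult_right_mono) auto
            qed
            also have "exp (1 / h) * exp (A2 / h) = exp ((A2 + 1) * (1 / h))"
              by (simp add: exp_add[symmetric] add_divide_distrib add.commute)
            also have "G * exp ((A2 + 1) * (1 / h)) \<le> (G + 1) * exp ((A2 + 1) * (1 / h))"
              by (intro mult_right_mono) auto
            finally show ?thesis .
          next
            case False
            have "L2_norm (weight s u) \<le> 1"
              by (rule weighted_solution_bound_large_Im[OF V B h(1) g _ ode up]) (use s Imz False in auto)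
            also have "1 \<le> (G + 1) * exp ((A2 + 1) * (1 / h))"
              using mult_mono[of 1 "G + 1" 1 "exp ((A2 + 1) * (1 / h))"] G exp1 by simp
            finally show ?thesis .
          qed
        qed
      qed
    qed simp
  qed
qed

end
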